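(* Let $\mathbf A\in\mathbb R^{n\times n}$ be symmetric with $\|\mathbf A\|_\infty\le1$ and eigenvalues $\lambda_1(\mathbf A)\ge\dots\ge\lambda_n(\mathbf A)$. For any $\epsilon,\delta\in(0,1)$, there is a (randomized) algorithm that reads $\tilde O\left(\frac{\log^3 n}{\epsilon^5\delta}\right)$ entries of $\mathbf A$ and returns, with probability at least $1-\delta$, values $\tilde\lambda_i(\mathbf A)$ for each $i\in[n]$ satisfying $|\tilde\lambda_i(\mathbf A)-\lambda_i(\mathbf A)|\le\epsilon n$.
   Context: $[n]=\{1,\dots,n\}$; $\|\mathbf A\|_\infty$ is the largest magnitude of an entry. $\tilde O(f)$ hides logarithmic factors in the argument, i.e. it means at most $C f\cdot(\max\{1,\log f\})^{C}$ for an absolute constant $C$; $\log^3 n=(\log n)^3$ with $\log x$ read as $\max\{1,\ln x\}$. The algorithm is given $n,\epsilon,\delta$ and query access to the entries of the unknown matrix $\mathbf A$; its complexity is the number of entries it queries. *)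

theory Defs
  imports
    "HOL-Probability.Probability_Mass_Function"
    "Jordan_Normal_Form.Char_Poly"
begin

text \<open>
  A deterministic adaptive algorithm with oracle access to a real matrix is a decision tree:
  it either stops with an output or queries an entry, the answer selecting the subtree.
  A randomized one is a probability distribution over such trees. Indices are 0-based.
\<close>

datatype 'r query_alg =
    Return 'r
  | Query nat nat "real \<Rightarrow> 'r query_alg"

primrec run :: "real mat \<Rightarrow> 'r query_alg \<Rightarrow> 'r" where
  "run A (Return r) = r"
| "run A (Query i j k) = run A (k (A $$ (i, j)))"

text \<open>
  Repeated queries to the same entry are counted every time.
\<close>

primrec num_queries :: "real mat \<Rightarrow> 'r query_alg \<Rightarrow> nat" where
  "num_queries A (Return r) = 0"
| "num_queries A (Query i j k) = Suc (num_queries A (k (A $$ (i, j))))"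

text \<open>
  Accessing a matrix outside its dimensions yields an unspecified value, so legal trees
  for \<open>n \<times> n\<close> matrices query only indices below \<open>n\<close>.
\<close>

primrec queries_within :: "nat \<Rightarrow> 'r query_alg \<Rightarrow> bool" where
  "queries_within n (Return r) = True"
| "queries_within n (Query i j k) = (i < n \<and> j < n \<and> (\<forall>v. queries_within n (k v)))"

definition max_entry_norm :: "real mat \<Rightarrow> real" where
  "max_entry_norm A = Max (abs ` elements_mat A)"

text \<open>
  Eigenvalues with algebraic multiplicity, in non-increasing order; the list has length
  \<open>n\<close> for a symmetric \<open>n \<times> n\<close> matrix, and position \<open>i\<close> holds \<open>\<lambda>\<^sub>i\<^sub>+\<^sub>1\<close>.
\<close>

definition eigenvalues_desc :: "real mat \<Rightarrow> real list" where
  "eigenvalues_desc A = rev (sorted_list_of_multiset (proots (char_poly A)))"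

definition log1 :: "real \<Rightarrow> real" where
  "log1 x = max 1 (ln x)"

text \<open>
  A quantity is soft-O of \<open>f\<close> if it is at most \<open>soft_O_bound C f\<close> for an absolute constant \<open>C\<close>.
\<close>

definition soft_O_bound :: "real \<Rightarrow> real \<Rightarrow> real" where
  "soft_O_bound C f = C * f * log1 f powr C"

end

theory Submission
  imports Defs "Jordan_Normal_Form.Spectral_Radius" "HOL-Combinatorics.Permutations"
begin

text \<open>
  Pad \<open>A\<close> with zeros and repeatedly halve it: split the indices into pairs and keep a random member of
  each pair, down to a principal submatrix of size \<open>s\<close> with \<open>s\<^sup>2\<close> of order \<open>1 / (\<epsilon>\<^sup>5 \<delta>)\<close>, which is read
  completely. The positive and negative parts of its scaled spectrum estimate those of \<open>A\<close>.

  One halving moves each eigenvalue by a small multiple of \<open>\<eta>\<close>. Write \<open>A = \<Sum>\<^sub>k \<lambda>\<^sub>k u\<^sub>k u\<^sub>k\<^sup>T\<close> and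
  \<open>J = diag (sgn \<lambda>\<^sub>k)\<close>. The doubled submatrix is \<open>X J X\<^sup>T\<close> for a random \<open>X\<close>, and by taking Schur
  complements its number of eigenvalues above \<open>t\<close> is governed by the inertia of \<open>t J - X\<^sup>T X\<close>. Here
  \<open>X\<^sup>T X\<close> is \<open>|\<Lambda>|\<close> plus a Rademacher sum of differences of rank one matrices. Rescaled by the weights
  \<open>|\<lambda>\<^sub>k - t| + \<eta>\<close>, this sum has matrix variance at most \<open>8 \<surd>N / \<eta>\<close> in dimension \<open>N\<close>, so the
  noncommutative Khintchine inequality makes it harmless. The errors of successive halvings
  form a geometric series dominated by the last one, hence no dependence on \<open>n\<close> remains.
\<close>

section \<open>Spectral theorem\<close>

text \<open>Without weights the same variance estimate would give a multiple of N^(3/2), so X^T X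
  would deviate from |\<Lambda>| by about N^(3/4) in operator norm; keeping this below \<epsilon> N
  asks for N of order 1 / \<epsilon>^4, hence about 1 / \<epsilon>^8 entries. Counting eigenvalues
  above a single threshold t tolerates far more: a direction whose \<lambda> is far from t may carry
  an error proportional to |\<lambda> - t|. With these weights and \<eta> of order \<epsilon> N, it
  is enough that N exceeds a multiple of 1 / \<epsilon>^2. The price is one event per threshold.
  Since the eigenvalues are sorted, the thresholds max (\<lambda>_k, 2 \<eta>) suffice, and negative
  eigenvalues are reached through -A; the union bound thus runs over two events per eigenvalue.
  Choosing one index from each pair, rather than sampling indices independently, makes the deviation
  exactly a Rademacher sum with fixed coefficient matrices, to which Khintchine applies without
  symmetrization.\<close>

lemma symmetric_real_eigenvector:
  fixes a :: "nat \<Rightarrow> nat \<Rightarrow> real"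
  assumes n: "n > 0" and sym: "\<And>i j. i < n \<Longrightarrow> j < n \<Longrightarrow> a i j = a j i"
  obtains \<mu> v where "(\<Sum>i<n. (v i)\<^sup>2) = 1" "\<And>i. i < n \<Longrightarrow> (\<Sum>j<n. a i j * v j) = \<mu> * v i"
proof -
  define A where "A = mat n n (\<lambda>(i,j). complex_of_real (a i j))"
  have A: "A \<in> carrier_mat n n" by (simp add: A_def)
  obtain \<mu> where "\<mu> \<in> spectrum A" using spectrum_non_empty[OF A n] by auto
  then obtain z where z: "z \<in> carrier_vec n" "z \<noteq> 0\<^sub>v n" "A *\<^sub>v z = \<mu> \<cdot>\<^sub>v z"
    using A by (auto simp: spectrum_def eigenvalue_def eigenvector_def)
  define y where "y i = vec_index z i" for i
  have eq: "(\<Sum>j<n. of_real (a i j) * y j) = \<mu> * y i" if "i < n" for i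
  proof -
    have "vec_index (A *\<^sub>v z) i = \<mu> * y i" using z that by (simp add: y_def)
    moreover have "vec_index (A *\<^sub>v z) i = (\<Sum>j<n. of_real (a i j) * y j)"
      using z(1) that by (simp add: A_def scalar_prod_def y_def atLeast0LessThan)
    ultimately show ?thesis by simp
  qed
  obtain k where k: "k < n" "y k \<noteq> 0"
    using z(1,2) unfolding y_def by (metis eq_vecI carrier_vecD index_zero_vec)
  define R where "R = (\<Sum>i<n. cnj (y i) * y i)"
  have R: "R = of_real (\<Sum>i<n. (cmod (y i))\<^sup>2)"
    unfolding R_def of_real_sum
    by (intro sum.cong refl) (simp add: complex_norm_square mult.commute flip: of_real_power)
  have Rpos: "(\<Sum>i<n. (cmod (y i))\<^sup>2) > 0"
    by (rule sum_pos2[of _ k]) (use k in auto)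
  define S where "S = (\<Sum>i<n. \<Sum>j<n. cnj (y i) * of_real (a i j) * y j)"
  have S: "S = \<mu> * R"
    unfolding S_def R_def sum_distrib_left
    by (intro sum.cong refl) (simp add: mult.assoc eq flip: sum_distrib_left)
  \<comment> \<open>The form S of a real symmetric matrix equals its own conjugate; since R is
    positive, the eigenvalue is real.\<close>
  have "cnj S = (\<Sum>i<n. \<Sum>j<n. cnj (y j) * of_real (a i j) * y i)"
    unfolding S_def cnj_sum by (intro sum.cong refl) simp
  also have "\<dots> = (\<Sum>j<n. \<Sum>i<n. cnj (y j) * of_real (a i j) * y i)"
    by (rule sum.swap)
  also have "\<dots> = S" unfolding S_def
    by (intro sum.cong refl) (use sym in auto)
  finally have "cnj \<mu> * R = \<mu> * R" using S R by simp
  then have "cnj \<mu> = \<mu>" using R Rpos by (metis mult_cancel_right of_real_eq_0_iff less_irrefl)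
  then obtain m where \<mu>: "\<mu> = of_real m" by (metis Reals_cnj_iff Reals_cases)
  have re: "(\<Sum>j<n. a i j * Re (y j)) = m * Re (y i)" if "i < n" for i
    using arg_cong[OF eq[OF that], of Re] by (simp only: \<mu> Re_sum scaleR_conv_of_real[symmetric] scaleR_complex.simps)
  have im: "(\<Sum>j<n. a i j * Im (y j)) = m * Im (y i)" if "i < n" for i
    using arg_cong[OF eq[OF that], of Im] by (simp only: \<mu> Im_sum scaleR_conv_of_real[symmetric] scaleR_complex.simps)
  \<comment> \<open>As the eigenvalue is real, the real and the imaginary part of \<open>y\<close>
    solve the equation separately; one of them is nonzero at \<open>k\<close>.\<close>
  obtain x where x: "x k \<noteq> 0" "\<And>i. i < n \<Longrightarrow> (\<Sum>j<n. a i j * x j) = m * x i"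
  proof (cases "Re (y k) = 0")
    case True
    then have "Im (y k) \<noteq> 0" using k by (simp add: complex_eq_iff)
    then show ?thesis using im by (intro that[of "\<lambda>i. Im (y i)"]) auto
  next
    case False
    then show ?thesis using re by (intro that[of "\<lambda>i. Re (y i)"]) auto
  qed
  define r where "r = sqrt (\<Sum>i<n. (x i)\<^sup>2)"
  have "(\<Sum>i<n. (x i)\<^sup>2) > 0" by (rule sum_pos2[of _ k]) (use k x in auto)
  then have r: "r > 0" "r\<^sup>2 = (\<Sum>i<n. (x i)\<^sup>2)" by (auto simp: r_def)
  show ?thesis
  proof (rule that[of "\<lambda>i. x i / r" "m"])
    have "(\<Sum>i<n. (x i / r)\<^sup>2) = (\<Sum>i<n. (x i)\<^sup>2) / r\<^sup>2"
      unfolding sum_divide_distrib power_divide ..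
    also have "\<dots> = 1" using r(1) unfolding r(2)[symmetric] by simp
    finally show "(\<Sum>i<n. (x i / r)\<^sup>2) = 1" .
    show "(\<Sum>j<n. a i j * (x j / r)) = m * (x i / r)" if "i < n" for i
    proof -
      have "(\<Sum>j<n. a i j * (x j / r)) = (\<Sum>j<n. a i j * x j) / r"
        unfolding sum_divide_distrib times_divide_eq_right ..
      then show ?thesis using x(2)[OF that] by simp
    qed
  qed
qed

definition orthonormal :: "nat \<Rightarrow> nat \<Rightarrow> (nat \<Rightarrow> nat \<Rightarrow> real) \<Rightarrow> bool" where
  "orthonormal N m u \<longleftrightarrow> (\<forall>k<m. \<forall>l<m. (\<Sum>i<N. u k i * u l i) = (if k = l then 1 else 0))"

text \<open>The number \<open>m\<close> of eigenpairs may be smaller than the dimension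
  \<open>N\<close>, the missing ones standing for eigenvalue 0. A zero-padded matrix can thus keep
  exactly the eigenpairs of the original.\<close>

definition spectral_family ::
    "nat \<Rightarrow> (nat \<Rightarrow> nat \<Rightarrow> real) \<Rightarrow> nat \<Rightarrow> (nat \<Rightarrow> real) \<Rightarrow> (nat \<Rightarrow> nat \<Rightarrow> real) \<Rightarrow> bool" where
  "spectral_family N a m ev u \<longleftrightarrow> orthonormal N m u \<and>
     (\<forall>i<N. \<forall>j<N. a i j = (\<Sum>k<m. ev k * u k i * u k j))"

lemma orthonormalD: "orthonormal N m u \<Longrightarrow> k < m \<Longrightarrow> l < m \<Longrightarrow>
    (\<Sum>i<N. u k i * u l i) = (if k = l then 1 else 0)"
  by (simp add: orthonormal_def)

lemma spectral_family_orthonormal: "spectral_family N a m ev u \<Longrightarrow> orthonormal N m u"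
  by (simp add: spectral_family_def)

lemma spectral_familyD: "spectral_family N a m ev u \<Longrightarrow> i < N \<Longrightarrow> j < N \<Longrightarrow>
    a i j = (\<Sum>k<m. ev k * u k i * u k j)"
  by (simp add: spectral_family_def)

lemma sum_delta_mult_lessThan [simp]:
  fixes f :: "nat \<Rightarrow> 'a :: semiring_1"
  shows "(\<Sum>i<N. (if i = k then 1 else 0) * f i) = (if k < N then f k else 0)"
    and "(\<Sum>i<N. (if k = i then 1 else 0) * f i) = (if k < N then f k else 0)"
    and "(\<Sum>i<N. f i * (if i = k then 1 else 0)) = (if k < N then f k else 0)"
    and "(\<Sum>i<N. f i * (if k = i then 1 else 0)) = (if k < N then f k else 0)"
  by (simp_all add: if_distrib[of "\<lambda>x. _ * x"] if_distrib[of "\<lambda>x. x * _"] cong: if_cong)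

lemma isometry_inner:
  fixes H :: "nat \<Rightarrow> nat \<Rightarrow> real"
  assumes "\<And>j k. j < N \<Longrightarrow> k < N \<Longrightarrow> (\<Sum>i<N. H i j * H i k) = (if j = k then 1 else 0)"
  shows "(\<Sum>i<N. (\<Sum>j<N. H i j * x j) * (\<Sum>k<N. H i k * y k)) = (\<Sum>j<N. x j * y j)"
proof -
  have "(\<Sum>i<N. (\<Sum>j<N. H i j * x j) * (\<Sum>k<N. H i k * y k))
      = (\<Sum>i<N. \<Sum>j<N. \<Sum>k<N. x j * y k * (H i j * H i k))"
    by (simp add: sum_product mult_ac)
  also have "\<dots> = (\<Sum>j<N. \<Sum>i<N. \<Sum>k<N. x j * y k * (H i j * H i k))"
    by (rule sum.swap)
  also have "\<dots> = (\<Sum>j<N. \<Sum>k<N. \<Sum>i<N. x j * y k * (H i j * H i k))"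
    by (intro sum.cong refl sum.swap)
  also have "\<dots> = (\<Sum>j<N. \<Sum>k<N. x j * y k * (if j = k then 1 else 0))"
    by (intro sum.cong refl) (simp add: assms flip: sum_distrib_left)
  also have "\<dots> = (\<Sum>j<N. x j * y j)"
    by (intro sum.cong refl) simp
  finally show ?thesis .
qed

lemma spectral_family_conjugate:
  assumes fam: "spectral_family N b m ev w"
    and H: "\<And>j k. j < N \<Longrightarrow> k < N \<Longrightarrow> (\<Sum>i<N. H i j * H i k) = (if j = k then 1 else 0)"
    and a: "\<And>i j. i < N \<Longrightarrow> j < N \<Longrightarrow> a i j = (\<Sum>k<N. \<Sum>l<N. H i k * b k l * H j l)"
  shows "spectral_family N a m ev (\<lambda>k i. \<Sum>j<N. H i j * w k j)"
  unfolding spectral_family_def orthonormal_def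
proof (intro conjI allI impI)
  fix k l assume "k < m" "l < m"
  then show "(\<Sum>i<N. (\<Sum>j<N. H i j * w k j) * (\<Sum>j<N. H i j * w l j)) = (if k = l then 1 else 0)"
    using orthonormalD[OF spectral_family_orthonormal[OF fam]] by (subst isometry_inner) (auto simp: H)
next
  fix i j assume ij: "i < N" "j < N"
  have "a i j = (\<Sum>p<N. \<Sum>q<N. \<Sum>k<m. ev k * (H i p * w k p) * (H j q * w k q))"
    unfolding a[OF ij]
    by (intro sum.cong refl) (simp add: spectral_familyD[OF fam] sum_distrib_left sum_distrib_right mult_ac)
  also have "\<dots> = (\<Sum>p<N. \<Sum>k<m. \<Sum>q<N. ev k * (H i p * w k p) * (H j q * w k q))"
    by (intro sum.cong refl sum.swap)
  also have "\<dots> = (\<Sum>k<m. \<Sum>p<N. \<Sum>q<N. ev k * (H i p * w k p) * (H j q * w k q))"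
    by (rule sum.swap)
  also have "\<dots> = (\<Sum>k<m. ev k * (\<Sum>p<N. H i p * w k p) * (\<Sum>q<N. H j q * w k q))"
    by (simp add: sum_product sum_distrib_left mult_ac)
  finally show "a i j = (\<Sum>k<m. ev k * (\<Sum>p<N. H i p * w k p) * (\<Sum>q<N. H j q * w k q))" .
qed

text \<open>\<open>H\<close> is the Householder reflection exchanging \<open>v\<close> with the last
  unit vector, along their difference \<open>w\<close>; the usual factor 2 / |w|^2 equals 1 / (1 - v
  n).\<close>

lemma reflection_to_unit_vector:
  fixes v :: "nat \<Rightarrow> real"
  assumes "(\<Sum>i<Suc n. (v i)\<^sup>2) = 1"
  obtains H where "\<And>i j. H i j = H j i" "\<And>i. i \<le> n \<Longrightarrow> H i n = v i"
    "\<And>j k. j < Suc n \<Longrightarrow> k < Suc n \<Longrightarrow> (\<Sum>i<Suc n. H i j * H i k) = (if j = k then 1 else 0)"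
proof -
  \<comment> \<open>For \<open>v n = 1\<close> the quotient is 0 by the convention for division by
    zero, so \<open>H\<close> is the identity. This is as desired, since \<open>v\<close> then is
    the last unit vector.\<close>
  define c where "c = 1 / (1 - v n)"
  define w where "w i = v i - (if i = n then 1 else 0)" for i
  define H where "H i j = (if i = j then 1 else 0) - c * w i * w j" for i j
  have ww: "(\<Sum>i<Suc n. (w i)\<^sup>2) = 2 - 2 * v n"
  proof -
    have "(\<Sum>i<Suc n. (w i)\<^sup>2) = (\<Sum>i<n. (v i)\<^sup>2) + (v n - 1)\<^sup>2" by (simp add: w_def)
    then show ?thesis using assms by (simp add: power2_eq_square algebra_simps)
  qed
  have w0: "w i = 0" if "v n = 1" "i \<le> n" for i
  proof -
    have "(\<Sum>i<Suc n. (w i)\<^sup>2) = 0" using ww that by simp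
    then have "(w i)\<^sup>2 = 0" by (subst (asm) sum_nonneg_eq_0_iff) (use that in auto)
    then show ?thesis by simp
  qed
  have "c * (2 - 2 * v n) = 2" if "v n \<noteq> 1" using that by (simp add: c_def field_simps)
  then have cc: "c * (c * (2 - 2 * v n)) = 2 * c"
    by (cases "v n = 1") (auto simp: c_def)
  show ?thesis
  proof (rule that[of H])
    show "H i j = H j i" for i j by (simp add: H_def)
    show "H i n = v i" if "i \<le> n" for i
    proof (cases "v n = 1")
      case True
      then show ?thesis using w0[OF True that] by (simp add: H_def w_def c_def split: if_splits)
    next
      case False
      then have "c * w n = - 1" by (simp add: c_def w_def field_simps)
      moreover have "H i n = (if i = n then 1 else 0) - (c * w n) * w i"
        by (simp add: H_def mult_ac)
      ultimately show ?thesis by (simp only:) (simp add: w_def)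
    qed
    show "(\<Sum>i<Suc n. H i j * H i k) = (if j = k then 1 else 0)" if "j < Suc n" "k < Suc n" for j k
    proof -
      have "(\<Sum>i<Suc n. H i j * H i k)
          = (\<Sum>i<Suc n. (if i = j then 1 else 0) * (if i = k then 1 else 0))
            - (\<Sum>i<Suc n. (if i = j then 1 else 0) * (c * w i * w k))
            - (\<Sum>i<Suc n. (if i = k then 1 else 0) * (c * w i * w j))
            + (\<Sum>i<Suc n. c * c * w j * w k * (w i)\<^sup>2)"
        unfolding sum_subtractf[symmetric] sum.distrib[symmetric]
        by (intro sum.cong refl) (simp add: H_def algebra_simps power2_eq_square)
      also have "\<dots> = (if j = k then 1 else 0) - 2 * c * w j * w k + c * c * w j * w k * (2 - 2 * v n)"
        using that by (simp only: sum_delta_mult_lessThan ww flip: sum_distrib_left) (simp add: mult_ac)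
      also have "c * c * w j * w k * (2 - 2 * v n) = (c * (c * (2 - 2 * v n))) * w j * w k"
        by (simp only: mult_ac)
      finally show ?thesis using cc by simp
    qed
  qed
qed

text \<open>Deflation: conjugation by a reflection whose last column is an eigenvector clears the
  last row and column off the diagonal, and induction diagonalises the remaining block. The
  reflection is symmetric and orthogonal, hence its own inverse, so the same conjugation leads back
  to \<open>a\<close>.\<close>

theorem spectral_family_exists:
  assumes "\<And>i j. i < n \<Longrightarrow> j < n \<Longrightarrow> a i j = a j i"
  shows "\<exists>ev u. spectral_family n a n ev u"
  using assms
proof (induction n arbitrary: a)
  case 0
  then show ?case by (simp add: spectral_family_def orthonormal_def)
next
  case (Suc n)
  obtain v \<mu> where v: "(\<Sum>i<Suc n. (v i)\<^sup>2) = 1"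
      "\<And>i. i < Suc n \<Longrightarrow> (\<Sum>j<Suc n. a i j * v j) = \<mu> * v i"
    by (rule symmetric_real_eigenvector[of "Suc n" a, OF zero_less_Suc Suc.prems]) (assumption+, rule that)
  obtain H where Hsym: "\<And>i j. H i j = H j i" and Hn: "\<And>i. i \<le> n \<Longrightarrow> H i n = v i"
    and Ho: "\<And>j k. j < Suc n \<Longrightarrow> k < Suc n \<Longrightarrow> (\<Sum>i<Suc n. H i j * H i k) = (if j = k then 1 else 0)"
    using reflection_to_unit_vector[OF v(1)] by blast
  have Ho': "(\<Sum>i<Suc n. H j i * H i k) = (if j = k then 1 else 0)" if "j < Suc n" "k < Suc n" for j k
    using Ho[OF that] by (subst Hsym) 
  define b where "b i j = (\<Sum>k<Suc n. \<Sum>l<Suc n. H i k * a k l * H j l)" for i j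
  have bsym: "b i j = b j i" for i j
  proof -
    have "b i j = (\<Sum>l<Suc n. \<Sum>k<Suc n. H i k * a k l * H j l)"
      unfolding b_def by (rule sum.swap)
    also have "\<dots> = b j i" unfolding b_def
      by (intro sum.cong refl) (use Suc.prems in auto)
    finally show ?thesis .
  qed
  have bn: "b i n = (if i = n then \<mu> else 0)" if "i < Suc n" for i
  proof -
    have "b i n = (\<Sum>k<Suc n. H i k * (\<Sum>l<Suc n. a k l * H n l))"
      by (simp only: b_def sum_distrib_left mult.assoc)
    also have "\<dots> = (\<Sum>k<Suc n. H i k * (\<Sum>l<Suc n. a k l * v l))"
      by (intro sum.cong refl arg_cong2[of _ _ _ _ "(*)"]) (use Hn Hsym in auto)
    also have "\<dots> = (\<Sum>k<Suc n. \<mu> * (H i k * H k n))"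
      by (intro sum.cong refl) (use v(2) Hn in auto)
    also have "\<dots> = \<mu> * (\<Sum>k<Suc n. H i k * H k n)"
      by (rule sum_distrib_left[symmetric])
    finally show ?thesis using Ho'[OF that, of n] by simp
  qed
  obtain ev w where w: "spectral_family n b n ev w" using Suc.IH bsym by blast
  define ev' where "ev' k = (if k < n then ev k else \<mu>)" for k
  define w' where "w' k j = (if k < n then if j < n then w k j else 0 else if j = n then 1 else 0)"
    for k j :: nat
  have "orthonormal (Suc n) (Suc n) w'"
    using orthonormalD[OF spectral_family_orthonormal[OF w]]
    by (simp add: orthonormal_def w'_def less_Suc_eq)
  moreover have "b i j = (\<Sum>k<Suc n. ev' k * w' k i * w' k j)" if "i < Suc n" "j < Suc n" for i j
  proof (cases "i = n \<or> j = n")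
    case True
    then show ?thesis using bn[OF that(1)] bn[OF that(2)] bsym[of n j]
      by (auto simp: ev'_def w'_def)
  next
    case False
    then have "i < n" "j < n" using that by auto
    then show ?thesis by (simp add: spectral_familyD[OF w] ev'_def w'_def)
  qed
  ultimately have fam': "spectral_family (Suc n) b (Suc n) ev' w'"
    by (simp add: spectral_family_def)
  have aeq: "a i j = (\<Sum>k<Suc n. \<Sum>l<Suc n. H i k * b k l * H j l)"
    if ij: "i < Suc n" "j < Suc n" for i j
  proof -
    have "(\<Sum>k<Suc n. \<Sum>l<Suc n. H i k * b k l * H j l)
      = (\<Sum>k<Suc n. \<Sum>l<Suc n. \<Sum>p<Suc n. \<Sum>q<Suc n. (H i k * H k p) * a p q * (H j l * H l q))"
      unfolding b_def sum_distrib_left sum_distrib_right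
      by (intro sum.cong refl) (simp only: mult_ac)
    also have "\<dots> = (\<Sum>k<Suc n. \<Sum>p<Suc n. \<Sum>l<Suc n. \<Sum>q<Suc n. (H i k * H k p) * a p q * (H j l * H l q))"
      by (intro sum.cong refl sum.swap)
    also have "\<dots> = (\<Sum>k<Suc n. \<Sum>p<Suc n. \<Sum>q<Suc n. \<Sum>l<Suc n. (H i k * H k p) * a p q * (H j l * H l q))"
      by (intro sum.cong refl sum.swap)
    also have "\<dots> = (\<Sum>k<Suc n. \<Sum>p<Suc n. \<Sum>q<Suc n. (H i k * H k p) * a p q * (\<Sum>l<Suc n. H j l * H l q))"
      by (simp only: sum_distrib_left)
    also have "\<dots> = (\<Sum>k<Suc n. \<Sum>p<Suc n. \<Sum>q<Suc n. (H i k * H k p) * a p q * (if j = q then 1 else 0))"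
      by (intro sum.cong refl arg_cong2[of _ _ _ _ "(*)"]) (use Ho' ij in auto)
    also have "\<dots> = (\<Sum>k<Suc n. \<Sum>p<Suc n. (H i k * H k p) * a p j)"
      using ij by (simp only: sum_delta_mult_lessThan if_True)
    also have "\<dots> = (\<Sum>p<Suc n. \<Sum>k<Suc n. (H i k * H k p) * a p j)"
      by (rule sum.swap)
    also have "\<dots> = (\<Sum>p<Suc n. (\<Sum>k<Suc n. H i k * H k p) * a p j)"
      by (simp only: sum_distrib_right)
    also have "\<dots> = (\<Sum>p<Suc n. (if i = p then 1 else 0) * a p j)"
      by (intro sum.cong refl arg_cong2[of _ _ _ _ "(*)"]) (use Ho' ij in auto)
    also have "\<dots> = a i j"
      using ij by (simp only: sum_delta_mult_lessThan if_True)
    finally show ?thesis by simp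
  qed
  show ?case
    using spectral_family_conjugate[OF fam' Ho aeq] by blast
qed

section \<open>Spectral decompositions and the roots of the characteristic polynomial\<close>

lemma orthonormal_dual:
  assumes "orthonormal N N u" "i < N" "j < N"
  shows "(\<Sum>k<N. u k i * u k j) = (if i = j then 1 else 0)"
proof -
  define U where "U = mat N N (\<lambda>(k,i). u k i)"
  have U: "U \<in> carrier_mat N N" by (simp add: U_def)
  have "U * transpose_mat U = 1\<^sub>m N"
    by (rule eq_matI)
      (use orthonormalD[OF assms(1)] in \<open>auto simp: U_def scalar_prod_def atLeast0LessThan\<close>)
  then have "transpose_mat U * U = 1\<^sub>m N"
    using mat_mult_left_right_inverse[OF U, of "transpose_mat U"] U by simp
  then have "(transpose_mat U * U) $$ (i, j) = 1\<^sub>m N $$ (i, j)" by simp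
  then show ?thesis using assms by (simp add: U_def scalar_prod_def atLeast0LessThan)
qed

lemma proots_char_poly_spectral_family:
  assumes "spectral_family n a n ev u"
  shows "proots (char_poly (mat n n (\<lambda>(i,j). a i j))) = mset (map ev [0..<n])"
proof -
  define A where "A = mat n n (\<lambda>(i,j). a i j)"
  define D where "D = mat n n (\<lambda>(i,j). if i = j then ev i else 0)"
  define P where "P = mat n n (\<lambda>(i,k). u k i)"
  note orth = spectral_family_orthonormal[OF assms]
  have c: "A \<in> carrier_mat n n" "D \<in> carrier_mat n n" "P \<in> carrier_mat n n"
    by (auto simp: A_def D_def P_def)
  have "P * transpose_mat P = 1\<^sub>m n"
    by (rule eq_matI)
      (use orthonormal_dual[OF orth] in \<open>auto simp: P_def scalar_prod_def atLeast0LessThan\<close>)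
  moreover have "transpose_mat P * P = 1\<^sub>m n"
    by (rule eq_matI)
      (use orthonormalD[OF orth] in \<open>auto simp: P_def scalar_prod_def atLeast0LessThan\<close>)
  moreover have "A = P * D * transpose_mat P"
  proof (rule eq_matI)
    fix i j assume "i < dim_row (P * D * transpose_mat P)" "j < dim_col (P * D * transpose_mat P)"
    then have ij: "i < n" "j < n" using c by auto
    have PD: "(P * D) $$ (i, k) = u k i * ev k" if "k < n" for k
      using ij that by (simp add: P_def D_def scalar_prod_def atLeast0LessThan
          if_distrib[of "\<lambda>x. _ * x"] cong: if_cong)
    have "(P * D * transpose_mat P) $$ (i, j) = (\<Sum>k<n. (P * D) $$ (i, k) * P $$ (j, k))"
      using c ij mult_carrier_mat[OF c(3,2)]
      by (subst index_mult_mat(1)) (auto simp: scalar_prod_def atLeast0LessThan)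
    also have "\<dots> = (\<Sum>k<n. ev k * u k i * u k j)"
      by (intro sum.cong refl) (use ij in \<open>simp add: PD, simp add: P_def\<close>)
    finally show "A $$ (i, j) = (P * D * transpose_mat P) $$ (i, j)"
      using spectral_familyD[OF assms ij] ij by (simp add: A_def)
  qed (use c in auto)
  ultimately have "similar_mat A D"
    using c by (intro similar_matI[of _ _ _ "transpose_mat P" n]) auto
  then have "char_poly A = char_poly D" by (rule char_poly_similar)
  also have "\<dots> = (\<Prod>x\<leftarrow>diag_mat D. [:- x, 1:])"
    by (rule char_poly_upper_triangular[OF c(2)]) (auto simp: D_def)
  also have "diag_mat D = map ev [0..<n]"
    by (auto simp: diag_mat_def D_def)
  finally have cp: "char_poly A = (\<Prod>x\<leftarrow>map ev [0..<n]. [:- x, 1:])" .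
  have "proots (\<Prod>x\<leftarrow>xs. [:- x, 1:]) = mset xs" for xs :: "real list"
  proof (induction xs)
    case (Cons x xs)
    have "(\<Prod>x\<leftarrow>xs. [:- x, 1:]) \<noteq> (0 :: real poly)" by (simp add: prod_list_zero_iff image_iff)
    then show ?case using Cons by (simp add: proots_mult del: mult_pCons_left)
  qed simp
  then have "proots (char_poly A) = mset (map ev [0..<n])" by (simp only: cp)
  then show ?thesis by (simp only: A_def)
qed

text \<open>Bridge between the two notions of spectrum: the sorted roots of the characteristic
  polynomial are a permutation of the eigenvalues of a spectral family, and the eigenvectors can be
  permuted along. Later arguments access \<open>eigenvalues_desc\<close> through these three
  conclusions.\<close>

theorem spectral_family_eigenvalues_desc:
  fixes A :: "real mat"
  assumes A: "A \<in> carrier_mat n n" and sym: "transpose_mat A = A"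
  shows "length (eigenvalues_desc A) = n"
    and "sorted_wrt (\<ge>) (eigenvalues_desc A)"
    and "\<exists>u. spectral_family n (\<lambda>i j. A $$ (i, j)) n (\<lambda>k. eigenvalues_desc A ! k) u"
proof -
  have "A $$ (i, j) = A $$ (j, i)" if "i < n" "j < n" for i j
    using that A arg_cong[OF sym, of "\<lambda>M. M $$ (i, j)"] by simp
  then obtain ev u where fam: "spectral_family n (\<lambda>i j. A $$ (i, j)) n ev u"
    using spectral_family_exists[of n "\<lambda>i j. A $$ (i, j)"] by blast
  have "mat n n (\<lambda>(i,j). A $$ (i, j)) = A" using A by auto
  then have ms: "mset (eigenvalues_desc A) = mset (map ev [0..<n])"
    using proots_char_poly_spectral_family[OF fam] by (simp add: eigenvalues_desc_def)
  show len: "length (eigenvalues_desc A) = n"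
    using arg_cong[OF ms, of size] by simp
  show "sorted_wrt (\<ge>) (eigenvalues_desc A)"
    by (simp add: eigenvalues_desc_def sorted_wrt_rev)
  obtain p where p: "p permutes {..<n}" "permute_list p (map ev [0..<n]) = eigenvalues_desc A"
    using mset_eq_permutation[OF ms] by auto
  have pk: "p k < n" if "k < n" for k using permutes_in_image[OF p(1)] that by auto
  have nth: "eigenvalues_desc A ! k = ev (p k)" if "k < n" for k
    using that pk[OF that] p(1) by (simp add: p(2)[symmetric] permute_list_nth)
  have inj: "p k = p l \<longleftrightarrow> k = l" for k l
    using permutes_inj[OF p(1)] by (auto dest: injD)
  have "spectral_family n (\<lambda>i j. A $$ (i, j)) n (\<lambda>k. eigenvalues_desc A ! k) (\<lambda>k. u (p k))"
    unfolding spectral_family_def orthonormal_def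
  proof (intro conjI allI impI)
    fix k l assume "k < n" "l < n"
    then show "(\<Sum>i<n. u (p k) i * u (p l) i) = (if k = l then 1 else 0)"
      using orthonormalD[OF spectral_family_orthonormal[OF fam]] pk inj by simp
  next
    fix i j assume ij: "i < n" "j < n"
    have "A $$ (i, j) = (\<Sum>k<n. ev k * u k i * u k j)" by (rule spectral_familyD[OF fam ij])
    also have "\<dots> = (\<Sum>k<n. ev (p k) * u (p k) i * u (p k) j)"
      by (rule sum.permute[OF p(1), unfolded o_def])
    also have "\<dots> = (\<Sum>k<n. eigenvalues_desc A ! k * u (p k) i * u (p k) j)"
      by (intro sum.cong refl) (simp add: nth)
    finally show "A $$ (i, j) = (\<Sum>k<n. eigenvalues_desc A ! k * u (p k) i * u (p k) j)" .
  qed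
  then show "\<exists>u. spectral_family n (\<lambda>i j. A $$ (i, j)) n (\<lambda>k. eigenvalues_desc A ! k) u" by blast
qed

section \<open>Noncommutative Khintchine inequality\<close>

definition mat_app :: "nat \<Rightarrow> (nat \<Rightarrow> nat \<Rightarrow> real) \<Rightarrow> (nat \<Rightarrow> real) \<Rightarrow> nat \<Rightarrow> real" where
  "mat_app N a x i = (\<Sum>j<N. a i j * x j)"

definition inner_n :: "nat \<Rightarrow> (nat \<Rightarrow> real) \<Rightarrow> (nat \<Rightarrow> real) \<Rightarrow> real" where
  "inner_n N x y = (\<Sum>i<N. x i * y i)"

lemma inner_n_commute: "inner_n N x y = inner_n N y x"
  by (simp add: inner_n_def mult.commute)

lemma inner_n_nonneg: "inner_n N x x \<ge> 0"
  by (simp add: inner_n_def sum_nonneg)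

lemma inner_n_cong:
  "(\<And>i. i < N \<Longrightarrow> x i = x' i) \<Longrightarrow> (\<And>i. i < N \<Longrightarrow> y i = y' i) \<Longrightarrow> inner_n N x y = inner_n N x' y'"
  by (simp add: inner_n_def)

lemma inner_n_sum_right: "inner_n N x (\<lambda>i. \<Sum>k\<in>K. f k i) = (\<Sum>k\<in>K. inner_n N x (f k))"
  unfolding inner_n_def sum_distrib_left by (rule sum.swap)

lemma inner_n_sum_left: "inner_n N (\<lambda>i. \<Sum>k\<in>K. f k i) x = (\<Sum>k\<in>K. inner_n N (f k) x)"
  by (simp add: inner_n_commute[of N _ x] inner_n_sum_right)

lemma inner_n_scale_right: "inner_n N x (\<lambda>i. c * y i) = c * inner_n N x y"
  by (simp add: inner_n_def sum_distrib_left mult_ac)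

lemma inner_n_scale_left: "inner_n N (\<lambda>i. c * y i) x = c * inner_n N y x"
  by (simp add: inner_n_def sum_distrib_left mult_ac)

lemma orthonormal_inner:
  "orthonormal N m u \<Longrightarrow> k < m \<Longrightarrow> l < m \<Longrightarrow> inner_n N (u k) (u l) = (if k = l then 1 else 0)"
  by (simp add: orthonormal_def inner_n_def)

lemma orthonormal_inner_lincomb:
  assumes "orthonormal N m u"
  shows "inner_n N (\<lambda>i. \<Sum>k<m. c k * u k i) (\<lambda>i. \<Sum>k<m. d k * u k i) = (\<Sum>k<m. c k * d k)"
proof -
  have "inner_n N (\<lambda>i. \<Sum>k<m. c k * u k i) (\<lambda>i. \<Sum>k<m. d k * u k i)
      = (\<Sum>k<m. \<Sum>l<m. c k * (d l * inner_n N (u k) (u l)))"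
    by (simp add: inner_n_sum_left inner_n_sum_right inner_n_scale_left inner_n_scale_right)
  also have "\<dots> = (\<Sum>k<m. \<Sum>l<m. c k * (d l * (if k = l then 1 else 0)))"
    by (intro sum.cong refl) (simp add: orthonormal_inner[OF assms])
  finally show ?thesis by (simp flip: sum_distrib_left)
qed

lemma orthonormal_expansion:
  assumes "orthonormal N N u" "i < N"
  shows "x i = (\<Sum>k<N. inner_n N (u k) x * u k i)"
proof -
  have "(\<Sum>k<N. inner_n N (u k) x * u k i) = (\<Sum>k<N. \<Sum>j<N. x j * (u k i * u k j))"
    unfolding inner_n_def sum_distrib_right by (intro sum.cong refl) simp
  also have "\<dots> = (\<Sum>j<N. x j * (\<Sum>k<N. u k i * u k j))"
    by (subst sum.swap) (simp add: sum_distrib_left)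
  also have "\<dots> = (\<Sum>j<N. x j * (if i = j then 1 else 0))"
    by (intro sum.cong refl) (simp add: orthonormal_dual[OF assms(1) assms(2)])
  finally show ?thesis using assms by simp
qed

lemma spectral_family_app:
  assumes "spectral_family N a m ev u" "i < N"
  shows "mat_app N a x i = (\<Sum>k<m. ev k * inner_n N (u k) x * u k i)"
proof -
  have "mat_app N a x i = (\<Sum>j<N. \<Sum>k<m. ev k * u k i * u k j * x j)"
    by (simp add: mat_app_def spectral_familyD[OF assms(1) assms(2)] sum_distrib_right)
  also have "\<dots> = (\<Sum>k<m. \<Sum>j<N. ev k * u k i * u k j * x j)" by (rule sum.swap)
  finally show ?thesis by (simp add: inner_n_def sum_distrib_left sum_distrib_right mult_ac)
qed

section \<open>A mean value inequality for traces of powers\<close>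

lemma mixed_powers_le:
  fixes x y :: real
  assumes "even n" "p \<le> n"
  shows "x ^ p * y ^ (n - p) + x ^ (n - p) * y ^ p \<le> x ^ n + y ^ n"
proof -
  \<comment> \<open>This product is the right side minus the left side of the claim. As
    \<open>n\<close> is even, \<open>p\<close> and \<open>n - p\<close> have the same parity, so
    both powers increase together: in \<open>x\<close> if odd, in \<open>\<bar>x\<bar>\<close> if
    even.\<close>
  have "(x ^ p - y ^ p) * (x ^ (n - p) - y ^ (n - p)) \<ge> 0"
  proof (cases "even p")
    case True
    then have e: "even (n - p)" using assms by simp
    have "\<bar>x\<bar> ^ p \<le> \<bar>y\<bar> ^ p \<and> \<bar>x\<bar> ^ (n - p) \<le> \<bar>y\<bar> ^ (n - p) \<or>
          \<bar>x\<bar> ^ p \<ge> \<bar>y\<bar> ^ p \<and> \<bar>x\<bar> ^ (n - p) \<ge> \<bar>y\<bar> ^ (n - p)"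
      by (cases "\<bar>x\<bar> \<le> \<bar>y\<bar>") (auto intro: power_mono)
    then show ?thesis using True e by (auto simp: power_even_abs mult_nonneg_nonneg mult_nonpos_nonpos)
  next
    case False
    then have o: "odd (n - p)" using assms by simp
    have "x ^ p \<le> y ^ p \<and> x ^ (n - p) \<le> y ^ (n - p) \<or> x ^ p \<ge> y ^ p \<and> x ^ (n - p) \<ge> y ^ (n - p)"
      using False o by (cases "x \<le> y") (auto intro: power_mono_odd)
    then show ?thesis by (auto simp: mult_nonneg_nonneg mult_nonpos_nonpos)
  qed
  moreover have "x ^ p * x ^ (n - p) = x ^ n" "y ^ p * y ^ (n - p) = y ^ n"
    using assms(2) by (simp_all flip: power_add)
  ultimately show ?thesis by (simp add: algebra_simps)
qed

text \<open>Dividing the difference of powers by \<open>x - y\<close> leaves a sum of mixed powers;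
  averaging it with its reversal groups them into symmetric pairs, each at most
  \<open>x ^ n + y ^ n\<close>.\<close>

lemma power_diff_mean_value:
  fixes x y :: real
  assumes "even n"
  shows "(x - y) * (x ^ Suc n - y ^ Suc n) \<le> Suc n / 2 * ((x - y)\<^sup>2 * (x ^ n + y ^ n))"
proof -
  define s where "s = (\<Sum>p<Suc n. x ^ p * y ^ (n - p))"
  have "s = (\<Sum>p<Suc n. x ^ (n - p) * y ^ p)"
    unfolding s_def by (subst sum.nat_diff_reindex[symmetric]) (auto intro!: sum.cong)
  then have "2 * s = (\<Sum>p<Suc n. x ^ p * y ^ (n - p) + x ^ (n - p) * y ^ p)"
    by (simp add: s_def sum.distrib)
  also have "\<dots> \<le> (\<Sum>p<Suc n. x ^ n + y ^ n)"
    by (intro sum_mono mixed_powers_le assms) auto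
  finally have s: "s \<le> Suc n / 2 * (x ^ n + y ^ n)" by simp
  have "(x - y) * (x ^ Suc n - y ^ Suc n) = (x - y)\<^sup>2 * s"
    unfolding s_def power2_eq_square by (simp only: diff_power_eq_sum mult.assoc)
  also have "\<dots> \<le> (x - y)\<^sup>2 * (Suc n / 2 * (x ^ n + y ^ n))"
    by (intro mult_left_mono s) simp
  finally show ?thesis by (simp add: mult_ac)
qed

text \<open>In the eigenbasis \<open>v\<close> of \<open>Z\<close>, the difference acts on the
  eigenvector \<open>u k\<close> of \<open>Y\<close> coordinatewise: \<open>Y\<close> multiplies all
  of \<open>u k\<close> by \<open>al k\<close> and \<open>Z\<close> multiplies the component along
  \<open>v l\<close> by \<open>be l\<close>, so the coordinate \<open>c l\<close> is multiplied by
  \<open>al k - be l\<close>.\<close>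

lemma spectral_difference_app:
  assumes Y: "spectral_family d Y d al u" and Z: "spectral_family d Z d be v"
    and k: "k < d"
    and D: "\<And>i j. i < d \<Longrightarrow> j < d \<Longrightarrow> D i j = Y i j - Z i j"
  defines "c \<equiv> \<lambda>l. inner_n d (v l) (u k)"
  shows "inner_n d (u k) (mat_app d D (u k)) = (\<Sum>l<d. (al k - be l) * (c l)\<^sup>2)"
    and "inner_n d (mat_app d D (u k)) (mat_app d D (u k)) = (\<Sum>l<d. (al k - be l)\<^sup>2 * (c l)\<^sup>2)"
proof -
  note uo = spectral_family_orthonormal[OF Y] and vo = spectral_family_orthonormal[OF Z]
  have uk: "u k i = (\<Sum>l<d. c l * v l i)" if "i < d" for i
    unfolding c_def by (rule orthonormal_expansion[OF vo that])
  have Du: "mat_app d D (u k) i = (\<Sum>l<d. ((al k - be l) * c l) * v l i)" if "i < d" for i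
  proof -
    have "mat_app d D (u k) i = mat_app d Y (u k) i - mat_app d Z (u k) i"
      unfolding mat_app_def sum_subtractf[symmetric]
      by (intro sum.cong refl) (simp add: D that left_diff_distrib)
    also have "mat_app d Y (u k) i = (\<Sum>l<d. al l * u l i * (if l = k then 1 else 0))"
      unfolding spectral_family_app[OF Y that]
      by (intro sum.cong refl) (use k in \<open>simp add: orthonormal_inner[OF uo]\<close>)
    also have "\<dots> = al k * u k i" using k by simp
    also have "\<dots> = (\<Sum>l<d. al k * c l * v l i)"
      by (simp add: uk[OF that] sum_distrib_left mult_ac)
    also have "mat_app d Z (u k) i = (\<Sum>l<d. be l * c l * v l i)"
      unfolding spectral_family_app[OF Z that] c_def ..
    finally show ?thesis by (simp add: sum_subtractf left_diff_distrib)
  qed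
  show "inner_n d (u k) (mat_app d D (u k)) = (\<Sum>l<d. (al k - be l) * (c l)\<^sup>2)"
  proof -
    have "inner_n d (u k) (mat_app d D (u k))
        = inner_n d (\<lambda>i. \<Sum>l<d. c l * v l i) (\<lambda>i. \<Sum>l<d. ((al k - be l) * c l) * v l i)"
      by (rule inner_n_cong) (fact uk, fact Du)
    also have "\<dots> = (\<Sum>l<d. c l * ((al k - be l) * c l))" by (rule orthonormal_inner_lincomb[OF vo])
    finally show ?thesis by (simp add: power2_eq_square mult_ac)
  qed
  show "inner_n d (mat_app d D (u k)) (mat_app d D (u k)) = (\<Sum>l<d. (al k - be l)\<^sup>2 * (c l)\<^sup>2)"
  proof -
    have "inner_n d (mat_app d D (u k)) (mat_app d D (u k))
        = inner_n d (\<lambda>i. \<Sum>l<d. ((al k - be l) * c l) * v l i)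
            (\<lambda>i. \<Sum>l<d. ((al k - be l) * c l) * v l i)"
      by (rule inner_n_cong) (fact Du)+
    also have "\<dots> = (\<Sum>l<d. ((al k - be l) * c l) * ((al k - be l) * c l))"
      by (rule orthonormal_inner_lincomb[OF vo])
    finally show ?thesis by (simp add: power2_eq_square mult_ac)
  qed
qed

text \<open>
  In the two eigenbases both sides become sums over pairs of eigenvalues against the same weights,
  the squared overlaps of the eigenvectors, so the inequality reduces to scalars.
\<close>

lemma mean_value_trace_inequality:
  assumes Y: "spectral_family d Y d al u" and Z: "spectral_family d Z d be v"
    and D: "\<And>i j. i < d \<Longrightarrow> j < d \<Longrightarrow> D i j = Y i j - Z i j" and n: "even n"
  shows "(\<Sum>k<d. al k ^ Suc n * inner_n d (u k) (mat_app d D (u k)))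
       - (\<Sum>k<d. be k ^ Suc n * inner_n d (v k) (mat_app d D (v k)))
     \<le> Suc n / 2 * ((\<Sum>k<d. al k ^ n * inner_n d (mat_app d D (u k)) (mat_app d D (u k)))
                   + (\<Sum>k<d. be k ^ n * inner_n d (mat_app d D (v k)) (mat_app d D (v k))))"
proof -
  define w where "w k l = (inner_n d (v l) (u k))\<^sup>2" for k l
  have u1: "inner_n d (u k) (mat_app d D (u k)) = (\<Sum>l<d. (al k - be l) * w k l)"
    and u2: "inner_n d (mat_app d D (u k)) (mat_app d D (u k)) = (\<Sum>l<d. (al k - be l)\<^sup>2 * w k l)"
    if "k < d" for k
    unfolding w_def by (rule spectral_difference_app[OF Y Z that D]; assumption)+
  \<comment> \<open>For the eigenvectors of \<open>Z\<close> the expansion is applied with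
    \<open>Y\<close> and \<open>Z\<close> exchanged, hence to the negated difference.\<close>
  define D' where "D' i j = Z i j - Y i j" for i j
  have D': "mat_app d D x i = - mat_app d D' x i" if "i < d" for x i
    unfolding mat_app_def sum_negf[symmetric] by (intro sum.cong refl) (simp add: D D'_def that algebra_simps)
  have v1: "inner_n d (v l) (mat_app d D (v l)) = (\<Sum>k<d. (al k - be l) * w k l)"
    and v2: "inner_n d (mat_app d D (v l)) (mat_app d D (v l)) = (\<Sum>k<d. (al k - be l)\<^sup>2 * w k l)"
    if "l < d" for l
  proof -
    note * = spectral_difference_app[OF Z Y that D'_def]
    have "inner_n d (v l) (mat_app d D (v l)) = - inner_n d (v l) (mat_app d D' (v l))"
      unfolding inner_n_def sum_negf[symmetric] by (intro sum.cong refl) (simp add: D')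
    also have "\<dots> = (\<Sum>k<d. - ((be l - al k) * w k l))"
      unfolding *(1) sum_negf w_def by (simp add: inner_n_commute)
    finally show "inner_n d (v l) (mat_app d D (v l)) = (\<Sum>k<d. (al k - be l) * w k l)"
      by (simp add: algebra_simps)
    have "inner_n d (mat_app d D (v l)) (mat_app d D (v l))
        = inner_n d (mat_app d D' (v l)) (mat_app d D' (v l))"
      unfolding inner_n_def by (intro sum.cong refl) (simp add: D')
    then show "inner_n d (mat_app d D (v l)) (mat_app d D (v l)) = (\<Sum>k<d. (al k - be l)\<^sup>2 * w k l)"
      unfolding *(2) w_def by (simp add: inner_n_commute power2_commute)
  qed
  \<comment> \<open>In terms of traces, tr ((Y^(n+1) - Z^(n+1)) D) is compared with (n+1)/2 times tr
    ((Y^n + Z^n) D^2).\<close>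
  have "(\<Sum>k<d. al k ^ Suc n * inner_n d (u k) (mat_app d D (u k)))
       - (\<Sum>k<d. be k ^ Suc n * inner_n d (v k) (mat_app d D (v k)))
      = (\<Sum>k<d. \<Sum>l<d. al k ^ Suc n * ((al k - be l) * w k l))
       - (\<Sum>l<d. \<Sum>k<d. be l ^ Suc n * ((al k - be l) * w k l))"
    by (simp add: u1 v1 sum_distrib_left)
  also have "(\<Sum>l<d. \<Sum>k<d. be l ^ Suc n * ((al k - be l) * w k l))
      = (\<Sum>k<d. \<Sum>l<d. be l ^ Suc n * ((al k - be l) * w k l))"
    by (rule sum.swap)
  also have "(\<Sum>k<d. \<Sum>l<d. al k ^ Suc n * ((al k - be l) * w k l)) - \<dots>
      = (\<Sum>k<d. \<Sum>l<d. ((al k - be l) * (al k ^ Suc n - be l ^ Suc n)) * w k l)"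
    unfolding sum_subtractf[symmetric] by (intro sum.cong refl) (simp add: algebra_simps)
  also have "\<dots> \<le> (\<Sum>k<d. \<Sum>l<d. (Suc n / 2 * ((al k - be l)\<^sup>2 * (al k ^ n + be l ^ n))) * w k l)"
    by (intro sum_mono mult_right_mono power_diff_mean_value n) (simp add: w_def)
  also have "\<dots> = Suc n / 2 * ((\<Sum>k<d. \<Sum>l<d. al k ^ n * ((al k - be l)\<^sup>2 * w k l))
      + (\<Sum>k<d. \<Sum>l<d. be l ^ n * ((al k - be l)\<^sup>2 * w k l)))"
    unfolding sum.distrib[symmetric] sum_distrib_left
    by (intro sum.cong refl) (simp add: algebra_simps)
  also have "(\<Sum>k<d. \<Sum>l<d. be l ^ n * ((al k - be l)\<^sup>2 * w k l))
      = (\<Sum>l<d. \<Sum>k<d. be l ^ n * ((al k - be l)\<^sup>2 * w k l))"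
    by (rule sum.swap)
  also have "(\<Sum>k<d. \<Sum>l<d. al k ^ n * ((al k - be l)\<^sup>2 * w k l)) + \<dots>
      = (\<Sum>k<d. al k ^ n * inner_n d (mat_app d D (u k)) (mat_app d D (u k)))
      + (\<Sum>k<d. be k ^ n * inner_n d (mat_app d D (v k)) (mat_app d D (v k)))"
    by (simp add: u2 v2 sum_distrib_left)
  finally show ?thesis .
qed

section \<open>Moments of Rademacher sums of matrices\<close>

definition set_sign :: "nat set \<Rightarrow> nat \<Rightarrow> real" where
  "set_sign S j = (if j \<in> S then 1 else -1)"

lemma set_sign_sq [simp]: "set_sign S j * set_sign S j = 1"
  by (simp add: set_sign_def)

lemma sum_Pow_toggle:
  fixes F :: "nat set \<Rightarrow> real"
  assumes "j < M"
  shows "(\<Sum>S\<in>Pow {..<M}. F (if j \<in> S then S - {j} else insert j S)) = (\<Sum>S\<in>Pow {..<M}. F S)"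
  by (rule sum.reindex_bij_witness[where i = "\<lambda>S. if j \<in> S then S - {j} else insert j S"
        and j = "\<lambda>S. if j \<in> S then S - {j} else insert j S"])
    (use assms in auto)

text \<open>Exchangeable pairs: with Y the signed sum, tr Y^(n+2) is the signed sum over
  \<open>j\<close> of tr (Y^(n+1) H_j). Flipping the sign of \<open>j\<close> preserves the uniform
  distribution and changes Y by 2 H_j up to sign, so on average the term of \<open>j\<close> is half
  a difference of traces, and the mean value inequality leaves tr (Y^n H_j^2). Summing over
  \<open>j\<close> brings in the variance.\<close>

lemma rademacher_moment_step:
  fixes H :: "nat \<Rightarrow> nat \<Rightarrow> nat \<Rightarrow> real" and \<sigma>2 :: real
  assumes fam: "\<And>S. S \<subseteq> {..<M} \<Longrightarrow>
      spectral_family d (\<lambda>i k. \<Sum>j<M. set_sign S j * H j i k) d (\<nu> S) (U S)"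
    and var: "\<And>w. (\<Sum>j<M. inner_n d (mat_app d (H j) w) (mat_app d (H j) w)) \<le> \<sigma>2 * inner_n d w w"
    and n: "even n"
  shows "(\<Sum>S\<in>Pow {..<M}. \<Sum>k<d. \<nu> S k ^ (n + 2)) \<le> Suc n * \<sigma>2 * (\<Sum>S\<in>Pow {..<M}. \<Sum>k<d. \<nu> S k ^ n)"
proof -
  \<comment> \<open>\<open>T h S\<close> is tr (Y^(n+1) h) and \<open>V h S\<close> is tr (Y^n h^T
    h), evaluated in the eigenbasis of the signed sum Y belonging to \<open>S\<close>.\<close>
  define T where "T h S = (\<Sum>k<d. \<nu> S k ^ Suc n * inner_n d (U S k) (mat_app d h (U S k)))" for h S
  define V where "V h S = (\<Sum>k<d. \<nu> S k ^ n * inner_n d (mat_app d h (U S k)) (mat_app d h (U S k)))"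
    for h S
  define tg where "tg j S = (if j \<in> S then S - {j} else insert j S)" for j :: nat and S
  have 1: "(\<Sum>k<d. \<nu> S k ^ (n + 2)) = (\<Sum>j<M. set_sign S j * T (H j) S)" if S: "S \<subseteq> {..<M}" for S
  proof -
    let ?Y = "\<lambda>i k. \<Sum>j<M. set_sign S j * H j i k"
    note uo = spectral_family_orthonormal[OF fam[OF S]]
    have "inner_n d (U S k) (mat_app d ?Y (U S k)) = \<nu> S k" if k: "k < d" for k
    proof -
      have "inner_n d (U S k) (mat_app d ?Y (U S k)) = inner_n d (U S k) (\<lambda>i. \<nu> S k * U S k i)"
      proof (rule inner_n_cong)
        fix i assume i: "i < d"
        have "mat_app d ?Y (U S k) i = (\<Sum>l<d. \<nu> S l * U S l i * (if l = k then 1 else 0))"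
          unfolding spectral_family_app[OF fam[OF S] i]
          by (intro sum.cong refl) (use k in \<open>simp add: orthonormal_inner[OF uo]\<close>)
        then show "mat_app d ?Y (U S k) i = \<nu> S k * U S k i" using k by simp
      qed simp
      then show ?thesis using k by (simp add: inner_n_scale_right orthonormal_inner[OF uo])
    qed
    then have "(\<Sum>k<d. \<nu> S k ^ (n + 2))
        = (\<Sum>k<d. \<nu> S k ^ Suc n * inner_n d (U S k) (mat_app d ?Y (U S k)))"
      by (intro sum.cong refl) (simp add: mult_ac)
    also have "\<dots> = (\<Sum>k<d. \<Sum>j<M. set_sign S j * (\<nu> S k ^ Suc n * inner_n d (U S k) (mat_app d (H j) (U S k))))"
    proof (intro sum.cong refl)
      fix k
      have "mat_app d ?Y x i = (\<Sum>j<M. set_sign S j * mat_app d (H j) x i)" for x i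
        unfolding mat_app_def sum_distrib_left sum_distrib_right
        by (subst sum.swap) (simp add: mult_ac)
      then have "inner_n d (U S k) (mat_app d ?Y (U S k))
          = inner_n d (U S k) (\<lambda>i. \<Sum>j<M. set_sign S j * mat_app d (H j) (U S k) i)"
        by (intro inner_n_cong) auto
      also have "\<dots> = (\<Sum>j<M. set_sign S j * inner_n d (U S k) (mat_app d (H j) (U S k)))"
        by (simp add: inner_n_sum_right inner_n_scale_right)
      finally show "\<nu> S k ^ Suc n * inner_n d (U S k) (mat_app d ?Y (U S k))
          = (\<Sum>j<M. set_sign S j * (\<nu> S k ^ Suc n * inner_n d (U S k) (mat_app d (H j) (U S k))))"
        by (simp add: sum_distrib_left mult_ac)
    qed
    also have "\<dots> = (\<Sum>j<M. set_sign S j * T (H j) S)"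
      unfolding T_def by (subst sum.swap) (simp only: sum_distrib_left)
    finally show ?thesis .
  qed
  have 2: "set_sign S j * (T (H j) S - T (H j) (tg j S)) \<le> Suc n * (V (H j) S + V (H j) (tg j S))"
    if S: "S \<subseteq> {..<M}" and j: "j < M" for S j
  proof -
    have S': "tg j S \<subseteq> {..<M}" using S j by (auto simp: tg_def)
    define D where "D = (\<lambda>i k. 2 * set_sign S j * H j i k)"
    have D: "D i k = (\<Sum>l<M. set_sign S l * H l i k) - (\<Sum>l<M. set_sign (tg j S) l * H l i k)" for i k
    proof -
      have "(\<Sum>l<M. set_sign S l * H l i k) - (\<Sum>l<M. set_sign (tg j S) l * H l i k)
          = (\<Sum>l<M. if l = j then D i k else 0)"
        unfolding sum_subtractf[symmetric]
      proof (intro sum.cong refl)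
        fix l
        have "set_sign (tg j S) l = (if l = j then - set_sign S l else set_sign S l)"
          by (cases "l = j") (simp_all add: set_sign_def tg_def)
        then show "set_sign S l * H l i k - set_sign (tg j S) l * H l i k = (if l = j then D i k else 0)"
          by (simp add: D_def)
      qed
      then show ?thesis using j by simp
    qed
    have Dm: "mat_app d D x = (\<lambda>i. 2 * set_sign S j * mat_app d (H j) x i)" for x
      by (rule ext) (simp add: mat_app_def D_def sum_distrib_left mult_ac)
    have TD: "T D R = 2 * set_sign S j * T (H j) R" for R
      by (simp add: T_def Dm inner_n_scale_right sum_distrib_left mult_ac)
    have VD: "V D R = 4 * V (H j) R" for R
    proof -
      have "inner_n d (mat_app d D x) (mat_app d D x)
          = 4 * (set_sign S j * set_sign S j) * inner_n d (mat_app d (H j) x) (mat_app d (H j) x)" for x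
        unfolding Dm inner_n_scale_right inner_n_scale_left by simp
      then show ?thesis by (simp add: V_def sum_distrib_left mult_ac)
    qed
    have "T D S - T D (tg j S) \<le> Suc n / 2 * (V D S + V D (tg j S))"
      unfolding T_def V_def by (rule mean_value_trace_inequality[OF fam[OF S] fam[OF S'] D n])
    then show ?thesis by (simp add: TD VD field_simps)
  qed
  have 3: "(\<Sum>S\<in>Pow {..<M}. set_sign S j * T (H j) S) \<le> Suc n * (\<Sum>S\<in>Pow {..<M}. V (H j) S)"
    if j: "j < M" for j
  proof -
    \<comment> \<open>Reindexing by the flip reverses the sign, so twice the wanted sum is a sum of
      differences between \<open>S\<close> and its flip.\<close>
    have "(\<Sum>S\<in>Pow {..<M}. set_sign S j * T (H j) (tg j S))
        = (\<Sum>S\<in>Pow {..<M}. - (set_sign (tg j S) j * T (H j) (tg j S)))"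
      by (intro sum.cong refl) (auto simp: set_sign_def tg_def)
    also have "\<dots> = - (\<Sum>S\<in>Pow {..<M}. set_sign S j * T (H j) S)"
      unfolding sum_negf tg_def by (subst sum_Pow_toggle[OF j]) simp
    finally have "2 * (\<Sum>S\<in>Pow {..<M}. set_sign S j * T (H j) S)
        = (\<Sum>S\<in>Pow {..<M}. set_sign S j * (T (H j) S - T (H j) (tg j S)))"
      by (simp add: right_diff_distrib sum_subtractf)
    also have "\<dots> \<le> (\<Sum>S\<in>Pow {..<M}. Suc n * (V (H j) S + V (H j) (tg j S)))"
      by (intro sum_mono 2) (use j in auto)
    also have "\<dots> = Suc n * ((\<Sum>S\<in>Pow {..<M}. V (H j) S) + (\<Sum>S\<in>Pow {..<M}. V (H j) (tg j S)))"
      by (simp only: sum_distrib_left sum.distrib distrib_left)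
    also have "(\<Sum>S\<in>Pow {..<M}. V (H j) (tg j S)) = (\<Sum>S\<in>Pow {..<M}. V (H j) S)"
      unfolding tg_def by (rule sum_Pow_toggle[OF j])
    finally show ?thesis by simp
  qed
  have "(\<Sum>S\<in>Pow {..<M}. \<Sum>k<d. \<nu> S k ^ (n + 2)) = (\<Sum>S\<in>Pow {..<M}. \<Sum>j<M. set_sign S j * T (H j) S)"
    by (intro sum.cong refl 1) auto
  also have "\<dots> = (\<Sum>j<M. \<Sum>S\<in>Pow {..<M}. set_sign S j * T (H j) S)" by (rule sum.swap)
  also have "\<dots> \<le> (\<Sum>j<M. Suc n * (\<Sum>S\<in>Pow {..<M}. V (H j) S))"
    by (intro sum_mono 3) auto
  also have "\<dots> = Suc n * (\<Sum>S\<in>Pow {..<M}. \<Sum>j<M. V (H j) S)"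
    by (subst sum.swap) (simp only: sum_distrib_left)
  also have "\<dots> \<le> Suc n * (\<Sum>S\<in>Pow {..<M}. \<Sum>k<d. \<sigma>2 * \<nu> S k ^ n)"
  proof (intro mult_left_mono sum_mono)
    fix S assume "S \<in> Pow {..<M}"
    then have S: "S \<subseteq> {..<M}" by auto
    have "(\<Sum>j<M. V (H j) S)
        = (\<Sum>k<d. \<nu> S k ^ n * (\<Sum>j<M. inner_n d (mat_app d (H j) (U S k)) (mat_app d (H j) (U S k))))"
      unfolding V_def by (subst sum.swap) (simp only: sum_distrib_left)
    also have "\<dots> \<le> (\<Sum>k<d. \<nu> S k ^ n * (\<sigma>2 * inner_n d (U S k) (U S k)))"
      by (intro sum_mono mult_left_mono var zero_le_even_power n)
    also have "\<dots> = (\<Sum>k<d. \<sigma>2 * \<nu> S k ^ n)"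
      by (intro sum.cong refl) (simp add: orthonormal_inner[OF spectral_family_orthonormal[OF fam[OF S]]])
    finally show "(\<Sum>j<M. V (H j) S) \<le> (\<Sum>k<d. \<sigma>2 * \<nu> S k ^ n)" .
  qed simp
  also have "\<dots> = Suc n * \<sigma>2 * (\<Sum>S\<in>Pow {..<M}. \<Sum>k<d. \<nu> S k ^ n)"
    by (simp only: sum_distrib_left mult.assoc)
  finally show ?thesis .
qed

text \<open>Each moment step costs an odd factor and one \<open>\<sigma>2\<close>. Starting from
  exponent 0, where the trace is \<open>d\<close>, the odd factors multiply to (2p - 1)!!, the 2p-th
  moment of a standard Gaussian. The factor \<open>2 ^ M\<close> appears because sums over all signs
  are used instead of averages.\<close>

theorem noncommutative_khintchine:
  fixes H :: "nat \<Rightarrow> nat \<Rightarrow> nat \<Rightarrow> real" and \<sigma>2 :: real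
  assumes fam: "\<And>S. S \<subseteq> {..<M} \<Longrightarrow>
      spectral_family d (\<lambda>i k. \<Sum>j<M. set_sign S j * H j i k) d (\<nu> S) (U S)"
    and var: "\<And>w. (\<Sum>j<M. inner_n d (mat_app d (H j) w) (mat_app d (H j) w)) \<le> \<sigma>2 * inner_n d w w"
    and \<sigma>2: "\<sigma>2 \<ge> 0"
  shows "(\<Sum>S\<in>Pow {..<M}. \<Sum>k<d. \<nu> S k ^ (2 * p)) \<le> (\<Prod>q<p. real (2 * q + 1)) * \<sigma>2 ^ p * d * 2 ^ M"
proof (induction p)
  case 0
  then show ?case by (simp add: card_Pow)
next
  case (Suc p)
  have "(\<Sum>S\<in>Pow {..<M}. \<Sum>k<d. \<nu> S k ^ (2 * Suc p)) = (\<Sum>S\<in>Pow {..<M}. \<Sum>k<d. \<nu> S k ^ (2 * p + 2))"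
    by (simp only: mult_Suc_right add.commute)
  also have "\<dots> \<le> Suc (2 * p) * \<sigma>2 * (\<Sum>S\<in>Pow {..<M}. \<Sum>k<d. \<nu> S k ^ (2 * p))"
    by (rule rademacher_moment_step[OF fam var]) auto
  also have "\<dots> \<le> Suc (2 * p) * \<sigma>2 * ((\<Prod>q<p. real (2 * q + 1)) * \<sigma>2 ^ p * d * 2 ^ M)"
    by (intro mult_left_mono Suc.IH) (use \<sigma>2 in auto)
  also have "\<dots> = (\<Prod>q<Suc p. real (2 * q + 1)) * \<sigma>2 ^ Suc p * d * 2 ^ M"
    unfolding prod.lessThan_Suc power_Suc by (simp only: Suc_eq_plus1 mult_ac)
  finally show ?case .
qed

section \<open>Counting eigenvalues by Schur complements\<close>

text \<open>Gaussian elimination, removing one unknown per equation. Both inertia comparisons obtain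
  their test vector from such a system.\<close>

lemma underdetermined_system_nontrivial_solution:
  fixes c :: "'e \<Rightarrow> 'v \<Rightarrow> real"
  assumes "finite E" "finite V" "card E < card V"
  shows "\<exists>x. (\<exists>v\<in>V. x v \<noteq> 0) \<and> (\<forall>e\<in>E. (\<Sum>v\<in>V. c e v * x v) = 0)"
  using assms
proof (induction E arbitrary: V c rule: finite_induct)
  case empty
  then obtain v where "v \<in> V" by fastforce
  then show ?case by (intro exI[of _ "\<lambda>_. 1"]) auto
next
  case (insert e E)
  show ?case
  proof (cases "\<forall>v\<in>V. c e v = 0")
    case True
    obtain x where "\<exists>v\<in>V. x v \<noteq> 0" "\<forall>e\<in>E. (\<Sum>v\<in>V. c e v * x v) = 0"
      using insert.IH[of V c] insert.prems insert.hyps by auto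
    moreover have "(\<Sum>v\<in>V. c e v * x v) = 0" using True by (simp add: sum.neutral)
    ultimately show ?thesis by blast
  next
    case False
    then obtain v0 where v0: "v0 \<in> V" "c e v0 \<noteq> 0" by blast
    define c' where "c' e' v = c e' v - c e' v0 * c e v / c e v0" for e' v
    have "card E < card (V - {v0})" using insert v0 by simp
    then obtain x where x: "\<exists>v\<in>V - {v0}. x v \<noteq> 0" "\<And>e'. e' \<in> E \<Longrightarrow> (\<Sum>v\<in>V - {v0}. c' e' v * x v) = 0"
      using insert.IH[of "V - {v0}" c'] insert.prems by blast
    define s where "s = (\<Sum>v\<in>V - {v0}. c e v * x v)"
    define y where "y v = (if v = v0 then - s / c e v0 else x v)" for v
    have split: "(\<Sum>v\<in>V. c e' v * y v) = c e' v0 * (- s / c e v0) + (\<Sum>v\<in>V - {v0}. c e' v * x v)" for e'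
    proof -
      have "(\<Sum>v\<in>V. c e' v * y v) = c e' v0 * y v0 + (\<Sum>v\<in>V - {v0}. c e' v * y v)"
        by (rule sum.remove) (use insert.prems v0 in auto)
      also have "(\<Sum>v\<in>V - {v0}. c e' v * y v) = (\<Sum>v\<in>V - {v0}. c e' v * x v)"
        by (intro sum.cong) (auto simp: y_def)
      finally show ?thesis by (simp add: y_def)
    qed
    have "(\<Sum>v\<in>V. c e' v * y v) = 0" if "e' \<in> insert e E" for e'
    proof (cases "e' = e")
      case True
      then show ?thesis using v0 by (simp add: split s_def)
    next
      case False
      then have "0 = (\<Sum>v\<in>V - {v0}. c' e' v * x v)" using x(2) that by simp
      also have "\<dots> = (\<Sum>v\<in>V - {v0}. c e' v * x v) - (\<Sum>v\<in>V - {v0}. c e' v0 / c e v0 * (c e v * x v))"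
        unfolding sum_subtractf[symmetric] by (intro sum.cong refl) (simp add: c'_def algebra_simps)
      also have "(\<Sum>v\<in>V - {v0}. c e' v0 / c e v0 * (c e v * x v)) = c e' v0 / c e v0 * s"
        by (simp only: s_def sum_distrib_left)
      finally show ?thesis by (simp add: split)
    qed
    moreover have "\<exists>v\<in>V. y v \<noteq> 0" using x(1) by (auto simp: y_def)
    ultimately show ?thesis by blast
  qed
qed

lemma bessel_inequality:
  assumes "orthonormal N m v"
  shows "(\<Sum>l<m. (inner_n N (v l) z)\<^sup>2) \<le> inner_n N z z"
proof -
  define p where "p = (\<lambda>i. \<Sum>l<m. inner_n N (v l) z * v l i)"
  have pp: "inner_n N p p = (\<Sum>l<m. (inner_n N (v l) z)\<^sup>2)"
    by (simp add: p_def orthonormal_inner_lincomb[OF assms] power2_eq_square)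
  have pz: "inner_n N p z = (\<Sum>l<m. (inner_n N (v l) z)\<^sup>2)"
    by (simp add: p_def inner_n_sum_left inner_n_scale_left power2_eq_square)
  have "0 \<le> inner_n N (\<lambda>i. z i - p i) (\<lambda>i. z i - p i)" by (rule inner_n_nonneg)
  also have "\<dots> = inner_n N z z - 2 * inner_n N p z + inner_n N p p"
    unfolding inner_n_def sum_distrib_left sum_subtractf[symmetric] sum.distrib[symmetric]
    by (intro sum.cong refl) (simp add: algebra_simps)
  finally show ?thesis using pp pz by simp
qed

lemma spectral_family_quadratic_form:
  assumes "spectral_family N b m ev v"
  shows "(\<Sum>i<N. \<Sum>j<N. z i * z j * b i j) = (\<Sum>l<m. ev l * (inner_n N (v l) z)\<^sup>2)"
proof -
  have "(\<Sum>i<N. \<Sum>j<N. z i * z j * b i j) = inner_n N z (mat_app N b z)"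
    by (simp add: inner_n_def mat_app_def sum_distrib_left mult_ac)
  also have "\<dots> = inner_n N z (\<lambda>i. \<Sum>l<m. ev l * inner_n N (v l) z * v l i)"
    by (intro inner_n_cong refl spectral_family_app[OF assms])
  also have "\<dots> = (\<Sum>l<m. ev l * (inner_n N (v l) z)\<^sup>2)"
    unfolding inner_n_sum_right inner_n_scale_right
    by (intro sum.cong refl) (simp add: inner_n_commute[of N z] power2_eq_square)
  finally show ?thesis .
qed

text \<open>Here \<open>b\<close> is X J X^T with J diagonal, so its form at z is the form of J at
  X^T z.\<close>

lemma gram_quadratic_form:
  fixes J z :: "nat \<Rightarrow> real" and X b :: "nat \<Rightarrow> nat \<Rightarrow> real"
  assumes "\<And>i j. i < M \<Longrightarrow> j < M \<Longrightarrow> b i j = (\<Sum>k<m. J k * X i k * X j k)"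
  shows "(\<Sum>i<M. \<Sum>j<M. z i * z j * b i j) = (\<Sum>k<m. J k * (\<Sum>j<M. X j k * z j)\<^sup>2)"
proof -
  have "(\<Sum>i<M. \<Sum>j<M. z i * z j * b i j) = (\<Sum>i<M. \<Sum>j<M. \<Sum>k<m. J k * ((X i k * z i) * (X j k * z j)))"
  proof (intro sum.cong refl)
    fix i j assume "i \<in> {..<M}" "j \<in> {..<M}"
    then show "z i * z j * b i j = (\<Sum>k<m. J k * ((X i k * z i) * (X j k * z j)))"
      by (simp only: assms sum_distrib_left lessThan_iff) (intro sum.cong refl, simp only: mult_ac)
  qed
  also have "\<dots> = (\<Sum>i<M. \<Sum>k<m. \<Sum>j<M. J k * ((X i k * z i) * (X j k * z j)))"
    by (intro sum.cong refl sum.swap)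
  also have "\<dots> = (\<Sum>k<m. \<Sum>i<M. \<Sum>j<M. J k * ((X i k * z i) * (X j k * z j)))"
    by (rule sum.swap)
  also have "\<dots> = (\<Sum>k<m. J k * (\<Sum>j<M. X j k * z j)\<^sup>2)"
  proof (intro sum.cong refl)
    fix k
    have "(\<Sum>j<M. X j k * z j)\<^sup>2 = (\<Sum>i<M. \<Sum>j<M. (X i k * z i) * (X j k * z j))"
      by (simp add: power2_eq_square sum_product)
    then show "(\<Sum>i<M. \<Sum>j<M. J k * ((X i k * z i) * (X j k * z j))) = J k * (\<Sum>j<M. X j k * z j)\<^sup>2"
      by (simp only: sum_distrib_left)
  qed
  finally show ?thesis .
qed

text \<open>
  Completing the square in the form \<open>\<langle>w, J w\<rangle> + 2 \<langle>z, X w\<rangle> + s \<langle>z, z\<rangle>\<close> with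
  respect to \<open>z\<close> and with respect to \<open>w\<close>. This relates the inertia of \<open>s J - X\<^sup>T X\<close> to that
  of \<open>s I - X J X\<^sup>T\<close>.
\<close>

lemma schur_complement_identity:
  fixes m M :: nat and J w z :: "nat \<Rightarrow> real" and X :: "nat \<Rightarrow> nat \<Rightarrow> real" and s :: real
  assumes s: "s \<noteq> 0" and J: "\<And>k. J k * J k = 1"
  defines "p \<equiv> \<lambda>j. \<Sum>k<m. X j k * w k" and "q \<equiv> \<lambda>k. \<Sum>j<M. X j k * z j"
  shows "s * (\<Sum>j<M. (z j + p j / s)\<^sup>2) + (\<Sum>k<m. J k * (w k)\<^sup>2) - (\<Sum>j<M. (p j)\<^sup>2) / s
       = (\<Sum>k<m. J k * (w k + J k * q k)\<^sup>2) + s * (\<Sum>j<M. (z j)\<^sup>2) - (\<Sum>k<m. J k * (q k)\<^sup>2)"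
proof -
  have "s * (\<Sum>j<M. (z j + p j / s)\<^sup>2)
      = (\<Sum>j<M. s * (z j)\<^sup>2 + 2 * (z j * p j) + (p j)\<^sup>2 / s)"
    unfolding sum_distrib_left
    by (intro sum.cong refl) (use s in \<open>simp add: field_simps power2_eq_square\<close>)
  also have "\<dots> = s * (\<Sum>j<M. (z j)\<^sup>2) + 2 * (\<Sum>j<M. z j * p j) + (\<Sum>j<M. (p j)\<^sup>2) / s"
    by (simp only: sum.distrib sum_distrib_left sum_divide_distrib)
  finally have 1: "s * (\<Sum>j<M. (z j + p j / s)\<^sup>2)
      = s * (\<Sum>j<M. (z j)\<^sup>2) + 2 * (\<Sum>j<M. z j * p j) + (\<Sum>j<M. (p j)\<^sup>2) / s" .
  have J': "J k * (J k * x) = x" for k x using J[of k] by (metis mult.assoc mult_1)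
  have "(\<Sum>k<m. J k * (w k + J k * q k)\<^sup>2)
      = (\<Sum>k<m. J k * (w k)\<^sup>2 + 2 * (w k * q k) + J k * (q k)\<^sup>2)"
    by (intro sum.cong refl) (simp add: power2_eq_square algebra_simps J')
  also have "\<dots> = (\<Sum>k<m. J k * (w k)\<^sup>2) + 2 * (\<Sum>k<m. w k * q k) + (\<Sum>k<m. J k * (q k)\<^sup>2)"
    by (simp only: sum.distrib sum_distrib_left)
  finally have 2: "(\<Sum>k<m. J k * (w k + J k * q k)\<^sup>2)
      = (\<Sum>k<m. J k * (w k)\<^sup>2) + 2 * (\<Sum>k<m. w k * q k) + (\<Sum>k<m. J k * (q k)\<^sup>2)" .
  have "(\<Sum>j<M. z j * p j) = (\<Sum>k<m. w k * q k)"
    unfolding p_def q_def sum_distrib_left by (subst sum.swap) (simp add: mult_ac)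
  then show ?thesis unfolding 1 2 by simp
qed

lemma sum_support:
  fixes f :: "nat \<Rightarrow> real"
  assumes "V \<subseteq> {..<m}"
  shows "(\<Sum>k<m. f k * (if k \<in> V then x k else 0)) = (\<Sum>k\<in>V. f k * x k)"
proof -
  have "(\<Sum>k<m. f k * (if k \<in> V then x k else 0)) = (\<Sum>k\<in>V. f k * (if k \<in> V then x k else 0))"
    by (rule sum.mono_neutral_right) (use assms in auto)
  then show ?thesis by simp
qed

text \<open>Dimension count for the Schur identity at s = t - \<eta>. If the claim failed, a nonzero
  w supported on \<open>Kp\<close> and \<open>Kn\<close> could satisfy one equation for every index
  in \<open>Kn\<close> and \<open>L\<close>. These equations make the right side of the identity
  nonnegative, whereas \<open>good\<close> makes the left side negative for every such w. Having
  \<open>Kn\<close> among both the unknowns and the equations is what absorbs the negative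
  directions of J.\<close>

lemma eigenvalue_count_lower:
  fixes ev \<mu> :: "nat \<Rightarrow> real" and X :: "nat \<Rightarrow> nat \<Rightarrow> real" and t \<eta> :: real
  defines "J \<equiv> \<lambda>k. if ev k < 0 then -1 else (1 :: real)"
  assumes \<eta>: "\<eta> > 0" "2 * \<eta> \<le> t"
    and b: "\<And>i j. i < M \<Longrightarrow> j < M \<Longrightarrow> b i j = (\<Sum>k<m. J k * X i k * X j k)"
    and fam: "spectral_family M b m' \<mu> v"
    and good: "\<And>w. \<bar>(\<Sum>j<M. (\<Sum>k<m. X j k * w k)\<^sup>2) - (\<Sum>k<m. \<bar>ev k\<bar> * (w k)\<^sup>2)\<bar>
        \<le> 1/4 * (\<Sum>k<m. (\<bar>ev k - t\<bar> + \<eta>) * (w k)\<^sup>2)"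
  shows "card {k. k < m \<and> ev k \<ge> t} \<le> card {l. l < m' \<and> \<mu> l > t - \<eta>}"
proof (rule ccontr)
  define Kp where "Kp = {k. k < m \<and> ev k \<ge> t}"
  define Kn where "Kn = {k. k < m \<and> ev k < 0}"
  define L where "L = {l. l < m' \<and> \<mu> l > t - \<eta>}"
  define s where "s = t - \<eta>"
  assume "\<not> ?thesis"
  then have lt: "card L < card Kp" by (simp add: Kp_def L_def)
  have s: "s > 0" using \<eta> by (simp add: s_def)
  have fin: "finite Kp" "finite Kn" "finite L" by (auto simp: Kp_def Kn_def L_def)
  have disj: "Kp \<inter> Kn = {}" using \<eta> by (auto simp: Kp_def Kn_def)
  have sub: "Kp \<union> Kn \<subseteq> {..<m}" by (auto simp: Kp_def Kn_def)
  \<comment> \<open>Equation \<open>Inl k\<close> expresses w k + J k q k = 0 and equation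
    \<open>Inr l\<close> the orthogonality of z to \<open>v l\<close>, both after substituting z = -
    X w / s, the choice that makes the first square vanish.\<close>
  define c where "c e k' = (case e of
      Inl k \<Rightarrow> (if k = k' then 1 else 0) - J k / s * (\<Sum>j<M. X j k * X j k')
    | Inr l \<Rightarrow> (\<Sum>j<M. v l j * X j k'))" for e k'
  have "card (Kn <+> L) < card (Kp \<union> Kn)"
    using lt fin disj by (simp add: card_Plus card_Un_disjoint)
  then have "\<exists>x. (\<exists>k\<in>Kp \<union> Kn. x k \<noteq> 0) \<and> (\<forall>e\<in>Kn <+> L. (\<Sum>k\<in>Kp \<union> Kn. c e k * x k) = 0)"
    using fin by (intro underdetermined_system_nontrivial_solution) auto
  then obtain x where x: "\<exists>k\<in>Kp \<union> Kn. x k \<noteq> 0"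
      and xe: "\<And>e. e \<in> Kn <+> L \<Longrightarrow> (\<Sum>k\<in>Kp \<union> Kn. c e k * x k) = 0"
    by blast
  define w where "w k = (if k \<in> Kp \<union> Kn then x k else 0)" for k
  have xe': "(\<Sum>k<m. c e k * w k) = 0" if "e \<in> Kn <+> L" for e
    using xe[OF that] sum_support[OF sub] by (simp add: w_def)
  define p where "p j = (\<Sum>k<m. X j k * w k)" for j
  define z where "z j = - p j / s" for j
  define q where "q k = (\<Sum>j<M. X j k * z j)" for k
  have wn: "w k + J k * q k = 0" if k: "k \<in> Kn" for k
  proof -
    have "(\<Sum>k'<m. (if k = k' then 1 else 0) * w k') - (\<Sum>k'<m. J k / s * (\<Sum>j<M. X j k * X j k') * w k') = 0"
      using xe'[OF InlI[OF k]] by (simp only: c_def sum.case left_diff_distrib sum_subtractf)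
    moreover have "(\<Sum>k'<m. (if k = k' then 1 else 0) * w k') = w k"
      using k sub by auto
    moreover have "(\<Sum>k'<m. J k / s * (\<Sum>j<M. X j k * X j k') * w k') = - (J k * q k)"
    proof -
      have "(\<Sum>k'<m. J k / s * (\<Sum>j<M. X j k * X j k') * w k')
        = (\<Sum>k'<m. \<Sum>j<M. J k / s * (X j k * (X j k' * w k')))"
      by (simp only: sum_distrib_left sum_distrib_right mult.assoc)
    also have "\<dots> = (\<Sum>j<M. \<Sum>k'<m. J k / s * (X j k * (X j k' * w k')))" by (rule sum.swap)
    also have "\<dots> = (\<Sum>j<M. J k / s * (X j k * p j))"
      by (simp only: p_def sum_distrib_left)
    also have "\<dots> = - (J k * q k)"
      unfolding q_def sum_distrib_left sum_negf[symmetric] by (intro sum.cong refl) (simp add: z_def)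
      finally show ?thesis .
    qed
    ultimately show ?thesis by simp
  qed
  have zl: "inner_n M (v l) z = 0" if l: "l \<in> L" for l
  proof -
    have "0 = (\<Sum>k'<m. \<Sum>j<M. v l j * (X j k' * w k'))"
      using xe'[OF InrI[OF l]] by (simp only: c_def sum.case sum_distrib_right mult.assoc)
    also have "\<dots> = (\<Sum>j<M. \<Sum>k'<m. v l j * (X j k' * w k'))" by (rule sum.swap)
    also have "\<dots> = (\<Sum>j<M. v l j * p j)" by (simp only: p_def sum_distrib_left)
    finally have "0 = (\<Sum>j<M. v l j * p j)" .
    moreover have "inner_n M (v l) z = - (\<Sum>j<M. v l j * p j) / s"
      by (simp add: inner_n_def z_def sum_negf sum_divide_distrib)
    ultimately show ?thesis by simp
  qed
  have id: "s * (\<Sum>j<M. (z j + p j / s)\<^sup>2) + (\<Sum>k<m. J k * (w k)\<^sup>2) - (\<Sum>j<M. (p j)\<^sup>2) / s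
       = (\<Sum>k<m. J k * (w k + J k * q k)\<^sup>2) + s * (\<Sum>j<M. (z j)\<^sup>2) - (\<Sum>k<m. J k * (q k)\<^sup>2)"
    unfolding p_def q_def by (rule schur_complement_identity) (use s in \<open>auto simp: J_def\<close>)
  have "(\<Sum>k<m. J k * (q k)\<^sup>2) = (\<Sum>l<m'. \<mu> l * (inner_n M (v l) z)\<^sup>2)"
    using gram_quadratic_form[where z = z, OF b] spectral_family_quadratic_form[OF fam, of z]
    by (simp add: q_def)
  also have "\<dots> \<le> (\<Sum>l<m'. s * (inner_n M (v l) z)\<^sup>2)"
  proof (rule sum_mono)
    fix l assume l: "l \<in> {..<m'}"
    show "\<mu> l * (inner_n M (v l) z)\<^sup>2 \<le> s * (inner_n M (v l) z)\<^sup>2"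
    proof (cases "l \<in> L")
      case True then show ?thesis by (simp add: zl)
    next
      case False then show ?thesis using l by (intro mult_right_mono) (auto simp: L_def s_def)
    qed
  qed
  also have "\<dots> \<le> s * inner_n M z z"
    unfolding sum_distrib_left[symmetric]
    by (intro mult_left_mono bessel_inequality[OF spectral_family_orthonormal[OF fam]]) (use s in auto)
  finally have "(\<Sum>k<m. J k * (q k)\<^sup>2) \<le> s * (\<Sum>j<M. (z j)\<^sup>2)"
    by (simp add: inner_n_def power2_eq_square)
  moreover have "(\<Sum>k<m. J k * (w k + J k * q k)\<^sup>2) \<ge> 0"
  proof (rule sum_nonneg)
    fix k assume "k \<in> {..<m}"
    then show "0 \<le> J k * (w k + J k * q k)\<^sup>2"
      using wn[of k] by (cases "ev k < 0") (auto simp: Kn_def J_def)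
  qed
  moreover have "(\<Sum>j<M. (z j + p j / s)\<^sup>2) = 0" by (simp add: z_def)
  ultimately have ge: "(\<Sum>k<m. J k * (w k)\<^sup>2) - (\<Sum>j<M. (p j)\<^sup>2) / s \<ge> 0"
    using id by simp
  have "s * (\<Sum>k<m. J k * (w k)\<^sup>2) - (\<Sum>j<M. (p j)\<^sup>2)
      = s * ((\<Sum>k<m. J k * (w k)\<^sup>2) - (\<Sum>j<M. (p j)\<^sup>2) / s)"
    using s by (simp add: field_simps)
  also have "\<dots> \<ge> 0" using ge s by (intro mult_nonneg_nonneg) auto
  finally have ge': "0 \<le> s * (\<Sum>k<m. J k * (w k)\<^sup>2) - (\<Sum>j<M. (p j)\<^sup>2)" .
  \<comment> \<open>Coefficient of (w k)^2 in s J - X^T X once X^T X is replaced by |\<Lambda>|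
    minus the tolerated error. It is - 3/4 (ev k - t + \<eta>) on \<open>Kp\<close>; on
    \<open>Kn\<close> it is negative thanks to t \<ge> 2 \<eta>.\<close>
  define g where "g k = s * J k - \<bar>ev k\<bar> + 1/4 * (\<bar>ev k - t\<bar> + \<eta>)" for k
  define Q1 where "Q1 = (\<Sum>k<m. \<bar>ev k\<bar> * (w k)\<^sup>2)"
  define Q2 where "Q2 = (\<Sum>k<m. (\<bar>ev k - t\<bar> + \<eta>) * (w k)\<^sup>2)"
  have "\<bar>(\<Sum>j<M. (p j)\<^sup>2) - Q1\<bar> \<le> 1/4 * Q2"
    unfolding p_def Q1_def Q2_def by (rule good)
  then have "0 \<le> s * (\<Sum>k<m. J k * (w k)\<^sup>2) - Q1 + 1/4 * Q2"
    using ge' by linarith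
  also have "\<dots> = (\<Sum>k<m. g k * (w k)\<^sup>2)"
    unfolding Q1_def Q2_def sum_distrib_left sum_subtractf[symmetric] sum.distrib[symmetric]
    by (intro sum.cong refl) (simp add: g_def algebra_simps)
  also have "\<dots> < 0"
  proof -
    have neg: "g k < 0" if kin: "k \<in> Kp \<union> Kn" for k
    proof -
      consider "ev k \<ge> t" | "ev k < 0" using kin unfolding Kp_def Kn_def by blast
      then show ?thesis
      proof cases
        case 1
        then have "g k = - 3/4 * (ev k - t + \<eta>)" using \<eta> by (simp add: g_def J_def s_def field_simps)
        then show ?thesis using 1 \<eta> by simp
      next
        case 2
        then have "g k = 5/4 * \<eta> - 3/4 * t + 3/4 * ev k" using \<eta> by (simp add: g_def J_def s_def field_simps)
        then show ?thesis using 2 \<eta> by simp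
      qed
    qed
    obtain k0 where k0: "k0 \<in> Kp \<union> Kn" "x k0 \<noteq> 0" using x by blast
    have "(\<Sum>k<m. - (g k * (w k)\<^sup>2)) > 0"
    proof (rule sum_pos2[of _ k0])
      show "k0 \<in> {..<m}" using k0 sub by auto
      show "0 < - (g k0 * (w k0)\<^sup>2)"
        using neg[OF k0(1)] k0 by (simp add: w_def mult_neg_pos)
      show "0 \<le> - (g k * (w k)\<^sup>2)" for k
      proof (cases "k \<in> Kp \<union> Kn")
        case True
        then show ?thesis using neg[OF True] by (simp add: mult_nonpos_nonneg)
      qed (simp add: w_def)
    qed simp
    then show ?thesis by (simp add: sum_negf)
  qed
  finally show False by simp
qed

text \<open>Dual to the lower count, at s = t + \<eta>. The unknowns are a combination z of the
  eigenvectors in \<open>L\<close> and a free part of w on \<open>Kn\<close>; the equations make w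
  vanish on \<open>Kp\<close> and \<open>Kn\<close>. Then the right side of the Schur identity is
  negative, but w lives where 0 \<le> ev k \<le> t, and there \<open>good\<close> makes the left
  side nonnegative.\<close>

lemma eigenvalue_count_upper:
  fixes ev \<mu> :: "nat \<Rightarrow> real" and X :: "nat \<Rightarrow> nat \<Rightarrow> real" and t \<eta> :: real
  defines "J \<equiv> \<lambda>k. if ev k < 0 then -1 else (1 :: real)"
  assumes \<eta>: "\<eta> > 0" "2 * \<eta> \<le> t"
    and b: "\<And>i j. i < M \<Longrightarrow> j < M \<Longrightarrow> b i j = (\<Sum>k<m. J k * X i k * X j k)"
    and fam: "spectral_family M b m' \<mu> v"
    and good: "\<And>w. \<bar>(\<Sum>j<M. (\<Sum>k<m. X j k * w k)\<^sup>2) - (\<Sum>k<m. \<bar>ev k\<bar> * (w k)\<^sup>2)\<bar>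
        \<le> 1/4 * (\<Sum>k<m. (\<bar>ev k - t\<bar> + \<eta>) * (w k)\<^sup>2)"
  shows "card {l. l < m' \<and> \<mu> l > t + \<eta>} \<le> card {k. k < m \<and> ev k > t}"
proof (rule ccontr)
  define Kp where "Kp = {k. k < m \<and> ev k > t}"
  define Kn where "Kn = {k. k < m \<and> ev k < 0}"
  define L where "L = {l. l < m' \<and> \<mu> l > t + \<eta>}"
  define s where "s = t + \<eta>"
  assume "\<not> ?thesis"
  then have lt: "card Kp < card L" by (simp add: Kp_def L_def)
  have s: "s > 0" using \<eta> by (simp add: s_def)
  have fin: "finite Kp" "finite Kn" "finite L" by (auto simp: Kp_def Kn_def L_def)
  have disj: "Kp \<inter> Kn = {}" using \<eta> by (auto simp: Kp_def Kn_def)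
  have sub: "Kn \<subseteq> {..<m}" "L \<subseteq> {..<m'}" by (auto simp: Kn_def L_def)
  define c where "c k e = (case e of
      Inl k' \<Rightarrow> (if k = k' then 1 else 0)
    | Inr l \<Rightarrow> - J k * (\<Sum>j<M. X j k * v l j))" for k e
  have "card (Kp \<union> Kn) < card (Kn <+> L)"
    using lt fin disj by (simp add: card_Plus card_Un_disjoint)
  then have "\<exists>x. (\<exists>e\<in>Kn <+> L. x e \<noteq> 0) \<and> (\<forall>k\<in>Kp \<union> Kn. (\<Sum>e\<in>Kn <+> L. c k e * x e) = 0)"
    using fin by (intro underdetermined_system_nontrivial_solution) auto
  then obtain x where x: "\<exists>e\<in>Kn <+> L. x e \<noteq> 0"
      and xe: "\<And>k. k \<in> Kp \<union> Kn \<Longrightarrow> (\<Sum>e\<in>Kn <+> L. c k e * x e) = 0"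
    by blast
  define w' where "w' k = (if k \<in> Kn then x (Inl k) else 0)" for k
  define cl where "cl l = (if l \<in> L then x (Inr l) else 0)" for l
  define z where "z j = (\<Sum>l<m'. cl l * v l j)" for j
  define q where "q k = (\<Sum>j<M. X j k * z j)" for k
  \<comment> \<open>This makes w k + J k q k equal to \<open>w' k\<close>, which is supported on
    \<open>Kn\<close>, where J is -1; the first sum on the right thus becomes - |w'|^2.\<close>
  define w where "w k = w' k - J k * q k" for k
  define p where "p j = (\<Sum>k<m. X j k * w k)" for j
  have w0: "w k = 0" if k: "k \<in> Kp \<union> Kn" for k
  proof -
    have "0 = (\<Sum>k'\<in>Kn. (if k' = k then x (Inl k') else 0)) - (\<Sum>l\<in>L. J k * ((\<Sum>j<M. X j k * v l j) * x (Inr l)))"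
      using xe[OF k] fin unfolding c_def
      by (simp add: sum.Plus sum_negf if_distrib[of "\<lambda>y. y * _"] mult.assoc eq_commute[of k] cong: if_cong)
    also have "(\<Sum>k'\<in>Kn. (if k' = k then x (Inl k') else 0)) = w' k"
      using fin by (simp add: w'_def)
    also have "(\<Sum>l\<in>L. J k * ((\<Sum>j<M. X j k * v l j) * x (Inr l)))
        = (\<Sum>l<m'. J k * (\<Sum>j<M. X j k * v l j) * cl l)"
      unfolding cl_def sum_support[OF sub(2)] by (simp only: mult.assoc)
    also have "\<dots> = (\<Sum>l<m'. \<Sum>j<M. J k * (X j k * (cl l * v l j)))"
      unfolding sum_distrib_left sum_distrib_right by (intro sum.cong refl) simp
    also have "\<dots> = (\<Sum>j<M. \<Sum>l<m'. J k * (X j k * (cl l * v l j)))" by (rule sum.swap)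
    also have "\<dots> = J k * q k" by (simp only: q_def z_def sum_distrib_left)
    finally show ?thesis by (simp add: w_def)
  qed
  have JJ: "J k * J k = 1" for k by (simp add: J_def)
  have id: "s * (\<Sum>j<M. (z j + p j / s)\<^sup>2) + (\<Sum>k<m. J k * (w k)\<^sup>2) - (\<Sum>j<M. (p j)\<^sup>2) / s
       = (\<Sum>k<m. J k * (w k + J k * q k)\<^sup>2) + s * (\<Sum>j<M. (z j)\<^sup>2) - (\<Sum>k<m. J k * (q k)\<^sup>2)"
    unfolding p_def q_def by (rule schur_complement_identity) (use s JJ in auto)
  have vo: "orthonormal M m' v" by (rule spectral_family_orthonormal[OF fam])
  have vz: "inner_n M (v l) z = cl l" if "l < m'" for l
  proof -
    have "inner_n M (v l) z = (\<Sum>l'<m'. cl l' * inner_n M (v l) (v l'))"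
      unfolding z_def by (simp add: inner_n_sum_right inner_n_scale_right)
    also have "\<dots> = (\<Sum>l'<m'. cl l' * (if l' = l then 1 else 0))"
      by (intro sum.cong refl) (use that in \<open>simp add: orthonormal_inner[OF vo]\<close>)
    finally show ?thesis using that by simp
  qed
  have zz: "(\<Sum>j<M. (z j)\<^sup>2) = (\<Sum>l<m'. (cl l)\<^sup>2)"
    using orthonormal_inner_lincomb[OF vo, of cl cl] by (simp add: z_def inner_n_def power2_eq_square)
  have "(\<Sum>k<m. J k * (q k)\<^sup>2) = (\<Sum>l<m'. \<mu> l * (inner_n M (v l) z)\<^sup>2)"
    using gram_quadratic_form[where z = z, OF b] spectral_family_quadratic_form[OF fam, of z]
    by (simp add: q_def)
  also have "\<dots> = (\<Sum>l<m'. \<mu> l * (cl l)\<^sup>2)" by (intro sum.cong refl) (simp add: vz)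
  finally have qq: "(\<Sum>k<m. J k * (q k)\<^sup>2) = (\<Sum>l<m'. \<mu> l * (cl l)\<^sup>2)" .
  have ww: "(\<Sum>k<m. J k * (w k + J k * q k)\<^sup>2) = - (\<Sum>k<m. (w' k)\<^sup>2)"
    unfolding sum_negf[symmetric]
    by (intro sum.cong refl) (auto simp: w_def w'_def J_def Kn_def)
  have "(\<Sum>k<m. J k * (w k + J k * q k)\<^sup>2) + s * (\<Sum>j<M. (z j)\<^sup>2) - (\<Sum>k<m. J k * (q k)\<^sup>2)
      = - ((\<Sum>k<m. (w' k)\<^sup>2) + (\<Sum>l<m'. (\<mu> l - s) * (cl l)\<^sup>2))"
    unfolding ww qq zz by (simp add: left_diff_distrib sum_subtractf sum_distrib_left)
  also have "\<dots> < 0"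
  proof -
    have n1: "(\<Sum>k<m. (w' k)\<^sup>2) \<ge> 0" by (simp add: sum_nonneg)
    have n2: "(\<mu> l - s) * (cl l)\<^sup>2 \<ge> 0" for l by (auto simp: cl_def L_def s_def)
    have n3: "(\<Sum>l<m'. (\<mu> l - s) * (cl l)\<^sup>2) \<ge> 0" by (intro sum_nonneg n2)
    from x consider k where "k \<in> Kn" "x (Inl k) \<noteq> 0" | l where "l \<in> L" "x (Inr l) \<noteq> 0" by blast
    then have "(\<Sum>k<m. (w' k)\<^sup>2) > 0 \<or> (\<Sum>l<m'. (\<mu> l - s) * (cl l)\<^sup>2) > 0"
    proof cases
      case 1
      have "(\<Sum>k<m. (w' k)\<^sup>2) > 0"
        by (rule sum_pos2[of _ k]) (use 1 sub in \<open>auto simp: w'_def\<close>)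
      then show ?thesis ..
    next
      case 2
      have "(\<Sum>l<m'. (\<mu> l - s) * (cl l)\<^sup>2) > 0"
        by (rule sum_pos2[of _ l, OF _ _ _ n2]) (use 2 sub in \<open>auto simp: cl_def L_def s_def\<close>)
      then show ?thesis ..
    qed
    then show ?thesis using n1 n3 by linarith
  qed
  finally have neg: "s * (\<Sum>j<M. (z j + p j / s)\<^sup>2) + (\<Sum>k<m. J k * (w k)\<^sup>2) - (\<Sum>j<M. (p j)\<^sup>2) / s < 0"
    using id by simp
  moreover have "s * (\<Sum>j<M. (z j + p j / s)\<^sup>2) \<ge> 0"
    using s by (simp add: sum_nonneg)
  ultimately have "(\<Sum>k<m. J k * (w k)\<^sup>2) - (\<Sum>j<M. (p j)\<^sup>2) / s < 0" by linarith
  then have lt0: "s * (\<Sum>k<m. J k * (w k)\<^sup>2) - (\<Sum>j<M. (p j)\<^sup>2) < 0"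
    using s by (simp add: field_simps)
  \<comment> \<open>Off \<open>Kp\<close> and \<open>Kn\<close> this coefficient equals 3/4 (t - ev
    k + \<eta>).\<close>
  define g where "g k = s * J k - \<bar>ev k\<bar> - 1/4 * (\<bar>ev k - t\<bar> + \<eta>)" for k
  define Q1 where "Q1 = (\<Sum>k<m. \<bar>ev k\<bar> * (w k)\<^sup>2)"
  define Q2 where "Q2 = (\<Sum>k<m. (\<bar>ev k - t\<bar> + \<eta>) * (w k)\<^sup>2)"
  have "\<bar>(\<Sum>j<M. (p j)\<^sup>2) - Q1\<bar> \<le> 1/4 * Q2"
    unfolding p_def Q1_def Q2_def by (rule good)
  then have "s * (\<Sum>k<m. J k * (w k)\<^sup>2) - Q1 - 1/4 * Q2 < 0"
    using lt0 by linarith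
  moreover have "s * (\<Sum>k<m. J k * (w k)\<^sup>2) - Q1 - 1/4 * Q2 = (\<Sum>k<m. g k * (w k)\<^sup>2)"
    unfolding Q1_def Q2_def sum_distrib_left sum_subtractf[symmetric]
    by (intro sum.cong refl) (simp add: g_def algebra_simps)
  moreover have "(\<Sum>k<m. g k * (w k)\<^sup>2) \<ge> 0"
  proof (rule sum_nonneg)
    fix k assume "k \<in> {..<m}"
    then have k: "k < m" by simp
    show "0 \<le> g k * (w k)\<^sup>2"
    proof (cases "k \<in> Kp \<union> Kn")
      case True then show ?thesis by (simp add: w0)
    next
      case False
      then have "0 \<le> ev k" "ev k \<le> t" using k by (auto simp: Kp_def Kn_def)
      then have "g k \<ge> 0" using \<eta> by (simp add: g_def J_def s_def)
      then show ?thesis by simp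
    qed
  qed
  ultimately show False by simp
qed

section \<open>Halving a matrix\<close>

text \<open>The same set \<open>S\<close> records the kept member of each pair {j, j + M} and,
  through \<open>set_sign\<close>, the Rademacher signs of the deviation that this choice
  causes.\<close>

definition select_half :: "nat \<Rightarrow> nat set \<Rightarrow> nat \<Rightarrow> nat" where
  "select_half M S j = (if j \<in> S then j else j + M)"

text \<open>The hypothesis \<open>good\<close> of both eigenvalue counts at threshold
  \<open>t\<close>. The inner sums are the entries of X w; the 2 under the root compensates for
  dropping half of the indices.\<close>

definition sampled_gram_close ::
    "nat \<Rightarrow> nat \<Rightarrow> (nat \<Rightarrow> real) \<Rightarrow> (nat \<Rightarrow> nat \<Rightarrow> real) \<Rightarrow> real \<Rightarrow> real \<Rightarrow> nat set \<Rightarrow> bool" where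
  "sampled_gram_close M m ev u t \<eta> S \<longleftrightarrow> (\<forall>w.
     \<bar>(\<Sum>j<M. (\<Sum>k<m. sqrt (2 * \<bar>ev k\<bar>) * u k (select_half M S j) * w k)\<^sup>2) - (\<Sum>k<m. \<bar>ev k\<bar> * (w k)\<^sup>2)\<bar>
       \<le> 1/4 * (\<Sum>k<m. (\<bar>ev k - t\<bar> + \<eta>) * (w k)\<^sup>2))"

section \<open>Concentration for a random half\<close>

lemma sum_lessThan_double:
  fixes f :: "nat \<Rightarrow> real"
  shows "(\<Sum>i<2 * M. f i) = (\<Sum>j<M. f j + f (j + M))"
proof -
  have "(\<Sum>i<2 * M. f i) = sum f {..<M} + sum f {M..<M + M}"
    by (simp add: mult_2 lessThan_atLeast0 sum.atLeastLessThan_concat)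
  also have "sum f {M..<M + M} = (\<Sum>j<M. f (j + M))"
    using sum.shift_bounds_nat_ivl[of f 0 M M] by (simp add: lessThan_atLeast0)
  finally show ?thesis by (simp add: sum.distrib)
qed

lemma orthonormal_entry_bound:
  assumes "orthonormal N m u" "i < N"
  shows "(\<Sum>k<m. (u k i)\<^sup>2) \<le> 1"
proof -
  let ?e = "\<lambda>j. if j = i then 1 else (0 :: real)"
  have "inner_n N (u k) ?e = u k i" for k using assms(2) by (simp add: inner_n_def)
  moreover have "inner_n N ?e ?e = 1" using assms(2) by (simp add: inner_n_def)
  ultimately show ?thesis using bessel_inequality[OF assms(1), of ?e] by simp
qed

text \<open>Row \<open>i\<close> of \<open>a\<close> has coordinates \<open>ev k * u k i\<close> in
  the system \<open>u\<close>, so the sum is its squared length. This is where the bound on the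
  entries enters.\<close>

lemma spectral_family_row_bound:
  assumes fam: "spectral_family N a m ev u" and i: "i < N"
    and a: "\<And>i j. i < N \<Longrightarrow> j < N \<Longrightarrow> \<bar>a i j\<bar> \<le> 1"
  shows "(\<Sum>k<m. (ev k)\<^sup>2 * (u k i)\<^sup>2) \<le> N"
proof -
  have "(\<Sum>k<m. (ev k)\<^sup>2 * (u k i)\<^sup>2) = inner_n N (\<lambda>j. \<Sum>k<m. (ev k * u k i) * u k j) (\<lambda>j. \<Sum>k<m. (ev k * u k i) * u k j)"
    unfolding orthonormal_inner_lincomb[OF spectral_family_orthonormal[OF fam]]
    by (simp add: power2_eq_square mult_ac)
  also have "\<dots> = inner_n N (a i) (a i)"
    by (intro inner_n_cong) (simp_all add: spectral_familyD[OF fam i])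
  also have "\<dots> \<le> (\<Sum>j<N. 1)"
    unfolding inner_n_def
  proof (rule sum_mono)
    fix j assume "j \<in> {..<N}"
    then have "\<bar>a i j\<bar> * \<bar>a i j\<bar> \<le> 1 * 1" using a[OF i] by (intro mult_mono) auto
    then show "a i j * a i j \<le> 1" by simp
  qed
  finally show ?thesis by simp
qed

text \<open>Eigenvalues near \<open>t\<close> carry the weight \<open>t / \<eta>\<close>, but few of them can load on one coordinate.\<close>

lemma weighted_leverage_bound:
  assumes fam: "spectral_family N a m ev u" and i: "i < N"
    and a: "\<And>i j. i < N \<Longrightarrow> j < N \<Longrightarrow> \<bar>a i j\<bar> \<le> 1"
    and \<eta>: "\<eta> \<ge> sqrt N" and t: "2 * \<eta> \<le> t"
  shows "(\<Sum>k<m. \<bar>ev k\<bar> / (\<bar>ev k - t\<bar> + \<eta>) * (u k i)\<^sup>2) \<le> 4 * sqrt N / t"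
proof -
  define R where "R = sqrt N"
  have R: "R > 0" "R\<^sup>2 = N" using i by (auto simp: R_def)
  have "\<eta> > 0" using R(1) \<eta> unfolding R_def by linarith
  then have pos: "\<eta> > 0" "t > 0" using t by auto
  \<comment> \<open>What is known about coordinate \<open>i\<close> are the sums of (ev k)^2 (u k
    i)^2 and of (u k i)^2, so the weight is bounded by a multiple of (ev k)^2 plus a constant. For
    |ev k| \<ge> t / 2 the denominator is at least \<eta>, otherwise at least t / 2; the linear term
    is split by the arithmetic-geometric mean inequality.\<close>
  have "\<bar>ev k\<bar> / (\<bar>ev k - t\<bar> + \<eta>) \<le> (2 / (\<eta> * t) + 1 / (R * t)) * (ev k)\<^sup>2 + R / t" for k
  proof -
    have am: "2 * \<bar>ev k\<bar> / t \<le> 1 / (R * t) * (ev k)\<^sup>2 + R / t"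
    proof -
      have "2 * \<bar>ev k\<bar> * R \<le> (ev k)\<^sup>2 + R\<^sup>2"
        using sum_squares_bound[of "\<bar>ev k\<bar>" R] by simp
      then have "2 * \<bar>ev k\<bar> * R / (R * t) \<le> ((ev k)\<^sup>2 + R\<^sup>2) / (R * t)"
        using R pos by (intro divide_right_mono) auto
      then show ?thesis using R(1) pos by (simp add: add_divide_distrib power2_eq_square)
    qed
    have n: "2 / (\<eta> * t) * (ev k)\<^sup>2 \<ge> 0" "1 / (R * t) * (ev k)\<^sup>2 + R / t \<ge> 0" using pos R(1) by auto
    have "\<bar>ev k\<bar> / (\<bar>ev k - t\<bar> + \<eta>) \<le> 2 / (\<eta> * t) * (ev k)\<^sup>2 + 2 * \<bar>ev k\<bar> / t"
    proof (cases "\<bar>ev k\<bar> \<ge> t / 2")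
      case True
      have "\<bar>ev k\<bar> / (\<bar>ev k - t\<bar> + \<eta>) \<le> \<bar>ev k\<bar> / \<eta>"
        using pos by (intro divide_left_mono) auto
      also have "\<dots> = \<bar>ev k\<bar> * t / (\<eta> * t)" using pos by simp
      also have "\<dots> \<le> \<bar>ev k\<bar> * (2 * \<bar>ev k\<bar>) / (\<eta> * t)"
        using True pos by (intro divide_right_mono mult_left_mono) auto
      also have "\<dots> = 2 / (\<eta> * t) * (ev k)\<^sup>2" by (simp add: power2_eq_square)
      finally show ?thesis using pos by (simp add: add_increasing2)
    next
      case False
      have "\<bar>ev k\<bar> / (\<bar>ev k - t\<bar> + \<eta>) \<le> \<bar>ev k\<bar> / (t / 2)"
        using False pos by (intro divide_left_mono) auto
      then show ?thesis using n(1) by (simp add: mult.commute)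
    qed
    then show ?thesis using am by (simp add: algebra_simps)
  qed
  then have "(\<Sum>k<m. \<bar>ev k\<bar> / (\<bar>ev k - t\<bar> + \<eta>) * (u k i)\<^sup>2)
      \<le> (\<Sum>k<m. ((2 / (\<eta> * t) + 1 / (R * t)) * (ev k)\<^sup>2 + R / t) * (u k i)\<^sup>2)"
    by (intro sum_mono mult_right_mono) auto
  also have "\<dots> = (2 / (\<eta> * t) + 1 / (R * t)) * (\<Sum>k<m. (ev k)\<^sup>2 * (u k i)\<^sup>2) + R / t * (\<Sum>k<m. (u k i)\<^sup>2)"
    unfolding sum_distrib_left sum.distrib[symmetric] by (intro sum.cong refl) (simp add: algebra_simps)
  also have "\<dots> \<le> (2 / (\<eta> * t) + 1 / (R * t)) * R\<^sup>2 + R / t * 1"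
    unfolding R(2)
    using pos R(1) spectral_family_row_bound[OF fam i a]
      orthonormal_entry_bound[OF spectral_family_orthonormal[OF fam] i]
    by (intro add_mono mult_left_mono) auto
  also have "\<dots> = 2 * R * (R / \<eta>) / t + 2 * R / t"
    using pos R(1) by (simp add: field_simps power2_eq_square)
  also have "\<dots> \<le> 2 * R * 1 / t + 2 * R / t"
    using pos R(1) \<eta> by (intro add_mono divide_right_mono mult_left_mono) (auto simp: R_def)
  finally show ?thesis by (simp add: R_def)
qed

text \<open>The image of w is p x - q y with p, q the inner products of w with x, y, and |p x - q
  y|^2 + |p x + q y|^2 is twice the sum of the squared lengths of p x and q y. Summed over all
  pairs, this controls the matrix variance.\<close>

lemma rank_one_difference_norm:
  fixes H :: "nat \<Rightarrow> nat \<Rightarrow> real"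
  assumes H: "\<And>k l. H k l = x k * x l - y k * y l"
    and x: "inner_n m x x \<le> B" and y: "inner_n m y y \<le> B"
  shows "inner_n m (mat_app m H w) (mat_app m H w) \<le> 2 * B * ((inner_n m x w)\<^sup>2 + (inner_n m y w)\<^sup>2)"
proof -
  let ?p = "inner_n m x w" and ?q = "inner_n m y w"
  have H: "mat_app m H w k = ?p * x k - ?q * y k" for k
    unfolding mat_app_def inner_n_def sum_distrib_right sum_subtractf[symmetric]
    by (intro sum.cong refl) (simp add: H algebra_simps)
  have "inner_n m (mat_app m H w) (mat_app m H w) \<le> (\<Sum>k<m. 2 * (?p\<^sup>2 * (x k * x k)) + 2 * (?q\<^sup>2 * (y k * y k)))"
    unfolding inner_n_def[of m "mat_app m H w"]
  proof (rule sum_mono)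
    fix k
    have "(?p * x k + ?q * y k)\<^sup>2 \<ge> 0" by simp
    then show "mat_app m H w k * mat_app m H w k \<le> 2 * (?p\<^sup>2 * (x k * x k)) + 2 * (?q\<^sup>2 * (y k * y k))"
      by (simp add: H power2_eq_square algebra_simps)
  qed
  also have "\<dots> = 2 * (?p\<^sup>2 * inner_n m x x) + 2 * (?q\<^sup>2 * inner_n m y y)"
    by (simp only: inner_n_def[of m x x] inner_n_def[of m y y] sum.distrib sum_distrib_left)
  also have "\<dots> \<le> 2 * (?p\<^sup>2 * B) + 2 * (?q\<^sup>2 * B)"
    using x y by (intro add_mono mult_left_mono) auto
  finally show ?thesis by (simp add: algebra_simps)
qed

lemma orthonormal_column_energy:
  assumes "orthonormal N m u"
  shows "(\<Sum>i<N. (\<Sum>k<m. d k * u k i * w k)\<^sup>2) = (\<Sum>k<m. (d k)\<^sup>2 * (w k)\<^sup>2)"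
proof -
  have "(\<Sum>i<N. (\<Sum>k<m. d k * u k i * w k)\<^sup>2)
      = inner_n N (\<lambda>i. \<Sum>k<m. (d k * w k) * u k i) (\<lambda>i. \<Sum>k<m. (d k * w k) * u k i)"
    unfolding inner_n_def power2_eq_square by (simp only: mult.assoc mult.commute[of "w _"])
  then show ?thesis
    unfolding orthonormal_inner_lincomb[OF assms] by (simp add: power2_eq_square mult_ac)
qed

text \<open>Within a pair, twice the kept term minus the sum of both terms is their difference up to
  sign, and by orthonormality the terms of all indices add up to exactly the form of
  |\<Lambda>|.\<close>

lemma sampled_gram_deviation:
  assumes orth: "orthonormal (2 * M) m u"
  shows "(\<Sum>j<M. (\<Sum>k<m. sqrt (2 * \<bar>ev k\<bar>) * u k (select_half M S j) * w k)\<^sup>2) - (\<Sum>k<m. \<bar>ev k\<bar> * (w k)\<^sup>2)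
    = (\<Sum>j<M. set_sign S j * ((\<Sum>k<m. sqrt \<bar>ev k\<bar> * u k j * w k)\<^sup>2
                             - (\<Sum>k<m. sqrt \<bar>ev k\<bar> * u k (j + M) * w k)\<^sup>2))"
proof -
  define f where "f i = (\<Sum>k<m. sqrt \<bar>ev k\<bar> * u k i * w k)\<^sup>2" for i
  have "(\<Sum>k<m. sqrt (2 * \<bar>ev k\<bar>) * u k i * w k)\<^sup>2 = 2 * f i" for i
  proof -
    have "(\<Sum>k<m. sqrt (2 * \<bar>ev k\<bar>) * u k i * w k) = sqrt 2 * (\<Sum>k<m. sqrt \<bar>ev k\<bar> * u k i * w k)"
      by (simp add: real_sqrt_mult sum_distrib_left mult.assoc)
    then show ?thesis by (simp add: f_def power_mult_distrib)
  qed
  moreover have "(\<Sum>k<m. \<bar>ev k\<bar> * (w k)\<^sup>2) = (\<Sum>j<M. f j + f (j + M))"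
    using orthonormal_column_energy[OF orth, of "\<lambda>k. sqrt \<bar>ev k\<bar>" w]
    by (simp add: sum_lessThan_double f_def)
  ultimately show ?thesis
    unfolding f_def[symmetric] by (simp only: sum_subtractf[symmetric]) 
      (intro sum.cong refl, simp add: set_sign_def select_half_def)
qed

text \<open>Rescaling w by the square roots of the weights \<open>W\<close> reduces the event to all
  eigenvalues of the signed sum of the \<open>H j\<close> lying in [-1/4, 1/4]. In the variance, a
  leverage of at most 4 R / t meets an energy of at most t / \<eta>; the cancellation of t makes the
  bound uniform in the threshold. Markov's inequality for the trace of the 2p-th power then counts
  the bad sets.\<close>

lemma bad_selection_count:
  assumes fam: "spectral_family (2 * M) a m ev u"
    and a: "\<And>i j. i < 2 * M \<Longrightarrow> j < 2 * M \<Longrightarrow> \<bar>a i j\<bar> \<le> 1"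
    and \<eta>: "\<eta> \<ge> sqrt (2 * M)" and t: "2 * \<eta> \<le> t" and M: "M > 0"
  shows "real (card {S \<in> Pow {..<M}. \<not> sampled_gram_close M m ev u t \<eta> S})
      \<le> (\<Prod>q<p. real (2 * q + 1)) * (128 * sqrt (2 * M) / \<eta>) ^ p * m * 2 ^ M"
proof -
  define R where "R = sqrt (2 * M)"
  have R: "R > 0" using M by (simp add: R_def)
  have "\<eta> > 0" using R \<eta> unfolding R_def by linarith
  then have pos: "\<eta> > 0" "t > 0" using t by auto
  define W where "W k = \<bar>ev k - t\<bar> + \<eta>" for k
  have W: "W k > 0" for k using pos by (simp add: W_def)
  define d where "d k = sqrt (\<bar>ev k\<bar> / W k)" for k
  have d2: "(d k)\<^sup>2 = \<bar>ev k\<bar> / W k" for k using W[of k] by (simp add: d_def)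
  define y where "y i k = d k * u k i" for i k
  define H where "H j k l = y j k * y j l - y (j + M) k * y (j + M) l" for j k l
  define \<sigma>2 where "\<sigma>2 = 8 * R / \<eta>"
  have orth: "orthonormal (2 * M) m u" by (rule spectral_family_orthonormal[OF fam])
  have yB: "inner_n m (y i) (y i) \<le> 4 * R / t" if "i < 2 * M" for i
  proof -
    have "inner_n m (y i) (y i) = (\<Sum>k<m. \<bar>ev k\<bar> / (\<bar>ev k - t\<bar> + \<eta>) * (u k i)\<^sup>2)"
      unfolding inner_n_def W_def[symmetric] d2[symmetric] by (simp add: y_def power2_eq_square mult_ac)
    then show ?thesis
      using weighted_leverage_bound[OF fam that a, of \<eta> t] \<eta> t by (simp add: R_def)
  qed
  have y_energy: "(\<Sum>i<2 * M. (inner_n m (y i) w)\<^sup>2) \<le> t / \<eta> * inner_n m w w" for w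
  proof -
    have "(\<Sum>i<2 * M. (inner_n m (y i) w)\<^sup>2) = (\<Sum>k<m. \<bar>ev k\<bar> / W k * (w k)\<^sup>2)"
      using orthonormal_column_energy[OF orth, of d w] by (simp add: inner_n_def y_def d2)
    also have "\<dots> \<le> (\<Sum>k<m. t / \<eta> * (w k)\<^sup>2)"
    proof (intro sum_mono mult_right_mono)
      fix k
      have "\<bar>ev k\<bar> * \<eta> \<le> (t + \<bar>ev k - t\<bar>) * \<eta>" using pos by (intro mult_right_mono) auto
      also have "\<dots> \<le> t * (\<bar>ev k - t\<bar> + \<eta>)"
        using mult_left_mono[of \<eta> t "\<bar>ev k - t\<bar>"] t pos by (simp add: algebra_simps)
      finally show "\<bar>ev k\<bar> / W k \<le> t / \<eta>" using W[of k] pos by (simp add: W_def field_simps)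
    qed simp
    finally show ?thesis by (simp add: inner_n_def sum_distrib_left power2_eq_square)
  qed
  have var: "(\<Sum>j<M. inner_n m (mat_app m (H j) w) (mat_app m (H j) w)) \<le> \<sigma>2 * inner_n m w w" for w
  proof -
    have "(\<Sum>j<M. inner_n m (mat_app m (H j) w) (mat_app m (H j) w))
        \<le> (\<Sum>j<M. 2 * (4 * R / t) * ((inner_n m (y j) w)\<^sup>2 + (inner_n m (y (j + M)) w)\<^sup>2))"
      by (intro sum_mono rank_one_difference_norm yB) (auto simp: H_def)
    also have "\<dots> = 2 * (4 * R / t) * (\<Sum>i<2 * M. (inner_n m (y i) w)\<^sup>2)"
      by (simp only: sum_lessThan_double sum_distrib_left)
    also have "\<dots> \<le> 2 * (4 * R / t) * (t / \<eta> * inner_n m w w)"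
      using R pos by (intro mult_left_mono y_energy) auto
    also have "\<dots> = \<sigma>2 * inner_n m w w" using pos by (simp add: \<sigma>2_def field_simps)
    finally show ?thesis .
  qed
  define Q where "Q S f = spectral_family m (\<lambda>k l. \<Sum>j<M. set_sign S j * H j k l) m (fst f) (snd f)"
    for S and f :: "(nat \<Rightarrow> real) \<times> (nat \<Rightarrow> nat \<Rightarrow> real)"
  have "\<exists>f. Q S f" for S
  proof -
    have "\<exists>ev u. spectral_family m (\<lambda>k l. \<Sum>j<M. set_sign S j * H j k l) m ev u"
      by (rule spectral_family_exists) (simp add: H_def mult_ac)
    then show ?thesis unfolding Q_def by simp
  qed
  then obtain f where f: "\<And>S. Q S (f S)" by metis
  define \<nu> U where "\<nu> S = fst (f S)" and "U S = snd (f S)" for S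
  have \<nu>: "spectral_family m (\<lambda>k l. \<Sum>j<M. set_sign S j * H j k l) m (\<nu> S) (U S)" for S
    using f[of S] unfolding Q_def \<nu>_def U_def .
  have moment: "(\<Sum>S\<in>Pow {..<M}. \<Sum>k<m. \<nu> S k ^ (2 * p)) \<le> (\<Prod>q<p. real (2 * q + 1)) * \<sigma>2 ^ p * m * 2 ^ M"
    by (rule noncommutative_khintchine[OF \<nu> var]) (use R pos in \<open>simp add: \<sigma>2_def\<close>)
  have close: "sampled_gram_close M m ev u t \<eta> S" if small: "\<And>k. k < m \<Longrightarrow> \<bar>\<nu> S k\<bar> \<le> 1/4" for S
    unfolding sampled_gram_close_def
  proof
    fix w :: "nat \<Rightarrow> real"
    define w' where "w' k = sqrt (W k) * w k" for k
    have yw: "inner_n m (y i) w' = (\<Sum>k<m. sqrt \<bar>ev k\<bar> * u k i * w k)" for i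
      unfolding inner_n_def
    proof (intro sum.cong refl)
      fix k
      have "sqrt (\<bar>ev k\<bar> / W k) * sqrt (W k) = sqrt \<bar>ev k\<bar>"
        using W[of k] by (simp flip: real_sqrt_mult)
      then show "y i k * w' k = sqrt \<bar>ev k\<bar> * u k i * w k"
        by (simp add: y_def w'_def d_def mult_ac)
    qed
    have "(\<Sum>k<m. \<Sum>l<m. w' k * w' l * (\<Sum>j<M. set_sign S j * H j k l))
        = (\<Sum>j<M. set_sign S j * ((inner_n m (y j) w')\<^sup>2 - (inner_n m (y (j + M)) w')\<^sup>2))"
    proof -
      have Hj: "(\<Sum>k<m. \<Sum>l<m. w' k * w' l * H j k l)
          = (inner_n m (y j) w')\<^sup>2 - (inner_n m (y (j + M)) w')\<^sup>2" for j
      proof -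
        have "(\<Sum>k<m. \<Sum>l<m. w' k * w' l * H j k l)
            = (\<Sum>k<m. \<Sum>l<m. (y j k * w' k) * (y j l * w' l))
            - (\<Sum>k<m. \<Sum>l<m. (y (j + M) k * w' k) * (y (j + M) l * w' l))"
          unfolding sum_subtractf[symmetric] by (intro sum.cong refl) (simp add: H_def algebra_simps)
        then show ?thesis unfolding inner_n_def power2_eq_square sum_product .
      qed
      have "(\<Sum>k<m. \<Sum>l<m. w' k * w' l * (\<Sum>j<M. set_sign S j * H j k l))
          = (\<Sum>k<m. \<Sum>l<m. \<Sum>j<M. set_sign S j * (w' k * w' l * H j k l))"
        by (simp add: sum_distrib_left mult_ac)
      also have "\<dots> = (\<Sum>k<m. \<Sum>j<M. \<Sum>l<m. set_sign S j * (w' k * w' l * H j k l))"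
        by (intro sum.cong refl sum.swap)
      also have "\<dots> = (\<Sum>j<M. \<Sum>k<m. \<Sum>l<m. set_sign S j * (w' k * w' l * H j k l))"
        by (rule sum.swap)
      also have "\<dots> = (\<Sum>j<M. set_sign S j * (\<Sum>k<m. \<Sum>l<m. w' k * w' l * H j k l))"
        by (simp only: sum_distrib_left)
      also have "\<dots> = (\<Sum>j<M. set_sign S j * ((inner_n m (y j) w')\<^sup>2 - (inner_n m (y (j + M)) w')\<^sup>2))"
        by (simp only: Hj)
      finally show ?thesis .
    qed
    also have "(\<Sum>k<m. \<Sum>l<m. w' k * w' l * (\<Sum>j<M. set_sign S j * H j k l))
        = (\<Sum>k<m. \<nu> S k * (inner_n m (U S k) w')\<^sup>2)"
      by (rule spectral_family_quadratic_form[OF \<nu>])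
    finally have eq: "(\<Sum>k<m. \<nu> S k * (inner_n m (U S k) w')\<^sup>2)
        = (\<Sum>j<M. set_sign S j * ((\<Sum>k<m. sqrt \<bar>ev k\<bar> * u k j * w k)\<^sup>2
                             - (\<Sum>k<m. sqrt \<bar>ev k\<bar> * u k (j + M) * w k)\<^sup>2))"
      unfolding yw .
    have "\<bar>\<Sum>k<m. \<nu> S k * (inner_n m (U S k) w')\<^sup>2\<bar> \<le> (\<Sum>k<m. \<bar>\<nu> S k * (inner_n m (U S k) w')\<^sup>2\<bar>)"
      by (rule sum_abs)
    also have "\<dots> \<le> (\<Sum>k<m. 1/4 * (inner_n m (U S k) w')\<^sup>2)"
      unfolding abs_mult by (intro sum_mono mult_mono small) auto
    also have "\<dots> \<le> 1/4 * inner_n m w' w'"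
      unfolding sum_distrib_left[symmetric]
      by (intro mult_left_mono bessel_inequality[OF spectral_family_orthonormal[OF \<nu>]]) auto
    also have "inner_n m w' w' = (\<Sum>k<m. (\<bar>ev k - t\<bar> + \<eta>) * (w k)\<^sup>2)"
      unfolding inner_n_def W_def[symmetric]
    proof (intro sum.cong refl)
      fix k
      have "sqrt (W k) * sqrt (W k) = W k" using W[of k] by simp
      then show "w' k * w' k = W k * (w k)\<^sup>2"
        unfolding w'_def power2_eq_square by (metis mult.assoc mult.left_commute)
    qed
    finally show "\<bar>(\<Sum>j<M. (\<Sum>k<m. sqrt (2 * \<bar>ev k\<bar>) * u k (select_half M S j) * w k)\<^sup>2)
        - (\<Sum>k<m. \<bar>ev k\<bar> * (w k)\<^sup>2)\<bar> \<le> 1/4 * (\<Sum>k<m. (\<bar>ev k - t\<bar> + \<eta>) * (w k)\<^sup>2)"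
      unfolding eq sampled_gram_deviation[OF orth] .
  qed
  let ?bad = "{S \<in> Pow {..<M}. \<not> sampled_gram_close M m ev u t \<eta> S}"
  have "real (card ?bad) * (1/4) ^ (2 * p) = (\<Sum>S\<in>?bad. (1/4) ^ (2 * p))" by simp
  also have "\<dots> \<le> (\<Sum>S\<in>?bad. \<Sum>k<m. \<nu> S k ^ (2 * p))"
  proof (rule sum_mono)
    fix S assume "S \<in> ?bad"
    then obtain k where k: "k < m" "\<bar>\<nu> S k\<bar> > 1/4" using close[of S] not_le by blast
    have "(1/4) ^ (2 * p) \<le> \<bar>\<nu> S k\<bar> ^ (2 * p)" using k by (intro power_mono) auto
    also have "\<dots> = \<nu> S k ^ (2 * p)" by (simp add: power_even_abs)
    also have "\<dots> \<le> (\<Sum>k<m. \<nu> S k ^ (2 * p))"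
      using k by (intro member_le_sum) (auto simp: zero_le_even_power)
    finally show "(1/4) ^ (2 * p) \<le> (\<Sum>k<m. \<nu> S k ^ (2 * p))" .
  qed
  also have "\<dots> \<le> (\<Sum>S\<in>Pow {..<M}. \<Sum>k<m. \<nu> S k ^ (2 * p))"
    by (rule sum_mono2) (auto intro!: sum_nonneg simp: zero_le_even_power)
  also note moment
  finally have "real (card ?bad) * (1/4) ^ (2 * p) \<le> (\<Prod>q<p. real (2 * q + 1)) * \<sigma>2 ^ p * m * 2 ^ M" .
  \<comment> \<open>Markov at level (1/4)^(2p) costs 16^p, which turns the variance 8 R / \<eta>
    into 128 R / \<eta>.\<close>
  then have "real (card ?bad) * (1/4) ^ (2 * p) * 16 ^ p
      \<le> (\<Prod>q<p. real (2 * q + 1)) * \<sigma>2 ^ p * m * 2 ^ M * 16 ^ p"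
    by (intro mult_right_mono) auto
  moreover have one: "(1/4 :: real) ^ (2 * p) * 16 ^ p = 1"
    by (simp add: power_mult power_mult_distrib[symmetric] power2_eq_square)
  ultimately have "real (card ?bad) \<le> (\<Prod>q<p. real (2 * q + 1)) * \<sigma>2 ^ p * m * 2 ^ M * 16 ^ p"
    by (simp only: mult.assoc mult_1_right)
  also have "\<dots> = (\<Prod>q<p. real (2 * q + 1)) * (\<sigma>2 ^ p * 16 ^ p) * m * 2 ^ M"
    by (simp only: mult_ac)
  also have "\<sigma>2 ^ p * 16 ^ p = (128 * R / \<eta>) ^ p"
    unfolding power_mult_distrib[symmetric] by (simp add: \<sigma>2_def)
  finally show ?thesis unfolding R_def .
qed

section \<open>Comparing spectra of matrices of different sizes\<close>

definition pos_eig :: "nat \<Rightarrow> (nat \<Rightarrow> real) \<Rightarrow> nat \<Rightarrow> real" where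
  "pos_eig m ev k = (if k < m then max 0 (ev k) else 0)"

text \<open>Size of the \<open>k\<close>-th most negative eigenvalue. Like \<open>pos_eig\<close> it
  continues by 0 beyond the dimension, so spectra of different lengths are compared index by index.
  The split by sign is forced, as changing the dimension adds or removes values in the middle of the
  sorted list.\<close>

definition neg_eig :: "nat \<Rightarrow> (nat \<Rightarrow> real) \<Rightarrow> nat \<Rightarrow> real" where
  "neg_eig m ev = pos_eig m (\<lambda>k. - ev (m - Suc k))"

text \<open>The factor \<open>c\<close> undoes the shrinking of the spectrum under sampling, 2 for
  each halving.\<close>

definition eig_close :: "nat \<Rightarrow> (nat \<Rightarrow> real) \<Rightarrow> nat \<Rightarrow> (nat \<Rightarrow> real) \<Rightarrow> real \<Rightarrow> real \<Rightarrow> bool" where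
  "eig_close m ev m' \<mu> c r \<longleftrightarrow>
     (\<forall>k. \<bar>pos_eig m ev k - c * pos_eig m' \<mu> k\<bar> \<le> r \<and> \<bar>neg_eig m ev k - c * neg_eig m' \<mu> k\<bar> \<le> r)"

lemma pos_eig_scale: "c \<ge> 0 \<Longrightarrow> pos_eig m (\<lambda>k. c * ev k) k = c * pos_eig m ev k"
  by (simp add: pos_eig_def max_def mult_le_0_iff zero_le_mult_iff)

lemma neg_eig_scale: "c \<ge> 0 \<Longrightarrow> neg_eig m (\<lambda>k. c * ev k) k = c * neg_eig m ev k"
  using pos_eig_scale[of c m "\<lambda>k. - ev (m - Suc k)" k] by (simp add: neg_eig_def)

lemma eig_close_trans:
  assumes "eig_close m ev m' \<mu> c r" "eig_close m' \<mu> m'' \<kappa> c' r'" "c \<ge> 0"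
  shows "eig_close m ev m'' \<kappa> (c * c') (r + c * r')"
proof -
  have aux: "\<bar>x - c * c' * z\<bar> \<le> r + c * r'" if "\<bar>x - c * y\<bar> \<le> r" "\<bar>y - c' * z\<bar> \<le> r'" for x y z :: real
  proof -
    have "x - c * c' * z = (x - c * y) + c * (y - c' * z)" by (simp add: algebra_simps)
    also have "\<bar>\<dots>\<bar> \<le> \<bar>x - c * y\<bar> + \<bar>c * (y - c' * z)\<bar>" by (rule abs_triangle_ineq)
    also have "\<bar>c * (y - c' * z)\<bar> = c * \<bar>y - c' * z\<bar>" using assms(3) by (simp add: abs_mult)
    also have "\<bar>x - c * y\<bar> + c * \<bar>y - c' * z\<bar> \<le> r + c * r'"
      using that assms(3) by (intro add_mono mult_left_mono) auto
    finally show ?thesis .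
  qed
  show ?thesis
    unfolding eig_close_def
    using aux assms(1,2)[unfolded eig_close_def] by blast
qed

text \<open>Reversing the indices keeps a non-increasing list non-increasing after negation, so
  bounds on \<open>pos_eig\<close> for -a become bounds on \<open>neg_eig\<close> for a.\<close>

lemma spectral_family_uminus:
  assumes "spectral_family N a m ev u"
  shows "spectral_family N (\<lambda>i j. - a i j) m (\<lambda>k. - ev (m - Suc k)) (\<lambda>k. u (m - Suc k))"
  unfolding spectral_family_def orthonormal_def
proof (intro conjI allI impI)
  fix k l assume "k < m" "l < m"
  then show "(\<Sum>i<N. u (m - Suc k) i * u (m - Suc l) i) = (if k = l then 1 else 0)"
    using orthonormalD[OF spectral_family_orthonormal[OF assms], of "m - Suc k" "m - Suc l"] by auto
next
  fix i j assume ij: "i < N" "j < N"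
  have "- a i j = (\<Sum>k<m. - (ev k * u k i * u k j))"
    by (simp add: spectral_familyD[OF assms ij] sum_negf)
  also have "\<dots> = (\<Sum>k<m. - (ev (m - Suc k) * u (m - Suc k) i * u (m - Suc k) j))"
    by (rule sum.nat_diff_reindex[symmetric])
  finally show "- a i j = (\<Sum>k<m. - ev (m - Suc k) * u (m - Suc k) i * u (m - Suc k) j)" by simp
qed

lemma spectral_family_scale:
  "spectral_family N a m ev u \<Longrightarrow> spectral_family N (\<lambda>i j. c * a i j) m (\<lambda>k. c * ev k) u"
  by (simp add: spectral_family_def sum_distrib_left mult.assoc)

lemma card_ge_imp_nth_mem:
  fixes P :: "nat \<Rightarrow> bool"
  assumes "i < card {k. k < m \<and> P k}" and "\<And>k. i \<le> k \<Longrightarrow> k < m \<Longrightarrow> P k \<Longrightarrow> P i"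
  shows "i < m \<and> P i"
proof -
  have "\<not> {k. k < m \<and> P k} \<subseteq> {..<i}"
    using assms(1) card_mono[of "{..<i}" "{k. k < m \<and> P k}"] by auto
  then obtain k where "k \<in> {k. k < m \<and> P k}" "k \<notin> {..<i}" by blast
  then have "k < m" "P k" "i \<le> k" by auto
  then show ?thesis using assms(2)[of k] by auto
qed

text \<open>The threshold for index \<open>i\<close> is \<open>ev i\<close> itself, raised to 2
  \<eta> if smaller. The upper count always gives at most t + \<eta>, the lower count more than ev i
  - \<eta> if ev i \<ge> 2 \<eta>. Otherwise both values lie between 0 and 3 \<eta>, which is the
  origin of the 3.\<close>

lemma half_sampling_pos_eig:
  assumes fam: "spectral_family (2 * M) a m ev u" and mono: "\<And>k l. k \<le> l \<Longrightarrow> l < m \<Longrightarrow> ev l \<le> ev k"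
    and \<eta>: "\<eta> > 0"
    and S: "S \<subseteq> {..<M}"
    and close: "\<And>k. k < m \<Longrightarrow> sampled_gram_close M m ev u (max (ev k) (2 * \<eta>)) \<eta> S"
    and fam': "spectral_family M (\<lambda>i j. 2 * a (select_half M S i) (select_half M S j)) m' \<mu> v"
    and mono': "\<And>k l. k \<le> l \<Longrightarrow> l < m' \<Longrightarrow> \<mu> l \<le> \<mu> k"
    and m': "m' \<le> m"
  shows "\<bar>pos_eig m ev i - pos_eig m' \<mu> i\<bar> \<le> 3 * \<eta>"
proof (cases "i < m")
  case False
  then show ?thesis using m' \<eta> by (simp add: pos_eig_def)
next
  case i: True
  define t where "t = max (ev i) (2 * \<eta>)"
  define X where "X j k = sqrt (2 * \<bar>ev k\<bar>) * u k (select_half M S j)" for j k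
  have t: "2 * \<eta> \<le> t" by (simp add: t_def)
  have sel: "select_half M S j < 2 * M" if "j < M" for j
    using that by (auto simp: select_half_def)
  have b: "2 * a (select_half M S p) (select_half M S q)
      = (\<Sum>k<m. (if ev k < 0 then -1 else 1) * X p k * X q k)" if "p < M" "q < M" for p q
  proof -
    have "(if ev k < 0 then -1 else 1) * X p k * X q k
        = 2 * (ev k * u k (select_half M S p) * u k (select_half M S q))" for k
    proof -
      have "sqrt (2 * \<bar>ev k\<bar>) * sqrt (2 * \<bar>ev k\<bar>) = 2 * \<bar>ev k\<bar>" by simp
      then have "X p k * X q k = 2 * \<bar>ev k\<bar> * (u k (select_half M S p) * u k (select_half M S q))"
        unfolding X_def by (metis mult.assoc mult.left_commute)
      then show ?thesis by (auto simp: abs_if)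
    qed
    then show ?thesis
      by (simp add: spectral_familyD[OF fam sel sel] that sum_distrib_left)
  qed
  have good: "\<bar>(\<Sum>j<M. (\<Sum>k<m. X j k * w k)\<^sup>2) - (\<Sum>k<m. \<bar>ev k\<bar> * (w k)\<^sup>2)\<bar>
        \<le> 1/4 * (\<Sum>k<m. (\<bar>ev k - t\<bar> + \<eta>) * (w k)\<^sup>2)" for w
    using close[OF i] unfolding sampled_gram_close_def X_def t_def by (rule spec)
  have upper: "pos_eig m' \<mu> i \<le> t + \<eta>"
  proof (rule ccontr)
    assume "\<not> ?thesis"
    then have i': "i < m'" "\<mu> i > t + \<eta>" using \<eta> t by (auto simp: pos_eig_def split: if_splits)
    have "{..i} \<subseteq> {l. l < m' \<and> \<mu> l > t + \<eta>}"
    proof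
      fix l assume "l \<in> {..i}"
      then have "l \<le> i" "l < m'" using i' by auto
      then show "l \<in> {l. l < m' \<and> \<mu> l > t + \<eta>}" using mono'[of l i] i' by auto
    qed
    from card_mono[OF _ this] have "Suc i \<le> card {l. l < m' \<and> \<mu> l > t + \<eta>}" by simp
    also have "\<dots> \<le> card {k. k < m \<and> ev k > t}"
      by (rule eigenvalue_count_upper[OF \<eta> t b fam' good])
    finally have "i < m \<and> ev i > t"
      by (intro card_ge_imp_nth_mem) (auto intro: less_le_trans mono)
    then show False by (simp add: t_def)
  qed
  have lower: "pos_eig m' \<mu> i > ev i - \<eta>" if "ev i \<ge> 2 * \<eta>"
  proof -
    have te: "t = ev i" using that by (simp add: t_def)
    have "{..i} \<subseteq> {k. k < m \<and> ev k \<ge> t}"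
      using mono i by (auto simp: te)
    from card_mono[OF _ this] have "Suc i \<le> card {k. k < m \<and> ev k \<ge> t}" by simp
    also have "\<dots> \<le> card {l. l < m' \<and> \<mu> l > t - \<eta>}"
      by (rule eigenvalue_count_lower[OF \<eta> t b fam' good])
    finally have "i < m' \<and> \<mu> i > t - \<eta>"
      by (intro card_ge_imp_nth_mem) (auto intro: less_le_trans mono')
    then show ?thesis using te by (simp add: pos_eig_def less_max_iff_disj)
  qed
  have "pos_eig m' \<mu> i \<ge> 0" by (simp add: pos_eig_def)
  then show ?thesis
    using upper lower i \<eta> by (auto simp: pos_eig_def[of m] t_def max_def abs_le_iff split: if_splits)
qed

definition fun_eigs :: "nat \<Rightarrow> (nat \<Rightarrow> nat \<Rightarrow> real) \<Rightarrow> nat \<Rightarrow> real" where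
  "fun_eigs N a k = eigenvalues_desc (mat N N (\<lambda>(i,j). a i j)) ! k"

lemma fun_eigs_family:
  assumes "\<And>i j. i < N \<Longrightarrow> j < N \<Longrightarrow> a i j = a j i"
  shows "\<exists>u. spectral_family N a N (fun_eigs N a) u"
    and "\<And>k l. k \<le> l \<Longrightarrow> l < N \<Longrightarrow> fun_eigs N a l \<le> fun_eigs N a k"
proof -
  let ?A = "mat N N (\<lambda>(i,j). a i j)"
  have A: "?A \<in> carrier_mat N N" by simp
  have sym: "transpose_mat ?A = ?A" by (rule eq_matI) (auto simp: assms)
  note * = spectral_family_eigenvalues_desc[OF A sym]
  obtain u where "spectral_family N (\<lambda>i j. ?A $$ (i, j)) N (\<lambda>k. eigenvalues_desc ?A ! k) u"
    using *(3) by blast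
  then have "spectral_family N a N (fun_eigs N a) u"
    by (simp add: spectral_family_def fun_eigs_def)
  then show "\<exists>u. spectral_family N a N (fun_eigs N a) u" by blast
  show "fun_eigs N a l \<le> fun_eigs N a k" if "k \<le> l" "l < N" for k l
    using *(1,2) that by (cases "k = l") (auto simp: fun_eigs_def sorted_wrt_iff_nth_less)
qed

text \<open>The positive eigenvalues of -a supply the negative half, so the same \<open>S\<close>
  has to be good for a and for -a.\<close>

lemma half_sampling_eig_close:
  assumes fam: "spectral_family (2 * M) a m ev u" and mono: "\<And>k l. k \<le> l \<Longrightarrow> l < m \<Longrightarrow> ev l \<le> ev k"
    and \<eta>: "\<eta> > 0" and S: "S \<subseteq> {..<M}" and m: "M \<le> m"
    and close: "\<And>k. k < m \<Longrightarrow> sampled_gram_close M m ev u (max (ev k) (2 * \<eta>)) \<eta> S"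
    and close': "\<And>k. k < m \<Longrightarrow> sampled_gram_close M m (\<lambda>k. - ev (m - Suc k)) (\<lambda>k. u (m - Suc k))
        (max (- ev (m - Suc k)) (2 * \<eta>)) \<eta> S"
  shows "eig_close m ev M (fun_eigs M (\<lambda>i j. a (select_half M S i) (select_half M S j))) 2 (3 * \<eta>)"
proof -
  define b where "b i j = a (select_half M S i) (select_half M S j)" for i j
  have sel: "select_half M S j < 2 * M" if "j < M" for j
    using that by (auto simp: select_half_def)
  have "b i j = b j i" if "i < M" "j < M" for i j
    unfolding b_def spectral_familyD[OF fam sel[OF that(1)] sel[OF that(2)]]
      spectral_familyD[OF fam sel[OF that(2)] sel[OF that(1)]] by (simp only: mult_ac)
  note bfam = fun_eigs_family[of M b, OF this]
  obtain v where v: "spectral_family M b M (fun_eigs M b) v" using bfam(1) by blast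
  note v2 = spectral_family_scale[OF v, of 2]
  have v2': "spectral_family M (\<lambda>i j. 2 * a (select_half M S i) (select_half M S j)) M
      (\<lambda>k. 2 * fun_eigs M b k) v"
    using v2 unfolding b_def .
  have v3: "spectral_family M (\<lambda>i j. 2 * (- a (select_half M S i) (select_half M S j))) M
      (\<lambda>k. - (2 * fun_eigs M b (M - Suc k))) (\<lambda>k. v (M - Suc k))"
    using spectral_family_uminus[OF v2] by (simp add: b_def)
  have 1: "\<bar>pos_eig m ev k - pos_eig M (\<lambda>k. 2 * fun_eigs M b k) k\<bar> \<le> 3 * \<eta>" for k
    by (rule half_sampling_pos_eig[OF fam mono \<eta> S close v2' _ m])
      (auto intro: bfam(2))
  have 2: "\<bar>pos_eig m (\<lambda>k. - ev (m - Suc k)) k - pos_eig M (\<lambda>k. - (2 * fun_eigs M b (M - Suc k))) k\<bar> \<le> 3 * \<eta>" for k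
    by (rule half_sampling_pos_eig[OF spectral_family_uminus[OF fam] _ \<eta> S close' v3 _ m])
      (auto intro!: mono bfam(2))
  have 3: "pos_eig M (\<lambda>k. - (2 * fun_eigs M b (M - Suc k))) k = 2 * neg_eig M (fun_eigs M b) k" for k
    using neg_eig_scale[of 2 M "fun_eigs M b" k] by (simp add: neg_eig_def)
  show ?thesis
    unfolding eig_close_def b_def[symmetric]
    using 1 2 unfolding 3 by (simp add: pos_eig_scale neg_eig_def[of m])
qed

text \<open>Union bound over \<open>m\<close> thresholds for each of a and -a; this gives 2 m, and
  the second factor m is the dimension in the trace moment.\<close>

lemma half_sampling_bad_probability:
  assumes fam: "spectral_family (2 * M) a m ev u" and mono: "\<And>k l. k \<le> l \<Longrightarrow> l < m \<Longrightarrow> ev l \<le> ev k"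
    and a: "\<And>i j. i < 2 * M \<Longrightarrow> j < 2 * M \<Longrightarrow> \<bar>a i j\<bar> \<le> 1"
    and \<eta>: "\<eta> > 0" and M: "M > 0" and m: "M \<le> m" "m \<le> 2 * M"
  shows "measure_pmf.prob (pmf_of_set (Pow {..<M}))
      {S. \<not> eig_close m ev M (fun_eigs M (\<lambda>i j. a (select_half M S i) (select_half M S j))) 2 (3 * \<eta>)}
    \<le> 2 * (real (2 * M))\<^sup>2 * (\<Prod>q<p. real (2 * q + 1)) * (128 * sqrt (real (2 * M)) / \<eta>) ^ p"
    (is "measure_pmf.prob ?P ?B \<le> ?r")
proof (cases "\<eta> \<ge> sqrt (2 * M)")
  case False
  have "1 \<le> 128 * sqrt (2 * M) / \<eta>" using False \<eta> by (simp add: field_simps)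
  then have "1 \<le> (128 * sqrt (2 * M) / \<eta>) ^ p" by (rule one_le_power)
  moreover have "1 \<le> (\<Prod>q<p. real (2 * q + 1))" by (rule prod_ge_1) simp
  moreover have "1 \<le> 2 * (2 * real M)\<^sup>2" using M one_le_power[of "2 * real M" 2] by simp
  ultimately have "1 * 1 * 1 \<le> ?r" by (intro mult_mono) auto
  then show ?thesis using measure_pmf.prob_le_1[of ?P ?B] by linarith
next
  case True
  let ?ev' = "\<lambda>k. - ev (m - Suc k)" and ?u' = "\<lambda>k. u (m - Suc k)"
  define bad where "bad e w k = {S \<in> Pow {..<M}. \<not> sampled_gram_close M m e w (max (e k) (2 * \<eta>)) \<eta> S}"
    for e w k
  define c where "c = (\<Prod>q<p. real (2 * q + 1)) * (128 * sqrt (2 * M) / \<eta>) ^ p * m * 2 ^ M"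
  have c: "c \<ge> 0" using \<eta> by (auto simp: c_def intro!: mult_nonneg_nonneg prod_nonneg)
  have 1: "real (card (bad ev u k)) \<le> c" for k
    unfolding bad_def c_def by (rule bad_selection_count[OF fam a True _ M]) auto
  have 2: "real (card (bad ?ev' ?u' k)) \<le> c" for k
    unfolding bad_def c_def by (rule bad_selection_count[OF spectral_family_uminus[OF fam] _ True _ M]) (auto simp: a)
  have fin: "finite (bad e w k)" for e w k by (simp add: bad_def)
  have sub: "Pow {..<M} \<inter> ?B \<subseteq> (\<Union>k<m. bad ev u k) \<union> (\<Union>k<m. bad ?ev' ?u' k)"
  proof (rule subsetI, rule ccontr)
    fix S assume S: "S \<in> Pow {..<M} \<inter> ?B" and n: "S \<notin> (\<Union>k<m. bad ev u k) \<union> (\<Union>k<m. bad ?ev' ?u' k)"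
    have "eig_close m ev M (fun_eigs M (\<lambda>i j. a (select_half M S i) (select_half M S j))) 2 (3 * \<eta>)"
      by (rule half_sampling_eig_close[OF fam mono \<eta> _ m(1)]) (use S n in \<open>auto simp: bad_def\<close>)
    then show False using S by auto
  qed
  have "card (\<Union>k<m. bad e w k) \<le> (\<Sum>k<m. card (bad e w k))" for e w
    by (rule card_UN_le) simp
  then have un: "real (card (\<Union>k<m. bad e w k)) \<le> (\<Sum>k<m. real (card (bad e w k)))" for e w
    by (metis of_nat_le_iff of_nat_sum)
  have "real (card (Pow {..<M} \<inter> ?B)) \<le> real (card ((\<Union>k<m. bad ev u k) \<union> (\<Union>k<m. bad ?ev' ?u' k)))"
    using card_mono[OF _ sub] fin by simp
  also have "\<dots> \<le> real (card (\<Union>k<m. bad ev u k)) + real (card (\<Union>k<m. bad ?ev' ?u' k))"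
    using card_Un_le[of "\<Union>k<m. bad ev u k" "\<Union>k<m. bad ?ev' ?u' k"] by linarith
  also have "\<dots> \<le> (\<Sum>k<m. c) + (\<Sum>k<m. c)"
    by (intro add_mono order.trans[OF un] sum_mono 1 2)
  also have "\<dots> = 2 * m * c" by simp
  finally have card: "real (card (Pow {..<M} \<inter> ?B)) \<le> 2 * m * c" .
  have "measure_pmf.prob ?P ?B = real (card (Pow {..<M} \<inter> ?B)) / 2 ^ M"
    by (subst measure_pmf_of_set) (auto simp: card_Pow)
  also have "\<dots> \<le> 2 * m * c / 2 ^ M"
    by (intro divide_right_mono card) auto
  also have "\<dots> = 2 * (real m)\<^sup>2 * ((\<Prod>q<p. real (2 * q + 1)) * (128 * sqrt (2 * M) / \<eta>) ^ p)"
    by (simp add: c_def power2_eq_square)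
  also have "\<dots> \<le> 2 * (real (2 * M))\<^sup>2 * ((\<Prod>q<p. real (2 * q + 1)) * (128 * sqrt (2 * M) / \<eta>) ^ p)"
    using m \<eta> by (intro mult_right_mono mult_left_mono power_mono mult_nonneg_nonneg prod_nonneg) auto
  finally show ?thesis by (simp add: mult.assoc)
qed

section \<open>Iterated halving\<close>

text \<open>Parameter \<open>i\<close> means i + 1 halvings: the map sends the \<open>s\<close>
  final indices into s 2^(i+1) original ones. The largest halving is composed outermost, so that the
  others act on the matrix it leaves.\<close>

primrec block_selection :: "nat \<Rightarrow> nat \<Rightarrow> (nat \<Rightarrow> nat) pmf" where
  "block_selection s 0 = map_pmf (select_half s) (pmf_of_set (Pow {..<s}))"
| "block_selection s (Suc i) = bind_pmf (pmf_of_set (Pow {..<s * 2 ^ Suc i}))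
     (\<lambda>S. map_pmf (\<lambda>\<phi>. select_half (s * 2 ^ Suc i) S \<circ> \<phi>) (block_selection s i))"

text \<open>Failure bound for the halving of size N = s 2^(l+1) with \<eta> = e l * N, for which
  sqrt N / \<eta> is 1 / (e l * sqrt N).\<close>

definition halving_failure :: "nat \<Rightarrow> nat \<Rightarrow> (nat \<Rightarrow> real) \<Rightarrow> nat \<Rightarrow> real" where
  "halving_failure p s e l = 2 * (real (s * 2 ^ Suc l))\<^sup>2 * (\<Prod>q<p. real (2 * q + 1))
     * (128 / (e l * sqrt (s * 2 ^ Suc l))) ^ p"

lemma prob_bind_pmf_le:
  assumes "\<And>x. x \<in> set_pmf p \<Longrightarrow> x \<notin> X \<Longrightarrow> measure_pmf.prob (f x) B \<le> b" and b: "b \<ge> 0"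
  shows "measure_pmf.prob (bind_pmf p f) B \<le> measure_pmf.prob p X + b"
proof -
  have "emeasure (measure_pmf (bind_pmf p f)) B = (\<integral>\<^sup>+x. emeasure (measure_pmf (f x)) B \<partial>measure_pmf p)"
    by (rule emeasure_bind_pmf)
  also have "\<dots> \<le> (\<integral>\<^sup>+x. indicator X x + ennreal b \<partial>measure_pmf p)"
  proof (rule nn_integral_mono_AE, rule AE_pmfI)
    fix x assume x: "x \<in> set_pmf p"
    show "emeasure (measure_pmf (f x)) B \<le> indicator X x + ennreal b"
    proof (cases "x \<in> X")
      case True
      have "emeasure (measure_pmf (f x)) B \<le> 1" by (rule measure_pmf.emeasure_le_1)
      then show ?thesis using True by (simp add: add_increasing2)
    next
      case False
      then show ?thesis
        using assms(1)[OF x] by (simp add: measure_pmf.emeasure_eq_measure ennreal_leI)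
    qed
  qed
  also have "\<dots> = emeasure (measure_pmf p) X + ennreal b"
    by (subst nn_integral_add) (auto simp: measure_pmf.emeasure_space_1)
  also have "\<dots> = ennreal (measure_pmf.prob p X + b)"
    using b by (simp add: measure_pmf.emeasure_eq_measure ennreal_plus)
  finally show ?thesis
    using b by (simp add: measure_pmf.emeasure_eq_measure ennreal_le_iff del: ennreal_plus)
qed

text \<open>Errors are measured relative to the size: the recursive error 3 M \<Sigma> is doubled by
  the scaling of the largest halving and becomes 3 (2 M) \<Sigma>, so relative errors simply add.
  Given the first selection, the reduced matrix is again symmetric with entries at most 1 and the
  remaining selections are independent of it, so the induction hypothesis applies
  conditionally.\<close>

lemma block_selection_eig_close:
  assumes "spectral_family (s * 2 ^ Suc i) a m ev u"
    and "\<And>k l. k \<le> l \<Longrightarrow> l < m \<Longrightarrow> ev l \<le> ev k"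
    and "\<And>x y. x < s * 2 ^ Suc i \<Longrightarrow> y < s * 2 ^ Suc i \<Longrightarrow> \<bar>a x y\<bar> \<le> 1"
    and "s * 2 ^ i \<le> m" "m \<le> s * 2 ^ Suc i" and s: "s > 0" and e: "\<And>l. e l > 0"
  shows "measure_pmf.prob (block_selection s i)
      {\<phi>. \<not> eig_close m ev s (fun_eigs s (\<lambda>x y. a (\<phi> x) (\<phi> y))) (2 ^ Suc i)
            (3 * real (s * 2 ^ Suc i) * (\<Sum>l\<le>i. e l))}
    \<le> (\<Sum>l\<le>i. halving_failure p s e l)"
  using assms(1-5)
proof (induction i arbitrary: a m ev u)
  case (0 a m ev u)
  have "measure_pmf.prob (pmf_of_set (Pow {..<s}))
      {S. \<not> eig_close m ev s (fun_eigs s (\<lambda>i j. a (select_half s S i) (select_half s S j))) 2 (3 * (e 0 * real (2 * s)))}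
    \<le> 2 * (real (2 * s))\<^sup>2 * (\<Prod>q<p. real (2 * q + 1)) * (128 * sqrt (2 * s) / (e 0 * real (2 * s))) ^ p"
    by (rule half_sampling_bad_probability[of s a m ev u]) (use 0 s e in \<open>auto simp: mult.commute[of s 2]\<close>)
  also have "128 * sqrt (2 * s) / (e 0 * real (2 * s)) = 128 / (e 0 * sqrt (2 * s))"
    using s e[of 0] real_sqrt_mult_self[of "2 * s"] by (simp add: field_simps)
  finally show ?case
    by (simp add: halving_failure_def mult_ac vimage_def)
next
  case (Suc i a m ev u)
  define M where "M = s * 2 ^ Suc i"
  have N: "s * 2 ^ Suc (Suc i) = 2 * M" by (simp add: M_def)
  have M: "M > 0" using s by (simp add: M_def)
  note prems = Suc.prems[unfolded N M_def[symmetric]]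
  define a' where "a' S x y = a (select_half M S x) (select_half M S y)" for S x y
  define X where "X = {S. \<not> eig_close m ev M (fun_eigs M (a' S)) 2 (3 * (e (Suc i) * real (2 * M)))}"
  define \<Sigma> where "\<Sigma> = (\<Sum>l\<le>i. e l)"
  define B where "B = {\<phi>. \<not> eig_close m ev s (fun_eigs s (\<lambda>x y. a (\<phi> x) (\<phi> y))) (2 ^ Suc (Suc i))
            (3 * real (2 * M) * (\<Sigma> + e (Suc i)))}"
  have sel: "select_half M S x < 2 * M" if "x < M" for S x
    using that by (auto simp: select_half_def)
  have "measure_pmf.prob (block_selection s (Suc i)) B
      \<le> measure_pmf.prob (pmf_of_set (Pow {..<M})) X + (\<Sum>l\<le>i. halving_failure p s e l)"
    unfolding block_selection.simps M_def[symmetric]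
  proof (rule prob_bind_pmf_le)
    fix S assume "S \<notin> X"
    then have 1: "eig_close m ev M (fun_eigs M (a' S)) 2 (3 * (e (Suc i) * real (2 * M)))"
      by (simp add: X_def)
    have "a' S x y = a' S y x" if "x < M" "y < M" for x y
      unfolding a'_def spectral_familyD[OF prems(1) sel[OF that(1)] sel[OF that(2)]]
        spectral_familyD[OF prems(1) sel[OF that(2)] sel[OF that(1)]] by (simp only: mult_ac)
    note fam = fun_eigs_family[of M "a' S", OF this]
    obtain v where v: "spectral_family M (a' S) M (fun_eigs M (a' S)) v" using fam(1) by blast
    have "measure_pmf.prob (block_selection s i)
        {\<phi>. \<not> eig_close M (fun_eigs M (a' S)) s (fun_eigs s (\<lambda>x y. a' S (\<phi> x) (\<phi> y))) (2 ^ Suc i)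
            (3 * real M * \<Sigma>)} \<le> (\<Sum>l\<le>i. halving_failure p s e l)"
      unfolding M_def \<Sigma>_def
    proof (rule Suc.IH)
      show "spectral_family (s * 2 ^ Suc i) (a' S) (s * 2 ^ Suc i) (fun_eigs (s * 2 ^ Suc i) (a' S)) v"
        using v by (simp only: M_def)
      show "fun_eigs (s * 2 ^ Suc i) (a' S) l \<le> fun_eigs (s * 2 ^ Suc i) (a' S) k"
        if "k \<le> l" "l < s * 2 ^ Suc i" for k l
        using fam(2)[of k l] that by (simp only: M_def)
      show "\<bar>a' S x y\<bar> \<le> 1" if "x < s * 2 ^ Suc i" "y < s * 2 ^ Suc i" for x y
        unfolding a'_def by (rule prems(3)) (use that sel in \<open>auto simp: M_def\<close>)
    qed auto
    moreover have "measure_pmf.prob (map_pmf (\<lambda>\<phi>. select_half M S \<circ> \<phi>) (block_selection s i)) B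
      \<le> measure_pmf.prob (block_selection s i)
        {\<phi>. \<not> eig_close M (fun_eigs M (a' S)) s (fun_eigs s (\<lambda>x y. a' S (\<phi> x) (\<phi> y))) (2 ^ Suc i)
            (3 * real M * \<Sigma>)}"
      unfolding measure_map_pmf
    proof (rule measure_pmf.finite_measure_mono; (rule subsetI)?)
      fix \<phi> assume \<phi>: "\<phi> \<in> (\<lambda>\<phi>. select_half M S \<circ> \<phi>) -` B"
      show "\<phi> \<in> {\<phi>. \<not> eig_close M (fun_eigs M (a' S)) s (fun_eigs s (\<lambda>x y. a' S (\<phi> x) (\<phi> y))) (2 ^ Suc i)
            (3 * real M * \<Sigma>)}"
      proof (rule ccontr)
        assume "\<not> ?thesis"
        then have "eig_close M (fun_eigs M (a' S)) s (fun_eigs s (\<lambda>x y. a' S (\<phi> x) (\<phi> y))) (2 ^ Suc i)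
            (3 * real M * \<Sigma>)" by simp
        from eig_close_trans[OF 1 this] \<phi> show False
          by (simp add: B_def a'_def algebra_simps)
      qed
    qed simp
    ultimately show "measure_pmf.prob (map_pmf (\<lambda>\<phi>. select_half M S \<circ> \<phi>) (block_selection s i)) B
      \<le> (\<Sum>l\<le>i. halving_failure p s e l)" by (rule order.trans[rotated])
  qed (use e in \<open>auto intro!: sum_nonneg mult_nonneg_nonneg prod_nonneg simp: halving_failure_def less_imp_le\<close>)
  also have "measure_pmf.prob (pmf_of_set (Pow {..<M})) X
    \<le> 2 * (real (2 * M))\<^sup>2 * (\<Prod>q<p. real (2 * q + 1)) * (128 * sqrt (2 * M) / (e (Suc i) * real (2 * M))) ^ p"
    unfolding X_def a'_def
    by (rule half_sampling_bad_probability[of M a m ev u]) (use prems M e in auto)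
  also have "128 * sqrt (2 * M) / (e (Suc i) * real (2 * M)) = 128 / (e (Suc i) * sqrt (2 * M))"
    using M e[of "Suc i"] real_sqrt_mult_self[of "2 * M"] by (simp add: field_simps)
  also have "2 * (real (2 * M))\<^sup>2 * (\<Prod>q<p. real (2 * q + 1)) * (128 / (e (Suc i) * sqrt (2 * M))) ^ p
      = halving_failure p s e (Suc i)"
    unfolding halving_failure_def N by simp
  finally show ?case
    unfolding B_def \<Sigma>_def N by (simp add: add.commute)
qed

text \<open>
  With 20th powers the failure probability at size \<open>N\<close> and relative error \<open>e\<close> is of order
  \<open>N\<^sup>2 / (e\<^sup>2 N)\<^sup>1\<^sup>0\<close>. Allowing the relative error to decay by \<open>4/5\<close> per doubling of \<open>N\<close> keeps
  both the errors and, since \<open>(5/4)\<^sup>2\<^sup>0 < 2\<^sup>7\<close>, the failure probabilities geometrically summable.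
\<close>

lemma halving_failure_sum:
  assumes s: "s > 0" and \<epsilon>: "\<epsilon> > 0"
  shows "(\<Sum>l\<le>i. halving_failure 20 s (\<lambda>l. \<epsilon> / 48 * (4/5) ^ Suc l) l)
    \<le> 2 * (\<Prod>q<20. real (2 * q + 1)) * 6144 ^ 20 / (real s ^ 8 * \<epsilon> ^ 20)"
proof -
  define P where "P = (\<Prod>q<20. real (2 * q + 1))"
  define D where "D = 2 * P * 6144 ^ 20 / (real s ^ 8 * \<epsilon> ^ 20)"
  have P: "P \<ge> 0" by (simp add: P_def prod_nonneg)
  then have D: "D \<ge> 0" using \<epsilon> by (simp add: D_def)
  have "halving_failure 20 s (\<lambda>l. \<epsilon> / 48 * (4/5) ^ Suc l) l \<le> D * (1/2) ^ Suc l" for l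
  proof -
    define x where "x = Suc l"
    define N where "N = real (s * 2 ^ x)"
    have N: "N > 0" using s by (simp add: N_def)
    have "(sqrt N) ^ 20 = ((sqrt N)\<^sup>2) ^ 10" by (simp flip: power_mult)
    then have sq: "(sqrt N) ^ 20 = N ^ 10" using N by simp
    \<comment> \<open>Origin of 6144: the 128 of the moment bound times the 48 of the error
      schedule.\<close>
    have "128 / (\<epsilon> / 48 * (4/5) ^ x * sqrt N) = 6144 * (5/4) ^ x / (\<epsilon> * sqrt N)"
      by (simp add: power_divide field_simps)
    then have "halving_failure 20 s (\<lambda>l. \<epsilon> / 48 * (4/5) ^ Suc l) l
        = 2 * N\<^sup>2 * P * (6144 * (5/4) ^ x / (\<epsilon> * sqrt N)) ^ 20"
      by (simp only: halving_failure_def x_def[symmetric] N_def[symmetric] P_def[symmetric])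
    also have "(6144 * (5/4) ^ x / (\<epsilon> * sqrt N)) ^ 20 = 6144 ^ 20 * ((5/4) ^ x) ^ 20 / (\<epsilon> ^ 20 * N ^ 10)"
      by (simp only: power_divide power_mult_distrib sq)
    also have "2 * N\<^sup>2 * P * (6144 ^ 20 * ((5/4) ^ x) ^ 20 / (\<epsilon> ^ 20 * N ^ 10))
        = (2 * P * 6144 ^ 20) * ((5/4) ^ x) ^ 20 / (\<epsilon> ^ 20 * N ^ 8)"
    proof -
      have gen: "2 * c * P * (K * U / (E * (c * V))) = (2 * P * K) * U / (E * V)" if "c \<noteq> 0"
        for c K U E V :: real using that by simp
      have "N ^ 10 = N\<^sup>2 * N ^ 8" by (simp flip: power_add)
      moreover have "N\<^sup>2 \<noteq> 0" using N by simp
      ultimately show ?thesis by (simp only: gen[OF \<open>N\<^sup>2 \<noteq> 0\<close>])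
    qed
    also have "N ^ 8 = real s ^ 8 * (2 ^ x) ^ 8" by (simp add: N_def power_mult_distrib)
    also have "(2 * P * 6144 ^ 20) * ((5/4) ^ x) ^ 20 / (\<epsilon> ^ 20 * (real s ^ 8 * (2 ^ x) ^ 8))
        = D * (((5/4) ^ x) ^ 20 / (2 ^ x) ^ 8)"
    proof -
      have gen: "q * U / (E * (S * V)) = q / (S * E) * (U / V)" for q U E S V :: real by simp
      show ?thesis unfolding D_def by (rule gen)
    qed
    also have "((5/4 :: real) ^ x) ^ 20 / (2 ^ x) ^ 8 = ((5/4) ^ 20 / 2 ^ 8) ^ x"
      unfolding power_divide[of _ "2 ^ 8"] power_mult[symmetric] by (simp only: mult.commute[of x])
    also have "D * ((5/4) ^ 20 / 2 ^ 8) ^ x \<le> D * (1/2) ^ x"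
      by (intro mult_left_mono power_mono D) (simp_all add: power_divide)
    finally show ?thesis by (simp only: x_def)
  qed
  then have "(\<Sum>l\<le>i. halving_failure 20 s (\<lambda>l. \<epsilon> / 48 * (4/5) ^ Suc l) l) \<le> (\<Sum>l\<le>i. D * (1/2) ^ Suc l)"
    by (rule sum_mono)
  also have "\<dots> = D * (\<Sum>l\<le>i. (1/2) ^ Suc l)" by (simp only: sum_distrib_left)
  also have "(\<Sum>l\<le>i. (1/2 :: real) ^ Suc l) = 1 - (1/2) ^ Suc i"
    by (induction i) (simp_all add: field_simps)
  also have "D * (1 - (1/2) ^ Suc i) \<le> D * 1" by (intro mult_left_mono D) simp
  finally show ?thesis by (simp add: D_def P_def)
qed

text \<open>The powers of 4/5 sum to at most 4, hence 48 for a total of \<epsilon> / 12. The halving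
  step multiplies this by 3 and recombining the two signs by 2, giving \<epsilon> / 2 relative to
  the padded size, which is less than 2 n.\<close>

lemma geometric_error_sum:
  assumes "\<epsilon> > 0"
  shows "(\<Sum>l\<le>i. \<epsilon> / 48 * (4/5 :: real) ^ Suc l) \<le> \<epsilon> / 12"
proof -
  have "(\<Sum>l\<le>i. (4/5 :: real) ^ Suc l) = 4 - 4 * (4/5) ^ Suc i"
    by (induction i) (simp_all add: field_simps)
  then have "(\<Sum>l\<le>i. (4/5 :: real) ^ Suc l) \<le> 4" by simp
  then have "\<epsilon> / 48 * (\<Sum>l\<le>i. (4/5 :: real) ^ Suc l) \<le> \<epsilon> / 48 * 4"
    using assms by (intro mult_left_mono) auto
  then show ?thesis by (simp add: sum_distrib_left)
qed

section \<open>The algorithm\<close>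

fun gather_entries ::
    "(nat \<times> nat) list \<Rightarrow> (nat \<times> nat \<Rightarrow> real) \<Rightarrow> ((nat \<times> nat \<Rightarrow> real) \<Rightarrow> 'r) \<Rightarrow> 'r query_alg" where
  "gather_entries [] g f = Return (f g)"
| "gather_entries ((i, j) # ps) g f = Query i j (\<lambda>v. gather_entries ps (g((i, j) := v)) f)"

lemma run_gather_entries:
  "run A (gather_entries ps g f) = f (\<lambda>p. if p \<in> set ps then A $$ p else g p)"
proof (induction ps arbitrary: g)
  case (Cons p ps)
  then show ?case by (cases p) (auto intro!: arg_cong[of _ _ f])
qed simp

lemma num_queries_gather_entries: "num_queries A (gather_entries ps g f) = length ps"
  by (induction ps arbitrary: g) auto

lemma queries_within_gather_entries:
  "set ps \<subseteq> {..<n} \<times> {..<n} \<Longrightarrow> queries_within n (gather_entries ps g f)"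
  by (induction ps arbitrary: g) auto

lemma fun_eigs_cong:
  "(\<And>i j. i < N \<Longrightarrow> j < N \<Longrightarrow> a i j = b i j) \<Longrightarrow> fun_eigs N a = fun_eigs N b"
  unfolding fun_eigs_def by (intro ext arg_cong2[of _ _ _ _ "(!)"] arg_cong[of _ _ eigenvalues_desc] eq_matI) auto

text \<open>The exact algorithm, for matrices no larger than the sample would be.\<close>

definition read_all :: "nat \<Rightarrow> real list query_alg" where
  "read_all n = gather_entries (List.product [0..<n] [0..<n]) (\<lambda>_. 0)
     (\<lambda>g. map (fun_eigs n (\<lambda>i j. g (i, j))) [0..<n])"

text \<open>Indices \<open>\<ge> n\<close> belong to the zero padding and are not queried.\<close>

definition read_sample :: "nat \<Rightarrow> nat \<Rightarrow> real \<Rightarrow> (nat \<Rightarrow> nat) \<Rightarrow> real list query_alg" where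
  "read_sample n s c \<phi> =
     gather_entries (filter (\<lambda>(x, y). x < n \<and> y < n) (List.product (map \<phi> [0..<s]) (map \<phi> [0..<s]))) (\<lambda>_. 0)
     (\<lambda>g. let \<mu> = fun_eigs s (\<lambda>i j. g (\<phi> i, \<phi> j)) in
        map (\<lambda>k. c * (pos_eig s \<mu> k - neg_eig s \<mu> (n - Suc k))) [0..<n])"

lemma read_all_queries: "queries_within n (read_all n)" "num_queries A (read_all n) = n\<^sup>2"
  by (auto simp: read_all_def num_queries_gather_entries power2_eq_square
      intro!: queries_within_gather_entries)

lemma run_read_all:
  assumes "A \<in> carrier_mat n n" "transpose_mat A = A"
  shows "run A (read_all n) = eigenvalues_desc A"
proof -
  have "run A (read_all n) = map (fun_eigs n (\<lambda>i j. A $$ (i, j))) [0..<n]"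
    unfolding read_all_def run_gather_entries by (intro map_cong refl fun_cong[OF fun_eigs_cong]) auto
  moreover have "mat n n (\<lambda>(i,j). A $$ (i, j)) = A" using assms by auto
  ultimately show ?thesis
    using spectral_family_eigenvalues_desc(1)[OF assms]
    by (auto simp: fun_eigs_def intro: nth_equalityI)
qed

lemma read_sample_queries: "queries_within n (read_sample n s c \<phi>)" "num_queries A (read_sample n s c \<phi>) \<le> s\<^sup>2"
proof -
  show "queries_within n (read_sample n s c \<phi>)"
    unfolding read_sample_def by (rule queries_within_gather_entries) auto
  show "num_queries A (read_sample n s c \<phi>) \<le> s\<^sup>2"
    unfolding read_sample_def num_queries_gather_entries
    by (rule order.trans[OF length_filter_le]) (simp add: power2_eq_square)
qed

definition pad_zero :: "nat \<Rightarrow> real mat \<Rightarrow> nat \<Rightarrow> nat \<Rightarrow> real" where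
  "pad_zero n A i j = (if i < n \<and> j < n then A $$ (i, j) else 0)"

text \<open>Skipped positions keep the default 0 of the collected table, which is the entry of the
  padded matrix there.\<close>

lemma run_read_sample:
  fixes n s :: nat
  defines "\<mu> \<equiv> \<lambda>A \<phi>. fun_eigs s (\<lambda>i j. pad_zero n A (\<phi> i) (\<phi> j))"
  shows "run A (read_sample n s c \<phi>)
    = map (\<lambda>k. c * (pos_eig s (\<mu> A \<phi>) k - neg_eig s (\<mu> A \<phi>) (n - Suc k))) [0..<n]"
proof -
  have "fun_eigs s (\<lambda>i j. if (\<phi> i, \<phi> j) \<in> set (filter (\<lambda>(x, y). x < n \<and> y < n)
        (List.product (map \<phi> [0..<s]) (map \<phi> [0..<s]))) then A $$ (\<phi> i, \<phi> j) else 0)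
      = fun_eigs s (\<lambda>i j. pad_zero n A (\<phi> i) (\<phi> j))"
    by (rule fun_eigs_cong) (auto simp: pad_zero_def)
  then show ?thesis
    unfolding read_sample_def run_gather_entries Let_def \<mu>_def by simp
qed

text \<open>The zero eigenvalues created by padding are left out of the family, so the estimates
  after padding still speak of the \<open>m\<close> original eigenvalues.\<close>

lemma spectral_family_pad_zero:
  assumes fam: "spectral_family n (\<lambda>i j. A $$ (i, j)) m ev u" and "n \<le> N"
  shows "spectral_family N (pad_zero n A) m ev (\<lambda>k i. if i < n then u k i else 0)"
  unfolding spectral_family_def orthonormal_def
proof (intro conjI allI impI)
  fix k l assume kl: "k < m" "l < m"
  have "(\<Sum>i<N. (if i < n then u k i else 0) * (if i < n then u l i else 0)) = (\<Sum>i<n. u k i * u l i)"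
    by (rule sum.mono_neutral_cong_right) (use assms in auto)
  then show "(\<Sum>i<N. (if i < n then u k i else 0) * (if i < n then u l i else 0)) = (if k = l then 1 else 0)"
    using orthonormalD[OF spectral_family_orthonormal[OF fam] kl] by simp
next
  fix i j
  show "pad_zero n A i j = (\<Sum>k<m. ev k * (if i < n then u k i else 0) * (if j < n then u k j else 0))"
    using spectral_familyD[OF fam, of i j] by (auto simp: pad_zero_def)
qed

lemma max_entry_norm_entry_le:
  assumes "A \<in> carrier_mat n n" "i < n" "j < n"
  shows "\<bar>A $$ (i, j)\<bar> \<le> max_entry_norm A"
proof -
  have "finite (abs ` elements_mat A)" unfolding elements_mat_def by simp
  moreover have "A $$ (i, j) \<in> elements_mat A" using assms by auto
  ultimately show ?thesis unfolding max_entry_norm_def by (intro Max_ge) auto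
qed

text \<open>An eigenvalue is its positive minus its negative part, and the \<open>k\<close>-th from
  above is number \<open>n - Suc k\<close> from below, counting from 0. The errors of the two parts
  add up to 2 r.\<close>

lemma eig_close_estimate:
  assumes "eig_close n ev s \<mu> c r" "k < n"
  shows "\<bar>c * (pos_eig s \<mu> k - neg_eig s \<mu> (n - Suc k)) - ev k\<bar> \<le> 2 * r"
proof -
  have "ev k = pos_eig n ev k - neg_eig n ev (n - Suc k)"
    using assms(2) by (auto simp: pos_eig_def neg_eig_def max_def)
  moreover have "\<bar>pos_eig n ev k - c * pos_eig s \<mu> k\<bar> \<le> r"
    "\<bar>neg_eig n ev (n - Suc k) - c * neg_eig s \<mu> (n - Suc k)\<bar> \<le> r"
    using assms(1) by (auto simp: eig_close_def)
  ultimately show ?thesis by (simp add: algebra_simps abs_le_iff)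
qed

lemma read_sample_success:
  fixes \<epsilon> :: real
  assumes A: "A \<in> carrier_mat n n" "transpose_mat A = A" "max_entry_norm A \<le> 1"
    and \<epsilon>: "\<epsilon> > 0" and s: "s > 0" "s * 2 ^ i < n" "n \<le> s * 2 ^ Suc i"
  shows "measure_pmf.prob (map_pmf (read_sample n s (2 ^ Suc i)) (block_selection s i))
      {t. length (run A t) = n \<and> (\<forall>k<n. \<bar>run A t ! k - eigenvalues_desc A ! k\<bar> \<le> \<epsilon> * real n)}
    \<ge> 1 - 2 * (\<Prod>q<20. real (2 * q + 1)) * 6144 ^ 20 / (real s ^ 8 * \<epsilon> ^ 20)"
proof -
  define N where "N = s * 2 ^ Suc i"
  define e where "e l = \<epsilon> / 48 * (4/5) ^ Suc l" for l
  define ev where "ev k = eigenvalues_desc A ! k" for k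
  define \<mu> where "\<mu> \<phi> = fun_eigs s (\<lambda>x y. pad_zero n A (\<phi> x) (\<phi> y))" for \<phi>
  define r where "r = 3 * real N * (\<Sum>l\<le>i. e l)"
  define good where "good = {\<phi>. eig_close n ev s (\<mu> \<phi>) (2 ^ Suc i) r}"
  note eig = spectral_family_eigenvalues_desc[OF A(1,2)]
  obtain u where u: "spectral_family n (\<lambda>i j. A $$ (i, j)) n ev u"
    using eig(3) unfolding ev_def by blast
  have fam: "spectral_family N (pad_zero n A) n ev (\<lambda>k i. if i < n then u k i else 0)"
    by (rule spectral_family_pad_zero[OF u]) (use s in \<open>simp add: N_def\<close>)
  have mono: "ev l \<le> ev k" if "k \<le> l" "l < n" for k l
    using eig(1,2) that by (cases "k = l") (auto simp: ev_def sorted_wrt_iff_nth_less)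
  have entries: "\<bar>pad_zero n A x y\<bar> \<le> 1" for x y
    using max_entry_norm_entry_le[OF A(1), of x y] A(3) by (auto simp: pad_zero_def)
  have "measure_pmf.prob (block_selection s i) (- good) \<le> (\<Sum>l\<le>i. halving_failure 20 s e l)"
    using block_selection_eig_close[of s i "pad_zero n A" n ev _ e 20] fam[unfolded N_def] mono entries s \<epsilon>
    by (simp add: good_def r_def \<mu>_def N_def e_def Collect_neg_eq)
  also have "\<dots> \<le> 2 * (\<Prod>q<20. real (2 * q + 1)) * 6144 ^ 20 / (real s ^ 8 * \<epsilon> ^ 20)"
    unfolding e_def by (rule halving_failure_sum[OF s(1) \<epsilon>])
  finally have bad: "measure_pmf.prob (block_selection s i) (- good)
      \<le> 2 * (\<Prod>q<20. real (2 * q + 1)) * 6144 ^ 20 / (real s ^ 8 * \<epsilon> ^ 20)" .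
  have "2 * r \<le> 2 * (3 * real N * (\<epsilon> / 12))"
    unfolding r_def e_def using geometric_error_sum[OF \<epsilon>, of i] by (intro mult_left_mono) auto
  also have "\<dots> = \<epsilon> * (N / 2)" by simp
  also have "\<dots> \<le> \<epsilon> * n"
  proof (intro mult_left_mono)
    have "real (s * 2 ^ i) \<le> real n" using s(2) by (simp only: of_nat_le_iff less_imp_le)
    then show "real N / 2 \<le> real n" by (simp add: N_def)
  qed (use \<epsilon> in simp)
  finally have r: "2 * r \<le> \<epsilon> * n" .
  let ?T = "{t. length (run A t) = n \<and> (\<forall>k<n. \<bar>run A t ! k - eigenvalues_desc A ! k\<bar> \<le> \<epsilon> * real n)}"
  have "good \<subseteq> read_sample n s (2 ^ Suc i) -` ?T"
  proof
    fix \<phi> assume "\<phi> \<in> good"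
    then have "eig_close n ev s (\<mu> \<phi>) (2 ^ Suc i) r" by (simp add: good_def)
    from order.trans[OF eig_close_estimate[OF this] r]
    have "\<forall>k<n. \<bar>2 ^ Suc i * (pos_eig s (\<mu> \<phi>) k - neg_eig s (\<mu> \<phi>) (n - Suc k)) - ev k\<bar> \<le> \<epsilon> * real n"
      by simp
    then show "\<phi> \<in> read_sample n s (2 ^ Suc i) -` ?T"
      using run_read_sample[of A n s "2 ^ Suc i" \<phi>]
      unfolding \<mu>_def[symmetric] by (simp add: ev_def del: power_Suc)
  qed
  then have "measure_pmf.prob (block_selection s i) good
      \<le> measure_pmf.prob (map_pmf (read_sample n s (2 ^ Suc i)) (block_selection s i)) ?T"
    unfolding measure_map_pmf by (intro measure_pmf.finite_measure_mono) auto
  moreover have "measure_pmf.prob (block_selection s i) (- good) = 1 - measure_pmf.prob (block_selection s i) good"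
    using measure_pmf.prob_compl[of good "block_selection s i"] by (simp add: Compl_eq_Diff_UNIV)
  ultimately show ?thesis using bad by linarith
qed

section \<open>Choice of the sample size\<close>

lemma smallest_power_of_two:
  fixes X :: real
  assumes "X \<ge> 1"
  obtains l where "X \<le> (2 ^ l)\<^sup>2" "(2 ^ l :: real)\<^sup>2 \<le> 4 * X"
proof -
  define P where "P l \<longleftrightarrow> X \<le> (2 ^ l :: real)\<^sup>2" for l :: nat
  obtain l0 :: nat where "X < 2 ^ l0" using real_arch_pow[of 2 X] by auto
  also have "(2 ^ l0 :: real) \<le> (2 ^ l0)\<^sup>2" by (rule power_increasing[of 1 2, simplified]) simp
  finally have "P l0" by (simp add: P_def)
  then obtain l where l: "P l" "\<And>l'. l' < l \<Longrightarrow> \<not> P l'" by (metis exists_least_iff)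
  have "(2 ^ l :: real)\<^sup>2 \<le> 4 * X"
  proof (cases l)
    case 0
    then show ?thesis using assms by simp
  next
    case (Suc l')
    then have "(2 ^ l' :: real)\<^sup>2 < X" using l(2)[of l'] by (simp add: P_def)
    then show ?thesis by (simp add: Suc power_mult_distrib)
  qed
  then show ?thesis using that l(1) by (simp add: P_def)
qed

lemma doubling_bracket:
  fixes s n :: nat
  assumes "s > 0" "s < n"
  obtains i where "s * 2 ^ i < n" "n \<le> s * 2 ^ Suc i"
proof -
  have "n \<le> s * 2 ^ n"
    using assms(1) less_exp[of n] by (metis le_trans less_imp_le mult_le_mono1 nat_mult_1 Suc_leI One_nat_def)
  then obtain i where i: "n \<le> s * 2 ^ i" "\<And>i'. i' < i \<Longrightarrow> \<not> n \<le> s * 2 ^ i'"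
    by (metis exists_least_iff[of "\<lambda>i. n \<le> s * 2 ^ i"])
  show ?thesis
  proof (cases i)
    case 0
    then show ?thesis using i(1) assms by simp
  next
    case (Suc i')
    then show ?thesis using i(1) i(2)[of i'] that[of i'] by simp
  qed
qed

text \<open>The failure bound is Q / (s^8 \<epsilon>^20). With s^2 at least Q / (\<epsilon>^5
  \<delta>), the powers of \<epsilon> cancel exactly and \<delta>^4 / Q^3 \<le> \<delta> remains.
  This explains the moment parameter 20: with p in its place a factor \<epsilon>^(p/4 - 5) would
  remain, which is bounded from p = 20 on. Rounding s to a power of two costs the factor 4 in the
  query bound.\<close>

theorem eigenvalue_estimation:
  fixes \<epsilon> \<delta> :: real and n :: nat
  defines "Q \<equiv> 2 * (\<Prod>q<20. real (2 * q + 1)) * 6144 ^ 20"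
  assumes \<epsilon>: "0 < \<epsilon>" "\<epsilon> < 1" and \<delta>: "0 < \<delta>" "\<delta> < 1"
  shows "\<exists>alg :: real list query_alg pmf. (\<forall>t \<in> set_pmf alg. queries_within n t) \<and>
    (\<forall>A. A \<in> carrier_mat n n \<longrightarrow> transpose_mat A = A \<longrightarrow> max_entry_norm A \<le> 1 \<longrightarrow>
      (\<forall>t \<in> set_pmf alg. real (num_queries A t) \<le> 4 * Q / (\<epsilon> ^ 5 * \<delta>)) \<and>
      measure_pmf.prob alg
        {t. length (run A t) = n \<and> (\<forall>k<n. \<bar>run A t ! k - eigenvalues_desc A ! k\<bar> \<le> \<epsilon> * real n)} \<ge> 1 - \<delta>)"
proof -
  define X where "X = Q / (\<epsilon> ^ 5 * \<delta>)"
  have "1 \<le> (\<Prod>q<20. real (2 * q + 1))" by (rule prod_ge_1) simp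
  then have "1 * 1 \<le> 2 * (\<Prod>q<20. real (2 * q + 1)) * 6144 ^ 20" by (intro mult_mono) auto
  then have Q: "Q \<ge> 1" by (simp add: Q_def)
  have ed: "0 < \<epsilon> ^ 5 * \<delta>" "\<epsilon> ^ 5 * \<delta> \<le> 1" using \<epsilon> \<delta> by (auto intro!: mult_le_one power_le_one)
  then have "X \<ge> 1" using Q by (simp add: X_def field_simps)
  then obtain l where l: "X \<le> (2 ^ l)\<^sup>2" "(2 ^ l :: real)\<^sup>2 \<le> 4 * X" using smallest_power_of_two by blast
  define s :: nat where "s = 2 ^ l"
  have s: "s > 0" "X \<le> (real s)\<^sup>2" "(real s)\<^sup>2 \<le> 4 * X" using l by (auto simp: s_def)
  have X4: "4 * Q / (\<epsilon> ^ 5 * \<delta>) = 4 * X" by (simp add: X_def)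
  show ?thesis
  proof (cases "n \<le> s")
    case True
    have "(real n)\<^sup>2 \<le> (real s)\<^sup>2" using True by (intro power_mono) auto
    then have "(real n)\<^sup>2 \<le> 4 * X" using s(3) by linarith
    moreover have "length (eigenvalues_desc A) = n" if "A \<in> carrier_mat n n" "transpose_mat A = A" for A
      by (rule spectral_family_eigenvalues_desc(1)[OF that])
    ultimately show ?thesis
      unfolding X4 using \<epsilon> \<delta>
      by (intro exI[of _ "return_pmf (read_all n)"])
        (auto simp: read_all_queries run_read_all indicator_def)
  next
    case False
    then obtain i where i: "s * 2 ^ i < n" "n \<le> s * 2 ^ Suc i" using doubling_bracket[of s n] s(1) by auto
    define alg where "alg = map_pmf (read_sample n s (2 ^ Suc i)) (block_selection s i)"
    have fail: "2 * (\<Prod>q<20. real (2 * q + 1)) * 6144 ^ 20 / (real s ^ 8 * \<epsilon> ^ 20) \<le> \<delta>"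
    proof -
      have "Q \<le> Q ^ 4" using Q by (rule self_le_power) simp
      also have "\<dots> = Q ^ 4 / \<delta> ^ 4 * \<delta> ^ 4" using \<delta> by simp
      also have "\<dots> \<le> Q ^ 4 / \<delta> ^ 4 * \<delta>"
        using \<delta> Q power_decreasing[of 1 4 \<delta>] by (intro mult_left_mono) auto
      also have "Q ^ 4 / \<delta> ^ 4 = X ^ 4 * \<epsilon> ^ 20"
        using \<epsilon> by (simp add: X_def power_divide power_mult_distrib flip: power_mult)
      also have "X ^ 4 * \<epsilon> ^ 20 * \<delta> \<le> ((real s)\<^sup>2) ^ 4 * \<epsilon> ^ 20 * \<delta>"
        using s(2) \<open>X \<ge> 1\<close> \<epsilon> \<delta> by (intro mult_right_mono power_mono) auto
      finally have "Q \<le> \<delta> * (real s ^ 8 * \<epsilon> ^ 20)" by (simp add: mult_ac flip: power_mult)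
      then have "Q / (real s ^ 8 * \<epsilon> ^ 20) \<le> \<delta>" using s(1) \<epsilon> by (simp add: pos_divide_le_eq)
      then show ?thesis unfolding Q_def .
    qed
    have q: "real (num_queries A t) \<le> 4 * X" if t: "t \<in> set_pmf alg" for A t
    proof -
      obtain \<phi> where "t = read_sample n s (2 ^ Suc i) \<phi>" using t unfolding alg_def set_map_pmf by blast
      then have "num_queries A t \<le> s\<^sup>2" using read_sample_queries(2) by simp
      then have "real (num_queries A t) \<le> (real s)\<^sup>2" by (metis of_nat_le_iff of_nat_power)
      then show ?thesis using s(3) by linarith
    qed
    have p: "measure_pmf.prob alg
        {t. length (run A t) = n \<and> (\<forall>k<n. \<bar>run A t ! k - eigenvalues_desc A ! k\<bar> \<le> \<epsilon> * real n)} \<ge> 1 - \<delta>"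
      if "A \<in> carrier_mat n n" "transpose_mat A = A" "max_entry_norm A \<le> 1" for A
      using read_sample_success[OF that \<epsilon>(1) s(1) i] fail unfolding alg_def by linarith
    show ?thesis
      unfolding X4 using q p
      by (intro exI[of _ alg]) (auto simp: alg_def read_sample_queries)
  qed
qed

theorem corollary1:
  shows "\<exists>(C::real) (alg :: nat \<Rightarrow> real \<Rightarrow> real \<Rightarrow> real list query_alg pmf). C > 0 \<and>
    (\<forall>(n::nat) (\<epsilon>::real) (\<delta>::real).
       n \<ge> 1 \<longrightarrow> 0 < \<epsilon> \<longrightarrow> \<epsilon> < 1 \<longrightarrow> 0 < \<delta> \<longrightarrow> \<delta> < 1 \<longrightarrow>
       (\<forall>t \<in> set_pmf (alg n \<epsilon> \<delta>). queries_within n t) \<and>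
       (\<forall>A :: real mat.
          A \<in> carrier_mat n n \<longrightarrow> transpose_mat A = A \<longrightarrow> max_entry_norm A \<le> 1 \<longrightarrow>
          (\<forall>t \<in> set_pmf (alg n \<epsilon> \<delta>).
             real (num_queries A t) \<le> soft_O_bound C (log1 (real n) ^ 3 / (\<epsilon> ^ 5 * \<delta>))) \<and>
          measure_pmf.prob (alg n \<epsilon> \<delta>)
            {t. length (run A t) = n \<and>
                (\<forall>i < n. \<bar>run A t ! i - eigenvalues_desc A ! i\<bar> \<le> \<epsilon> * real n)} \<ge> 1 - \<delta>))"
proof -
  define C :: real where "C = 4 * (2 * (\<Prod>q<20. real (2 * q + 1)) * 6144 ^ 20)"
  define spec where "spec n \<epsilon> \<delta> alg \<longleftrightarrow> (\<forall>t \<in> set_pmf alg. queries_within n t) \<and>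
    (\<forall>A. A \<in> carrier_mat n n \<longrightarrow> transpose_mat A = A \<longrightarrow> max_entry_norm A \<le> 1 \<longrightarrow>
      (\<forall>t \<in> set_pmf alg. real (num_queries A t) \<le> C / (\<epsilon> ^ 5 * \<delta>)) \<and>
      measure_pmf.prob alg
        {t. length (run A t) = n \<and> (\<forall>k<n. \<bar>run A t ! k - eigenvalues_desc A ! k\<bar> \<le> \<epsilon> * real n)} \<ge> 1 - \<delta>)"
    for n and \<epsilon> \<delta> :: real and alg :: "real list query_alg pmf"
  \<comment> \<open>The specification quantifies over \<open>A\<close> inside, so one choice for
    each n, \<epsilon>, \<delta> gives an algorithm that does not depend on the matrix.\<close>
  define alg where "alg n \<epsilon> \<delta> = (SOME p. spec n \<epsilon> \<delta> p)" for n and \<epsilon> \<delta> :: real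
  have C: "C > 0" unfolding C_def by (intro mult_pos_pos prod_pos) auto
  have alg: "spec n \<epsilon> \<delta> (alg n \<epsilon> \<delta>)" if "0 < \<epsilon>" "\<epsilon> < 1" "0 < \<delta>" "\<delta> < 1" for n and \<epsilon> \<delta> :: real
    unfolding alg_def by (rule someI_ex) (use eigenvalue_estimation[OF that, of n] in \<open>simp only: spec_def C_def\<close>)
  \<comment> \<open>Both \<open>log1 (real n) ^ 3\<close> and \<open>log1 f powr C\<close> are at
    least 1, so the bound free of n lies below the claimed one.\<close>
  have budget: "C / (\<epsilon> ^ 5 * \<delta>) \<le> soft_O_bound C (log1 (real n) ^ 3 / (\<epsilon> ^ 5 * \<delta>))"
    if "0 < \<epsilon>" "0 < \<delta>" for n and \<epsilon> \<delta> :: real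
  proof -
    have l: "log1 x \<ge> 1" for x by (simp add: log1_def)
    define f where "f = log1 (real n) ^ 3 / (\<epsilon> ^ 5 * \<delta>)"
    have "1 / (\<epsilon> ^ 5 * \<delta>) \<le> f"
      unfolding f_def using that l by (intro divide_right_mono one_le_power) auto
    moreover have "1 \<le> log1 f powr C"
      using l[of f] C by (intro ge_one_powr_ge_zero) auto
    moreover have "f \<ge> 0" unfolding f_def using that l[of n] by auto
    ultimately have "C * (1 / (\<epsilon> ^ 5 * \<delta>)) * 1 \<le> C * f * log1 f powr C"
      using C by (intro mult_mono mult_left_mono mult_nonneg_nonneg) auto
    then show ?thesis by (simp add: soft_O_bound_def f_def)
  qed
  show ?thesis
  proof (intro exI[of _ C] exI[of _ alg] conjI C allI impI)
    fix n :: nat and \<epsilon> \<delta> :: real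
    assume e: "0 < \<epsilon>" "\<epsilon> < 1" "0 < \<delta>" "\<delta> < 1"
    note * = alg[OF e, of n, unfolded spec_def]
    show "\<forall>t\<in>set_pmf (alg n \<epsilon> \<delta>). queries_within n t" using * by blast
    fix A :: "real mat"
    assume A: "A \<in> carrier_mat n n" "transpose_mat A = A" "max_entry_norm A \<le> 1"
    show "\<forall>t\<in>set_pmf (alg n \<epsilon> \<delta>). real (num_queries A t) \<le> soft_O_bound C (log1 (real n) ^ 3 / (\<epsilon> ^ 5 * \<delta>))"
      using * A budget[OF e(1,3), of n] order.trans by blast
    show "1 - \<delta> \<le> measure_pmf.prob (alg n \<epsilon> \<delta>)
        {t. length (run A t) = n \<and> (\<forall>i<n. \<bar>run A t ! i - eigenvalues_desc A ! i\<bar> \<le> \<epsilon> * real n)}"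
      using * A by blast
  qed
qed

end
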